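(* Let $\omega$ be a weight function with constants $K,b$, let $1\le p\le\infty$, $\tau\in(0,1)$ and $g\in\mathcal{S}_\omega(\mathbb{R}^N)$, $g\ne0$. (i) For every $\lambda\ge0$ and $f\in\mathcal{S}_\omega(\mathbb{R}^N)$, $$\|e^{\lambda\omega}Sp_gf\|_\infty\le D_\lambda^{(5)}\,\|e^{K\lambda\omega}\mathrm{Wig}_\tau(f)\|_p,$$ where $D_\lambda^{(5)}=e^{K\lambda}\|e^{K\lambda\omega}\mathrm{Wig}_{1-\tau}(\tilde g)\|_{p'}$ and $\tilde g(t):=g(-t)$. (ii) For every $\lambda\ge0$, $\mu>\frac{2N}{b}\left(K^2+\frac{2}{(2p)'}\right)$ and $f\in\mathcal{S}_\omega(\mathbb{R}^N)$, $$\|e^{\lambda\omega}\mathrm{Wig}_\tau(f)\|_\infty\le D_{\lambda,\mu}^{(6)}\,\|e^{(8K^4\lambda+\mu)\omega}Sp_gf\|_p,$$ where $$D^{(6)}_{\lambda,\mu}=\frac{e^{\frac K2(1+2K)\lambda}}{(2\pi)^{\frac52N}(\tau-\tau^2)^{\frac N2}\|g\|_2^4}\;\inf\Big[e^{K(1+2K)(4K^2\lambda+\mu')}\|e^{K^2(4K^2\lambda+\mu')\omega}g\|_\infty\,\|e^{K^2(4K^2\lambda+\mu')\omega}\hat g\|_\infty\,\|e^{-\mu'\omega}\|_{L^2(\mathbb{R}^{2N})}\,\|e^{-\mu''\omega}\|^2_{L^{(2p)'}(\mathbb{R}^{2N})}\Big],$$ the infimum being taken over all $\mu',\mu''$ with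 $2(K^2\mu'+\mu'')=\mu$, $\mu'>\frac Nb$ and $\mu''>\frac{2N}{b(2p)'}$.
   Context: A weight function is a continuous increasing (i.e. nondecreasing) function $\omega:[0,\infty)\to[0,\infty)$ such that: ($\alpha$) there is $K\ge1$ with $\omega(2t)\le K(1+\omega(t))$ for all $t\ge0$; ($\beta$) $\omega(t)=o(t)$ as $t\to\infty$; ($\gamma$) there are $a\in\mathbb{R}$, $b>0$ with $\omega(t)\ge a+b\log(1+t)$ for all $t\ge0$; ($\delta$) $t\mapsto\omega(e^t)$ is convex. $K$ and $b$ always denote the constants in ($\alpha$) and ($\gamma$). One extends $\omega$ to $\mathbb{R}^M$ by $\omega(z)=\omega(|z|)$; in particular $\omega(x,\xi)=\omega(|(x,\xi)|)$ on $\mathbb{R}^{2N}$. Fourier transform: $\hat f(\xi)=\int_{\mathbb{R}^N}e^{-ix\xi}f(x)\,dx$. $\mathcal{S}_\omega(\mathbb{R}^N)$ is the set of all $f\in L^1(\mathbb{R}^N)$ with $f,\hat f\in C^\infty(\mathbb{R}^N)$ and $\|e^{\lambda\omega}\partial^\alpha f\|_\infty<\infty$, $\|e^{\lambda\omega}\partial^\alpha\hat f\|_\infty<\infty$ for all $\lambda>0$, $\alpha\in\mathbb{N}_0^N$. Short-time Fourier transform: $V_gf(x,\xi)=\int_{\mathbb{R}^N}f(y)\overline{g(y-x)}e^{-iy\xi}\,dy$. Spectrogram: $Sp_gf(x,\xi)=|V_gf(x,\xi)|^2$. $\tau$-Wigner transform, $\tau\in[0,1]$: $\mathrm{Wig}_\tau(f)(x,\xi)=\int_{\mathbb{R}^N}e^{-it\xi}f(x+\tau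 t)\overline{f(x-(1-\tau)t)}\,dt$. $p'$ is the conjugate exponent of $p\in[1,\infty]$; $(2p)'$ is defined by $\frac1{2p}+\frac1{(2p)'}=1$, with $(2p)'=1$ for $p=\infty$. Norms of functions on $\mathbb{R}^N$ are in $L^q(\mathbb{R}^N)$, norms of functions on $\mathbb{R}^{2N}$ are in $L^q(\mathbb{R}^{2N})$. *)

theory Defs
  imports
    "HOL-Analysis.Analysis"
    "HOL-Library.Landau_Symbols"
    "HOL-Probability.Essential_Supremum"
begin

section \<open>Weight functions\<close>

text \<open>A weight function lives on \<open>[0,\<infinity>)\<close>; its values at negative reals are irrelevant throughout.\<close>

definition weight_doubling :: "(real \<Rightarrow> real) \<Rightarrow> real \<Rightarrow> bool" where
  "weight_doubling \<omega> K \<longleftrightarrow> 1 \<le> K \<and> (\<forall>t\<ge>0. \<omega> (2 * t) \<le> K * (1 + \<omega> t))"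

definition weight_log_bound :: "(real \<Rightarrow> real) \<Rightarrow> real \<Rightarrow> bool" where
  "weight_log_bound \<omega> b \<longleftrightarrow> 0 < b \<and> (\<exists>a. \<forall>t\<ge>0. a + b * ln (1 + t) \<le> \<omega> t)"

definition weight_function :: "(real \<Rightarrow> real) \<Rightarrow> bool" where
  "weight_function \<omega> \<longleftrightarrow>
     continuous_on {0..} \<omega> \<and> mono_on {0..} \<omega> \<and> (\<forall>t\<ge>0. 0 \<le> \<omega> t) \<and>
     (\<exists>K. weight_doubling \<omega> K) \<and>
     \<omega> \<in> o[at_top](\<lambda>t. t) \<and>
     (\<exists>b. weight_log_bound \<omega> b) \<and>
     convex_on UNIV (\<lambda>t. \<omega> (exp t))"

definition weighted ::
  "(real \<Rightarrow> real) \<Rightarrow> real \<Rightarrow> ('a::real_normed_vector \<Rightarrow> 'b::real_vector) \<Rightarrow> 'a \<Rightarrow> 'b" where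
  "weighted \<omega> lam f = (\<lambda>z. exp (lam * \<omega> (norm z)) *\<^sub>R f z)"

section \<open>Lebesgue norms with values in \<open>[0,\<infinity>]\<close>\<close>

definition Lnorm :: "ennreal \<Rightarrow> ('a::euclidean_space \<Rightarrow> 'b::real_normed_vector) \<Rightarrow> ennreal" where
  "Lnorm p f =
     (if p = \<infinity> then esssup lborel (\<lambda>x. ennreal (norm (f x)))
      else let I = (\<integral>\<^sup>+ x. ennreal (norm (f x) powr enn2real p) \<partial>lborel)
           in if I = \<infinity> then \<infinity> else ennreal (enn2real I powr (1 / enn2real p)))"

text \<open>In \<open>ennreal\<close> one has \<open>inverse 0 = \<infinity>\<close> and \<open>inverse \<infinity> = 0\<close>, which covers the endpoints
  \<open>p = 1\<close> and \<open>p = \<infinity>\<close>.\<close>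

definition conj_exponent :: "ennreal \<Rightarrow> ennreal" where
  "conj_exponent p = inverse (1 - inverse p)"

lemma inverse_add_inverse_conj_exponent:
  assumes "1 \<le> p"
  shows "inverse p + inverse (conj_exponent p) = 1"
proof -
  have "inverse p \<le> 1"
  proof (cases p)
    case (real r)
    with assms have "1 \<le> r" by simp
    then show ?thesis
      using real by (simp add: inverse_ennreal inverse_le_1_iff)
  qed simp
  moreover have "inverse (inverse x) = x" for x :: ennreal
  proof (cases x)
    case (real r)
    then show ?thesis
      by (cases "r = 0") (simp_all add: inverse_ennreal)
  qed simp
  ultimately show ?thesis
    by (simp add: conj_exponent_def add_diff_inverse_ennreal)
qed

section \<open>The space \<open>S\<^sub>\<omega>\<close>\<close>

definition fourier :: "(real ^ 'n \<Rightarrow> complex) \<Rightarrow> real ^ 'n \<Rightarrow> complex" where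
  "fourier f = (\<lambda>\<xi>. \<integral>x. exp (- \<i> * of_real (x \<bullet> \<xi>)) * f x \<partial>lborel)"

definition partial_deriv :: "'n \<Rightarrow> (real ^ 'n \<Rightarrow> complex) \<Rightarrow> real ^ 'n \<Rightarrow> complex" where
  "partial_deriv j f = (\<lambda>x. vector_derivative (\<lambda>h. f (x + h *\<^sub>R axis j 1)) (at 0))"

text \<open>A multi-index \<open>\<alpha>\<close> is encoded by a list of coordinate directions in which \<open>j\<close> occurs
  \<open>\<alpha>\<^sub>j\<close> times. Every multi-index arises, and on smooth functions the order of the list does not
  affect the derivative.\<close>

definition iter_partial_deriv :: "'n list \<Rightarrow> (real ^ 'n \<Rightarrow> complex) \<Rightarrow> real ^ 'n \<Rightarrow> complex" where
  "iter_partial_deriv js f = foldr partial_deriv js f"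

definition smooth_fun :: "(real ^ 'n \<Rightarrow> complex) \<Rightarrow> bool" where
  "smooth_fun f \<longleftrightarrow>
     (\<forall>js. continuous_on UNIV (iter_partial_deriv js f) \<and>
       (\<forall>j x. (\<lambda>h. iter_partial_deriv js f (x + h *\<^sub>R axis j 1)) differentiable (at (0::real))))"

text \<open>Elements are functions rather than classes modulo null sets: each class contains at most one
  continuous representative.\<close>

definition S_omega :: "(real \<Rightarrow> real) \<Rightarrow> (real ^ 'n \<Rightarrow> complex) set" where
  "S_omega \<omega> = {f. integrable lborel f \<and> smooth_fun f \<and> smooth_fun (fourier f) \<and>
     (\<forall>lam>0. \<forall>js. Lnorm \<infinity> (weighted \<omega> lam (iter_partial_deriv js f)) < \<infinity> \<and>
                   Lnorm \<infinity> (weighted \<omega> lam (iter_partial_deriv js (fourier f))) < \<infinity>)}"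

section \<open>Time-frequency representations\<close>

definition stft ::
  "(real ^ 'n \<Rightarrow> complex) \<Rightarrow> (real ^ 'n \<Rightarrow> complex) \<Rightarrow> (real ^ 'n) \<times> (real ^ 'n) \<Rightarrow> complex" where
  "stft g f = (\<lambda>(x, \<xi>). \<integral>y. f y * cnj (g (y - x)) * exp (- \<i> * of_real (y \<bullet> \<xi>)) \<partial>lborel)"

definition spectrogram ::
  "(real ^ 'n \<Rightarrow> complex) \<Rightarrow> (real ^ 'n \<Rightarrow> complex) \<Rightarrow> (real ^ 'n) \<times> (real ^ 'n) \<Rightarrow> real" where
  "spectrogram g f = (\<lambda>z. (cmod (stft g f z))\<^sup>2)"

definition wigner ::
  "real \<Rightarrow> (real ^ 'n \<Rightarrow> complex) \<Rightarrow> (real ^ 'n) \<times> (real ^ 'n) \<Rightarrow> complex" where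
  "wigner \<tau> f = (\<lambda>(x, \<xi>). \<integral>t. exp (- \<i> * of_real (t \<bullet> \<xi>)) *
       f (x + \<tau> *\<^sub>R t) * cnj (f (x - (1 - \<tau>) *\<^sub>R t)) \<partial>lborel)"

section \<open>The constants in the estimates\<close>

definition D5 ::
  "(real \<Rightarrow> real) \<Rightarrow> real \<Rightarrow> ennreal \<Rightarrow> real \<Rightarrow> (real ^ 'n \<Rightarrow> complex) \<Rightarrow> real \<Rightarrow> ennreal" where
  "D5 \<omega> K p \<tau> g lam =
     ennreal (exp (K * lam)) *
     Lnorm (conj_exponent p) (weighted \<omega> (K * lam) (wigner (1 - \<tau>) (\<lambda>t. g (- t))))"

definition D6 ::
  "(real \<Rightarrow> real) \<Rightarrow> real \<Rightarrow> real \<Rightarrow> ennreal \<Rightarrow> real \<Rightarrow> (real ^ 'n \<Rightarrow> complex) \<Rightarrow>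
   real \<Rightarrow> real \<Rightarrow> ennreal" where
  "D6 \<omega> K b p \<tau> g lam \<mu> =
     (let N = real CARD('n);
          q = conj_exponent (2 * p)
      in ennreal (exp (K / 2 * (1 + 2 * K) * lam)) /
           (ennreal ((2 * pi) powr (5 / 2 * N) * (\<tau> - \<tau>\<^sup>2) powr (N / 2)) * Lnorm 2 g ^ 4) *
         (INF (\<mu>', \<mu>'') \<in> {(\<mu>', \<mu>''). 2 * (K\<^sup>2 * \<mu>' + \<mu>'') = \<mu> \<and>
                               \<mu>' > N / b \<and> \<mu>'' > 2 * N / (b * enn2real q)}.
            ennreal (exp (K * (1 + 2 * K) * (4 * K\<^sup>2 * lam + \<mu>'))) *
            Lnorm \<infinity> (weighted \<omega> (K\<^sup>2 * (4 * K\<^sup>2 * lam + \<mu>')) g) *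
            Lnorm \<infinity> (weighted \<omega> (K\<^sup>2 * (4 * K\<^sup>2 * lam + \<mu>')) (fourier g)) *
            Lnorm 2 (\<lambda>z :: (real ^ 'n) \<times> (real ^ 'n). exp (- \<mu>' * \<omega> (norm z))) *
            (Lnorm q (\<lambda>z :: (real ^ 'n) \<times> (real ^ 'n). exp (- \<mu>'' * \<omega> (norm z))))\<^sup>2))"

end

theory Submission
  imports Defs "HOL-Probability.Characteristic_Functions" "HOL-Probability.Sinc_Integral"
begin

text \<open>Moyal's identity, combined with the covariance of the Wigner transform under time-frequency
  shifts, turns \<open>Sp\<^sub>g f\<close> into \<open>(2\<pi>)\<^sup>-\<^sup>N\<close> times the convolution of \<open>Wig\<^sub>\<tau> f\<close> with
  \<open>Wig\<^sub>1\<^sub>-\<^sub>\<tau>\<close> of the reflected window; distributing the weight by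
  \<open>\<omega> (z) \<le> K (1 + \<omega> (z - w) + \<omega> (w))\<close> and Hoelder's inequality give (i).
  For (ii), inserting the inversion formula for the short-time Fourier transform \<open>V\<close> into both
  arguments of \<open>Wig\<^sub>\<tau> f\<close> bounds it by a double integral of \<open>|V (z)| |V (w)|\<close> against translates of
  \<open>|Wig\<^sub>\<tau> g|\<close>. The latter is estimated by the geometric mean of its time-side bound (through \<open>g\<close>) and
  its frequency-side bound (through \<open>fourier g\<close>), and Hoelder's inequality with exponent \<open>2p\<close> for
  \<open>V\<close> concludes.\<close>

section \<open>Lebesgue norms and Hoelder's inequality\<close>

text \<open>Both sides of the estimates take values in [0,\<infinity>]. The expansion behind (ii)
  needs an integrable \<open>stft g f\<close>; if the weighted integral of its modulus diverges, the
  claim is rescued by showing that the right-hand side is infinite. As 0 * \<infinity> = 0 in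
  \<open>ennreal\<close>, this forces the proof to check that the factors of the constant, and the
  infimum itself, are nonzero. \<open>S_omega\<close> is accessed through its inclusion in
  \<open>wiener_algebra\<close>, where inversion, Parseval and Fubini hold pointwise, and through
  the continuity of \<open>fourier g\<close>. Origin of the constant in (ii): inverting twice gives
  (2 pi)^(-2N) and the fourth power of the L2 norm of g. The time-side bound has no power of 2 pi,
  the frequency-side bound has (2 pi)^(-N), so their geometric mean adds (2 pi)^(-N/2); both carry
  (\<tau> - \<tau>^2)^(-N/2), coming from the affine substitutions. The exponent 8 K^4 lam + \<mu>
  is 2 (a + \<mu>'') with a = K^2 (4 K^2 lam + \<mu>'), doubled in passing from |V| to its
  square.\<close>

lemma Lnorm_real:
  assumes "0 \<le> r"
  shows "Lnorm (ennreal r) f =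
    (let I = (\<integral>\<^sup>+ x. ennreal (norm (f x) powr r) \<partial>lborel)
     in if I = \<infinity> then \<infinity> else ennreal (enn2real I powr (1 / r)))"
  using assms by (simp add: Lnorm_def Let_def)

lemma Lnorm_infinity: "Lnorm \<infinity> f = esssup lborel (\<lambda>x. ennreal (norm (f x)))"
  by (simp add: Lnorm_def)

lemma Lnorm_1: "Lnorm 1 f = (\<integral>\<^sup>+ x. ennreal (norm (f x)) \<partial>lborel)"
  using Lnorm_real[of 1 f] by (auto simp: Let_def top.not_eq_extremum)

lemma Lnorm_cong_norm:
  "(\<And>x. norm (f x) = norm (g x)) \<Longrightarrow> Lnorm p f = Lnorm p g"
  by (simp add: Lnorm_def)

lemma Lnorm_infinity_AE:
  "AE x in lborel. ennreal (norm (f x)) \<le> Lnorm \<infinity> f"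
  unfolding Lnorm_infinity by (rule esssup_AE)

lemma Lnorm_infinity_le:
  fixes f :: "'a::euclidean_space \<Rightarrow> 'b::real_normed_vector"
  assumes [measurable]: "f \<in> borel_measurable borel" and "\<And>x. ennreal (norm (f x)) \<le> c"
  shows "Lnorm \<infinity> f \<le> c"
  unfolding Lnorm_infinity by (rule esssup_I) (use assms in auto)

text \<open>A nonempty open set is not a null set, so for continuous functions the essential
  supremum controls every single value. This turns weighted sup norms into pointwise decay.\<close>

lemma Lnorm_infinity_ge:
  fixes f :: "'a::euclidean_space \<Rightarrow> 'b::real_normed_vector"
  assumes "continuous_on UNIV f"
  shows "ennreal (norm (f x)) \<le> Lnorm \<infinity> f"
proof (rule ccontr)
  assume "\<not> ennreal (norm (f x)) \<le> Lnorm \<infinity> f"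
  then have lt: "Lnorm \<infinity> f < ennreal (norm (f x))" by simp
  then obtain c where c: "Lnorm \<infinity> f = ennreal c" "0 \<le> c"
    by (cases "Lnorm \<infinity> f") auto
  with lt have cx: "c < norm (f x)" by (simp add: ennreal_less_iff)
  let ?S = "{y. c < norm (f y)}"
  have "open ?S" using assms by (intro open_Collect_less continuous_intros)
  moreover have "x \<in> ?S" using cx by simp
  ultimately have "\<not> negligible ?S" using open_not_negligible by blast
  moreover have "AE y in lborel. y \<notin> ?S"
    using Lnorm_infinity_AE[of f] by eventually_elim (use c in \<open>auto simp: not_less\<close>)
  then have "?S \<in> null_sets lborel"
    using \<open>open ?S\<close> by (simp add: AE_iff_null)
  then have "negligible ?S" using negligible_iff_null_sets null_sets_completionI by blast
  ultimately show False by simp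
qed

lemma Lnorm_eq_0_AE:
  fixes f :: "'a::euclidean_space \<Rightarrow> 'b::real_normed_vector"
  assumes [measurable]: "f \<in> borel_measurable borel" and "0 < p" and "Lnorm p f = 0"
  shows "AE x in lborel. f x = 0"
proof (cases "p = \<infinity>")
  case True
  then show ?thesis using Lnorm_infinity_AE[of f] assms(3) by auto
next
  case False
  then obtain r where r: "p = ennreal r" "0 < r" using assms(2) by (cases p) auto
  let ?I = "\<integral>\<^sup>+ x. ennreal (norm (f x) powr r) \<partial>lborel"
  have "?I \<noteq> \<infinity>" and "enn2real ?I powr (1 / r) = 0"
    using assms(3) r by (auto simp: Lnorm_real Let_def ennreal_eq_0_iff split: if_splits)
  then have "?I = 0" by (auto simp: enn2real_eq_0_iff)
  then have "AE x in lborel. ennreal (norm (f x) powr r) = 0"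
    by (subst (asm) nn_integral_0_iff_AE) auto
  then show ?thesis by eventually_elim (auto simp: ennreal_eq_0_iff)
qed

lemma Lnorm_mono:
  fixes f :: "'a::euclidean_space \<Rightarrow> 'b::real_normed_vector" and g :: "'a \<Rightarrow> 'c::real_normed_vector"
  assumes [measurable]: "f \<in> borel_measurable borel" and le: "\<And>x. norm (f x) \<le> norm (g x)"
  shows "Lnorm p f \<le> Lnorm p g"
proof (cases "p = \<infinity>")
  case True
  then show ?thesis unfolding True Lnorm_infinity
    by (intro esssup_mono) (auto simp: le)
next
  case False
  then obtain r where r: "p = ennreal r" "0 \<le> r" by (cases p) auto
  let ?I = "\<lambda>f. \<integral>\<^sup>+ x. ennreal (f x powr r) \<partial>(lborel :: 'a measure)"
  have I: "?I (\<lambda>x. norm (f x)) \<le> ?I (\<lambda>x. norm (g x))"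
    by (intro nn_integral_mono ennreal_leI powr_mono2) (auto simp: r le)
  then have "enn2real (?I (\<lambda>x. norm (f x))) powr (1/r) \<le> enn2real (?I (\<lambda>x. norm (g x))) powr (1/r)"
    if "?I (\<lambda>x. norm (g x)) \<noteq> \<infinity>"
    using that r by (intro powr_mono2 enn2real_mono) (auto simp: top.not_eq_extremum)
  with I show ?thesis
    unfolding r(1) Lnorm_real[OF r(2)] Let_def by (auto simp: top_unique)
qed

lemma Lnorm_2_power2:
  "(Lnorm 2 f)\<^sup>2 = (\<integral>\<^sup>+ x. ennreal ((norm (f x))\<^sup>2) \<partial>lborel)"
proof -
  let ?I = "\<integral>\<^sup>+ x. ennreal ((norm (f x))\<^sup>2) \<partial>lborel"
  have "Lnorm 2 f = (if ?I = \<infinity> then \<infinity> else ennreal (sqrt (enn2real ?I)))"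
    using Lnorm_real[of 2 f] by (simp add: Let_def powr_numeral powr_half_sqrt)
  then show ?thesis
    by (auto simp: ennreal_power ennreal_top_mult top.not_eq_extremum power2_eq_square[of "top::ennreal"])
qed

text \<open>This is why the exponent \<open>2 * p\<close> appears: the spectrogram is the squared
  modulus of \<open>stft\<close>, so squaring an L^(2p) norm of the latter produces an L^p norm of
  the former.\<close>

lemma Lnorm_power2:
  fixes f :: "'a::euclidean_space \<Rightarrow> 'b::real_normed_vector"
  assumes [measurable]: "f \<in> borel_measurable borel" and "1 \<le> p"
  shows "(Lnorm (2 * p) f)\<^sup>2 = Lnorm p (\<lambda>x. (norm (f x))\<^sup>2)"
proof (cases "p = \<infinity>")
  case True
  have "2 * p = \<infinity>" using True by (simp add: ennreal_mult_top)
  have eq: "ennreal (norm ((norm (f x))\<^sup>2)) = (ennreal (norm (f x)))\<^sup>2" for x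
    by (simp add: ennreal_power)
  have "(Lnorm \<infinity> f)\<^sup>2 = Lnorm \<infinity> (\<lambda>x. (norm (f x))\<^sup>2)"
  proof (rule antisym)
    let ?c = "Lnorm \<infinity> (\<lambda>x. (norm (f x))\<^sup>2)"
    show "(Lnorm \<infinity> f)\<^sup>2 \<le> ?c"
    proof (cases "?c")
      case (real c)
      have "AE x in lborel. ennreal (norm (f x)) \<le> ennreal (sqrt c)"
        using Lnorm_infinity_AE[of "\<lambda>x. (norm (f x))\<^sup>2"]
        by eventually_elim (use real in \<open>auto simp: real_le_rsqrt\<close>)
      then have "Lnorm \<infinity> f \<le> ennreal (sqrt c)"
        unfolding Lnorm_infinity by (intro esssup_I) auto
      then have "(Lnorm \<infinity> f)\<^sup>2 \<le> (ennreal (sqrt c))\<^sup>2" by (rule power_mono) simp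
      then show ?thesis using real by (simp add: ennreal_power)
    qed simp
    have "AE x in lborel. ennreal (norm ((norm (f x))\<^sup>2)) \<le> (Lnorm \<infinity> f)\<^sup>2"
      using Lnorm_infinity_AE[of f] by eventually_elim (unfold eq, rule power_mono, auto)
    then show "?c \<le> (Lnorm \<infinity> f)\<^sup>2"
      unfolding Lnorm_infinity by (intro esssup_I) auto
  qed
  with \<open>2 * p = \<infinity>\<close> True show ?thesis by simp
next
  case False
  then obtain r where r: "p = ennreal r" "1 \<le> r" using assms(2) by (cases p) auto
  have 2: "2 * ennreal r = ennreal (2 * r)" using r by (simp add: ennreal_mult)
  have eq: "norm ((norm (f x))\<^sup>2) powr r = norm (f x) powr (2 * r)" for x
    using r by (cases "f x = 0") (auto simp: powr_powr[symmetric] powr_numeral)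
  have eq2: "(y powr (1 / (2 * r)))\<^sup>2 = y powr (1 / r)" if "0 \<le> y" for y
    using r that by (cases "y = 0") (auto simp: powr_powr simp flip: powr_numeral)
  show ?thesis
  proof -
    have "0 \<le> 2 * r" "0 \<le> r" using r by auto
    then show ?thesis
      unfolding r(1) 2 Lnorm_real[OF \<open>0 \<le> 2 * r\<close>] Lnorm_real[OF \<open>0 \<le> r\<close>] eq Let_def
      by (simp add: eq2 ennreal_power ennreal_top_mult power2_eq_square[of "top::ennreal"])
  qed
qed

lemma conj_exponent_infinity: "conj_exponent \<infinity> = 1"
  by (simp add: conj_exponent_def)

lemma conj_exponent_1: "conj_exponent 1 = \<infinity>"
  by (simp add: conj_exponent_def)

lemma conj_exponent_real:
  assumes "1 < r"
  shows "conj_exponent (ennreal r) = ennreal (r / (r - 1))"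
proof -
  have "1 - inverse (ennreal r) = ennreal (1 - 1 / r)"
    using assms by (simp add: inverse_ennreal ennreal_minus[symmetric] inverse_eq_divide)
  then show ?thesis
    unfolding conj_exponent_def using assms by (simp add: inverse_ennreal field_simps)
qed

lemma Holder_real:
  fixes f :: "'a::euclidean_space \<Rightarrow> 'b::real_normed_vector"
    and g :: "'a \<Rightarrow> 'c::real_normed_vector"
  assumes [measurable]: "f \<in> borel_measurable borel" "g \<in> borel_measurable borel"
    and p: "1 < p" and q: "1 < q" and pq: "1 / p + 1 / q = 1"
  shows "(\<integral>\<^sup>+ x. ennreal (norm (f x) * norm (g x)) \<partial>lborel) \<le> Lnorm (ennreal p) f * Lnorm (ennreal q) g"
\<comment> \<open>Since 0 * \<infinity> = 0 in \<open>ennreal\<close>, a vanishing norm must be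
  shown to kill the integrand almost everywhere, even when the other norm is infinite. Once both
  norms are nonzero, an infinite one makes the bound trivial.\<close>
proof (cases "Lnorm (ennreal p) f = 0 \<or> Lnorm (ennreal q) g = 0")
  case True
  then have "AE x in lborel. f x = 0 \<or> g x = 0"
    using Lnorm_eq_0_AE[of f "ennreal p"] Lnorm_eq_0_AE[of g "ennreal q"] p q by auto
  then have "AE x in lborel. ennreal (norm (f x) * norm (g x)) = 0"
    by eventually_elim auto
  then have "(\<integral>\<^sup>+ x. ennreal (norm (f x) * norm (g x)) \<partial>lborel) = 0"
    by (subst nn_integral_0_iff_AE) auto
  then show ?thesis by simp
next
  case False
  show ?thesis
  proof (cases "Lnorm (ennreal p) f = \<infinity> \<or> Lnorm (ennreal q) g = \<infinity>")
    case True
    with False show ?thesis by (auto simp: ennreal_top_mult ennreal_mult_top)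
  next
    case fin: False
    define I where "I = (\<integral>\<^sup>+ x. ennreal (norm (f x) powr p) \<partial>lborel)"
    define J where "J = (\<integral>\<^sup>+ x. ennreal (norm (g x) powr q) \<partial>lborel)"
    have "I \<noteq> \<infinity>" "J \<noteq> \<infinity>" and LI: "Lnorm (ennreal p) f = ennreal (enn2real I powr (1 / p))"
      and LJ: "Lnorm (ennreal q) g = ennreal (enn2real J powr (1 / q))"
      using fin p q by (auto simp: Lnorm_real Let_def I_def J_def split: if_splits)
    then obtain i j where ij: "I = ennreal i" "0 \<le> i" "J = ennreal j" "0 \<le> j"
      by (cases I; cases J) auto
    have i: "0 < i" and j: "0 < j"
      using False LI LJ ij by (auto simp: less_le)
    \<comment> \<open>Both functions are normalised by their norms a and b before Young's inequality
      is applied pointwise; up to the common factor a * b the two terms then integrate to 1/p and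
      1/q.\<close>
    define a where "a = i powr (1 / p)"
    define b where "b = j powr (1 / q)"
    have ab: "0 < a" "0 < b" "a powr p = i" "b powr q = j"
      using i j p q by (auto simp: a_def b_def powr_powr)
    have *: "norm (f x) * norm (g x) \<le> a * b / (p * i) * norm (f x) powr p + a * b / (q * j) * norm (g x) powr q" for x
    proof -
      have "(norm (f x) / a) * (norm (g x) / b) \<le> (norm (f x) / a) powr p / p + (norm (g x) / b) powr q / q"
        using ab by (intro Youngs_inequality p q pq) auto
      also have "\<dots> = norm (f x) powr p / i / p + norm (g x) powr q / j / q"
        using ab by (simp add: powr_divide)
      finally have "a * b * ((norm (f x) / a) * (norm (g x) / b))
          \<le> a * b * (norm (f x) powr p / i / p + norm (g x) powr q / j / q)"
        using ab by (intro mult_left_mono) auto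
      then show ?thesis using ab by (simp add: field_simps)
    qed
    have "(\<integral>\<^sup>+ x. ennreal (norm (f x) * norm (g x)) \<partial>lborel)
        \<le> (\<integral>\<^sup>+ x. ennreal (a * b / (p * i)) * ennreal (norm (f x) powr p) +
               ennreal (a * b / (q * j)) * ennreal (norm (g x) powr q) \<partial>lborel)"
      using ab i j p q
      by (intro nn_integral_mono) (use * in \<open>simp add: ennreal_mult'[symmetric] ennreal_plus[symmetric] del: ennreal_plus\<close>)
    also have "\<dots> = ennreal (a * b / (p * i)) * I + ennreal (a * b / (q * j)) * J"
      unfolding I_def J_def by (subst nn_integral_add) (auto simp: nn_integral_cmult)
    also have "\<dots> = ennreal (a * b / (p * i) * i + a * b / (q * j) * j)"
      using ij ab p q i j by (simp add: ennreal_mult'[symmetric] ennreal_plus[symmetric] del: ennreal_plus)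
    also have "a * b / (p * i) * i + a * b / (q * j) * j = a * b * (1 / p + 1 / q)"
      using i j by (simp add: field_simps)
    also have "ennreal (a * b * (1 / p + 1 / q)) = Lnorm (ennreal p) f * Lnorm (ennreal q) g"
      unfolding pq LI LJ using ij ab by (simp add: a_def b_def ennreal_mult)
    finally show ?thesis .
  qed
qed

lemma Holder_infinity:
  fixes f :: "'a::euclidean_space \<Rightarrow> 'b::real_normed_vector"
    and g :: "'a \<Rightarrow> 'c::real_normed_vector"
  assumes [measurable]: "f \<in> borel_measurable borel" "g \<in> borel_measurable borel"
  shows "(\<integral>\<^sup>+ x. ennreal (norm (f x) * norm (g x)) \<partial>lborel) \<le> Lnorm \<infinity> f * Lnorm 1 g"
proof -
  have "(\<integral>\<^sup>+ x. ennreal (norm (f x) * norm (g x)) \<partial>lborel)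
      \<le> (\<integral>\<^sup>+ x. Lnorm \<infinity> f * ennreal (norm (g x)) \<partial>lborel)"
    using Lnorm_infinity_AE[of f]
    by (intro nn_integral_mono_AE, eventually_elim) (auto simp: ennreal_mult mult_right_mono)
  then show ?thesis by (simp add: nn_integral_cmult Lnorm_1)
qed

theorem Lnorm_Holder:
  fixes f :: "'a::euclidean_space \<Rightarrow> 'b::real_normed_vector"
    and g :: "'a \<Rightarrow> 'c::real_normed_vector"
  assumes [measurable]: "f \<in> borel_measurable borel" "g \<in> borel_measurable borel" and "1 \<le> p"
  shows "(\<integral>\<^sup>+ x. ennreal (norm (f x) * norm (g x)) \<partial>lborel) \<le> Lnorm p f * Lnorm (conj_exponent p) g"
proof (cases p)
  case top
  then show ?thesis using Holder_infinity[of f g] by (simp add: conj_exponent_infinity[simplified])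
next
  case (real r)
  then have "1 \<le> r" using assms(3) by simp
  show ?thesis
  proof (cases "r = 1")
    case True
    then show ?thesis using Holder_infinity[of g f] real by (simp add: conj_exponent_1 mult.commute)
  next
    case False
    with \<open>1 \<le> r\<close> have "1 < r" by simp
    moreover then have "1 < r / (r - 1)" "1 / r + 1 / (r / (r - 1)) = 1"
      by (auto simp: field_simps)
    ultimately show ?thesis
      using Holder_real[of f g r "r / (r - 1)"] by (simp add: real conj_exponent_real)
  qed
qed

section \<open>Fourier inversion\<close>

text \<open>The product of integrable functions of separate variables is integrable on the product
  space, and a bounded kernel does not spoil this. Interchanges with an oscillating factor
  (inversion, transforms of products, Parseval, expansion into time-frequency shifts) are
  instances.\<close>

lemma Fubini_bounded_kernel:
  fixes a :: "'a::euclidean_space \<Rightarrow> complex" and V :: "'b::euclidean_space \<Rightarrow> complex"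
    and k :: "'b \<Rightarrow> 'a \<Rightarrow> complex"
  assumes a: "integrable lborel a" and V: "integrable lborel V"
    and k [measurable]: "case_prod k \<in> borel_measurable (borel \<Otimes>\<^sub>M borel)"
    and C: "\<And>z t. cmod (k z t) \<le> C"
  shows "(\<integral>t. a t * (\<integral>z. V z * k z t \<partial>lborel) \<partial>lborel) = (\<integral>z. V z * (\<integral>t. a t * k z t \<partial>lborel) \<partial>lborel)"
    and "integrable lborel (\<lambda>z. V z * (\<integral>t. a t * k z t \<partial>lborel))"
proof -
  have [measurable]: "a \<in> borel_measurable borel" "V \<in> borel_measurable borel"
    using a V by auto
  have C0: "0 \<le> C" using C norm_ge_zero order_trans by blast
  let ?h = "\<lambda>z t. V z * (a t * k z t)"
  have int: "integrable (lborel \<Otimes>\<^sub>M lborel) (case_prod ?h)"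
  proof (rule integrableI_bounded)
    have "(\<integral>\<^sup>+ w. ennreal (cmod (case_prod ?h w)) \<partial>(lborel \<Otimes>\<^sub>M lborel))
        = (\<integral>\<^sup>+ z. (\<integral>\<^sup>+ t. ennreal (cmod (?h z t)) \<partial>lborel) \<partial>lborel)"
      by (subst lborel.nn_integral_fst[symmetric]) (auto simp del: lborel_prod)
    also have "\<dots> \<le> (\<integral>\<^sup>+ z. (\<integral>\<^sup>+ t. ennreal C * ennreal (cmod (V z)) * ennreal (cmod (a t)) \<partial>lborel) \<partial>lborel)"
    proof (intro nn_integral_mono)
      fix z :: 'b and t :: 'a
      have "cmod (?h z t) \<le> cmod (V z) * (cmod (a t) * C)"
        unfolding norm_mult by (intro mult_left_mono C) auto
      then show "ennreal (cmod (?h z t)) \<le> ennreal C * ennreal (cmod (V z)) * ennreal (cmod (a t))"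
        using C0 by (simp add: ennreal_mult[symmetric] mult_ac ennreal_leI)
    qed
    also have "\<dots> = ennreal C * (\<integral>\<^sup>+ z. ennreal (cmod (V z)) \<partial>lborel) * (\<integral>\<^sup>+ t. ennreal (cmod (a t)) \<partial>lborel)"
      by (simp add: nn_integral_cmult nn_integral_multc mult_ac)
    also have "\<dots> < \<infinity>"
      using a V by (simp add: integrable_iff_bounded ennreal_mult_less_top)
    finally show "(\<integral>\<^sup>+ w. ennreal (cmod (case_prod ?h w)) \<partial>(lborel \<Otimes>\<^sub>M lborel)) < \<infinity>" .
  qed (simp del: lborel_prod)
  have "(\<integral>t. a t * (\<integral>z. V z * k z t \<partial>lborel) \<partial>lborel) = (\<integral>t. (\<integral>z. ?h z t \<partial>lborel) \<partial>lborel)"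
    by (simp add: mult_ac flip: integral_mult_right_zero)
  also have "\<dots> = (\<integral>z. (\<integral>t. ?h z t \<partial>lborel) \<partial>lborel)"
    by (rule lborel_pair.Fubini_integral[OF int])
  finally show "(\<integral>t. a t * (\<integral>z. V z * k z t \<partial>lborel) \<partial>lborel) = (\<integral>z. V z * (\<integral>t. a t * k z t \<partial>lborel) \<partial>lborel)"
    by simp
  show "integrable lborel (\<lambda>z. V z * (\<integral>t. a t * k z t \<partial>lborel))"
    using lborel_pair.integrable_fst[OF int] by simp
qed

section \<open>Affine substitutions and coordinatewise products in Lebesgue integrals\<close>

lemma nn_integral_lborel_affine:
  fixes f :: "'a::euclidean_space \<Rightarrow> ennreal"
  assumes [measurable]: "f \<in> borel_measurable borel" and c: "c \<noteq> 0"
  shows "(\<integral>\<^sup>+ x. f x \<partial>lborel) = ennreal (\<bar>c\<bar> ^ DIM('a)) * (\<integral>\<^sup>+ x. f (t + c *\<^sub>R x) \<partial>lborel)"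
  by (subst lborel_affine[OF c, of t])
     (simp add: nn_integral_density nn_integral_distr nn_integral_cmult)

lemma integrable_lborel_affine:
  fixes f :: "'a::euclidean_space \<Rightarrow> 'b :: {banach, second_countable_topology}"
  assumes f: "integrable lborel f" and c: "c \<noteq> 0"
  shows "integrable lborel (\<lambda>x. f (t + c *\<^sub>R x))"
  using f f[THEN borel_measurable_integrable] c unfolding integrable_iff_bounded
  by (subst (asm) nn_integral_lborel_affine[where c=c and t=t]) (auto simp: ennreal_mult_less_top)

lemma integral_lborel_affine:
  fixes f :: "'a::euclidean_space \<Rightarrow> 'b :: {banach, second_countable_topology}"
  assumes c: "c \<noteq> 0"
  shows "(\<integral>x. f x \<partial>lborel) = \<bar>c\<bar> ^ DIM('a) *\<^sub>R (\<integral>x. f (t + c *\<^sub>R x) \<partial>lborel)"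
proof cases
  assume f [measurable]: "integrable lborel f"
  then show ?thesis
    using c f[THEN borel_measurable_integrable] integrable_lborel_affine[OF f c, of t]
    by (subst lborel_affine[OF c, of t]) (simp add: integral_density integral_distr)
next
  \<comment> \<open>Both integrals have the default value 0 here: the inverse substitution would
    carry integrability back to f.\<close>
  assume nf: "\<not> integrable lborel f"
  have "\<not> integrable lborel (\<lambda>x. f (t + c *\<^sub>R x))"
  proof
    assume "integrable lborel (\<lambda>x. f (t + c *\<^sub>R x))"
    from integrable_lborel_affine[OF this, of "inverse c" "- t /\<^sub>R c"] c
    have "integrable lborel f" by (simp add: scaleR_diff_right)
    with nf show False ..
  qed
  with nf show ?thesis by (simp add: not_integrable_integral_eq)
qed

lemma lborel_integral_prod:
  fixes f :: "'a::euclidean_space \<Rightarrow> real \<Rightarrow> complex"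
  assumes "\<And>b. b \<in> Basis \<Longrightarrow> integrable lborel (f b)"
  shows "integrable lborel (\<lambda>x. \<Prod>b\<in>Basis. f b (x \<bullet> b))"
    and "(\<integral>x. (\<Prod>b\<in>Basis. f b (x \<bullet> b)) \<partial>lborel) = (\<Prod>b\<in>Basis. (\<integral>x. f b x \<partial>lborel))"
proof -
  interpret product_sigma_finite "\<lambda>_::'a. lborel :: real measure" by standard
  have m: "f b \<in> borel_measurable borel" if "b \<in> Basis" for b
    using assms[OF that] by auto
  then have meas: "(\<lambda>x. \<Prod>b\<in>Basis. f b (x \<bullet> b)) \<in> borel_measurable borel"
    by (intro borel_measurable_prod) (rule measurable_compose[of "\<lambda>x. x \<bullet> _"], auto)
  have T: "(\<lambda>g. \<Sum>b\<in>Basis. g b *\<^sub>R b) \<in> (\<Pi>\<^sub>M b\<in>Basis. lborel :: real measure) \<rightarrow>\<^sub>M (borel :: 'a measure)"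
    by measurable
  have eq: "(\<Prod>b\<in>Basis. f b ((\<Sum>b\<in>Basis. g b *\<^sub>R b) \<bullet> b)) = (\<Prod>b\<in>Basis. f b (g b))" for g :: "'a \<Rightarrow> real"
    by (intro prod.cong) auto
  show "integrable lborel (\<lambda>x. \<Prod>b\<in>Basis. f b (x \<bullet> b))"
    by (subst lborel_eq[where 'a='a], subst integrable_distr_eq[OF T meas])
      (unfold eq, intro product_integrable_prod assms finite_Basis)
  show "(\<integral>x. (\<Prod>b\<in>Basis. f b (x \<bullet> b)) \<partial>lborel) = (\<Prod>b\<in>Basis. (\<integral>x. f b x \<partial>lborel))"
    by (subst lborel_eq[where 'a='a], subst integral_distr[OF T meas])
      (unfold eq, intro product_integral_prod assms finite_Basis)
qed

text \<open>Up to the normalisation sqrt (2 * pi) this is the characteristic function of the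
  standard normal distribution.\<close>

lemma gaussian_integral_real:
  fixes t :: real
  shows "integrable lborel (\<lambda>x::real. exp (\<i> * of_real (x * t)) * of_real (exp (- x\<^sup>2 / 2)))"
    and "(\<integral>x. exp (\<i> * of_real (x * t)) * of_real (exp (- x\<^sup>2 / 2)) \<partial>lborel)
      = of_real (sqrt (2 * pi) * exp (- t\<^sup>2 / 2))"
proof -
  have dens: "exp (- x\<^sup>2 / 2) = sqrt (2 * pi) * std_normal_density x" for x :: real
    by (simp add: normal_density_def real_sqrt_mult)
  have "integrable lborel (\<lambda>x::real. of_real (std_normal_density x) :: complex)"
    by (intro integrable_of_real) simp
  then have "integrable lborel (\<lambda>x::real. of_real (exp (- x\<^sup>2 / 2)) :: complex)"
    unfolding dens of_real_mult by (rule integrable_mult_right)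
  then show "integrable lborel (\<lambda>x::real. exp (\<i> * of_real (x * t)) * of_real (exp (- x\<^sup>2 / 2)))"
    by (rule Bochner_Integration.integrable_bound) (auto simp: norm_mult)
  have "char std_normal_distribution t = (\<integral>x. std_normal_density x *\<^sub>R iexp (t * x) \<partial>lborel)"
    unfolding char_def by (rule integral_density) (auto simp: normal_density_nonneg)
  then have char: "(\<integral>x. std_normal_density x *\<^sub>R iexp (t * x) \<partial>lborel) = of_real (exp (- t\<^sup>2 / 2))"
    by (simp add: char_std_normal_distribution)
  have "(\<integral>x. exp (\<i> * of_real (x * t)) * of_real (exp (- x\<^sup>2 / 2)) \<partial>lborel)
      = (\<integral>x. of_real (sqrt (2 * pi)) * (std_normal_density x *\<^sub>R iexp (t * x)) \<partial>lborel)"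
    unfolding dens by (intro Bochner_Integration.integral_cong) (auto simp: scaleR_conv_of_real mult_ac)
  also have "\<dots> = of_real (sqrt (2 * pi)) * (\<integral>x. (std_normal_density x *\<^sub>R iexp (t * x)) \<partial>lborel)"
    by (rule integral_mult_right_zero)
  finally show "(\<integral>x. exp (\<i> * of_real (x * t)) * of_real (exp (- x\<^sup>2 / 2)) \<partial>lborel)
      = of_real (sqrt (2 * pi) * exp (- t\<^sup>2 / 2))"
    unfolding char by simp
qed

lemma gaussian_integral:
  fixes \<xi> :: "'a::euclidean_space"
  shows "integrable lborel (\<lambda>x::'a. exp (\<i> * of_real (x \<bullet> \<xi>)) * of_real (exp (- (norm x)\<^sup>2 / 2)))"
    and "(\<integral>x. exp (\<i> * of_real (x \<bullet> \<xi>)) * of_real (exp (- (norm x)\<^sup>2 / 2)) \<partial>lborel)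
      = of_real (sqrt (2 * pi) ^ DIM('a) * exp (- (norm \<xi>)\<^sup>2 / 2))"
proof -
  define f where "f b = (\<lambda>x::real. exp (\<i> * of_real (x * (\<xi> \<bullet> b))) * of_real (exp (- x\<^sup>2 / 2)))" for b
  have int: "integrable lborel (f b)" for b unfolding f_def by (rule gaussian_integral_real)
  have nrm: "exp (- (norm (x::'a))\<^sup>2 / 2) = (\<Prod>b\<in>Basis. exp (- (x \<bullet> b)\<^sup>2 / 2))" for x
  proof -
    have "- (norm x)\<^sup>2 / 2 = (\<Sum>b\<in>Basis. - (x \<bullet> b)\<^sup>2 / 2)"
      unfolding power2_norm_eq_inner
      by (subst euclidean_inner) (simp add: sum_negf sum_divide_distrib power2_eq_square)
    then show ?thesis by (simp only: exp_sum finite_Basis)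
  qed
  have osc: "exp (\<i> * of_real (x \<bullet> \<xi>)) = (\<Prod>b\<in>Basis. exp (\<i> * of_real ((x \<bullet> b) * (\<xi> \<bullet> b))))" for x
  proof -
    have "\<i> * of_real (x \<bullet> \<xi>) = (\<Sum>b\<in>Basis. \<i> * of_real ((x \<bullet> b) * (\<xi> \<bullet> b)))"
      by (subst euclidean_inner) (simp add: sum_distrib_left)
    then show ?thesis by (simp only: exp_sum finite_Basis)
  qed
  have eq: "(\<lambda>x::'a. exp (\<i> * of_real (x \<bullet> \<xi>)) * of_real (exp (- (norm x)\<^sup>2 / 2))) = (\<lambda>x. \<Prod>b\<in>Basis. f b (x \<bullet> b))"
    unfolding osc nrm f_def by (simp add: prod.distrib of_real_prod)
  show "integrable lborel (\<lambda>x::'a. exp (\<i> * of_real (x \<bullet> \<xi>)) * of_real (exp (- (norm x)\<^sup>2 / 2)))"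
    unfolding eq by (rule lborel_integral_prod) (rule int)
  have "(\<integral>x. exp (\<i> * of_real (x \<bullet> \<xi>)) * of_real (exp (- (norm x)\<^sup>2 / 2)) \<partial>lborel)
      = (\<Prod>b\<in>Basis. of_real (sqrt (2 * pi) * exp (- (\<xi> \<bullet> b)\<^sup>2 / 2)))"
    unfolding eq lborel_integral_prod(2)[OF int] unfolding f_def gaussian_integral_real ..
  also have "\<dots> = of_real (sqrt (2 * pi) ^ DIM('a) * exp (- (norm \<xi>)\<^sup>2 / 2))"
    unfolding nrm by (simp add: prod.distrib of_real_prod)
  finally show "(\<integral>x. exp (\<i> * of_real (x \<bullet> \<xi>)) * of_real (exp (- (norm x)\<^sup>2 / 2)) \<partial>lborel)
      = of_real (sqrt (2 * pi) ^ DIM('a) * exp (- (norm \<xi>)\<^sup>2 / 2))" .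
qed

lemma integrable_unimodular_mult:
  fixes f :: "'a::euclidean_space \<Rightarrow> complex"
  assumes f: "integrable lborel f" and [measurable]: "u \<in> borel_measurable borel" and "\<And>x. cmod (u x) \<le> 1"
  shows "integrable lborel (\<lambda>x. u x * f x)" "integrable lborel (\<lambda>x. f x * u x)"
proof -
  have [measurable]: "f \<in> borel_measurable borel" using f by auto
  show "integrable lborel (\<lambda>x. u x * f x)"
    by (rule Bochner_Integration.integrable_bound[OF f])
      (use assms in \<open>auto simp: norm_mult mult_left_le_one_le\<close>)
  then show "integrable lborel (\<lambda>x. f x * u x)" by (simp add: mult.commute)
qed

lemma borel_measurable_fourier [measurable]:
  assumes [measurable]: "f \<in> borel_measurable borel"
  shows "fourier f \<in> borel_measurable borel"
proof -
  have [measurable]: "f \<in> borel_measurable lborel" by simp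
  show ?thesis unfolding fourier_def by measurable
qed

text \<open>The two integrability conditions are those of the inversion theorem, continuity makes
  inversion hold at every point, and boundedness supplies its dominating function and makes products
  integrable. The class is stable under affine substitution, modulation, conjugation and products,
  so the slices whose Fourier transforms are \<open>stft\<close> and \<open>wigner\<close> (for 0 <
  \<tau> < 1) stay inside it.\<close>

definition wiener_algebra :: "(real ^ 'n \<Rightarrow> complex) set" where
  "wiener_algebra = {f. continuous_on UNIV f \<and> bounded (range f) \<and>
     integrable lborel f \<and> integrable lborel (fourier f)}"

text \<open>Gaussian regularisation: the integral damped by \<gamma>(\<epsilon> \<xi>) tends to the
  undamped one, dominated by the modulus of \<open>fourier f\<close>. By Fubini it is also an
  average of f over a Gaussian of width \<epsilon> around x, which tends to a multiple of f x
  because f is continuous and bounded.\<close>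

lemma fourier_inversion:
  fixes f :: "real ^ 'n \<Rightarrow> complex"
  assumes "f \<in> wiener_algebra"
  shows "(\<integral>\<xi>. fourier f \<xi> * exp (\<i> * of_real (x \<bullet> \<xi>)) \<partial>lborel) = of_real ((2 * pi) ^ CARD('n)) * f x"
proof -
  have cont: "continuous_on UNIV f" and bdd: "bounded (range f)" and int: "integrable lborel f"
    and intF: "integrable lborel (fourier f)"
    using assms by (auto simp: wiener_algebra_def)
  have [measurable]: "f \<in> borel_measurable borel" using int by auto
  have [measurable]: "fourier f \<in> borel_measurable borel" by measurable
  obtain B where B: "\<And>x. cmod (f x) \<le> B" using bdd by (auto simp: bounded_iff)
  define \<gamma> where "\<gamma> x = exp (- (norm x)\<^sup>2 / 2)" for x :: "real ^ 'n"
  have [measurable]: "\<gamma> \<in> borel_measurable borel" unfolding \<gamma>_def by measurable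
  define \<epsilon> where "\<epsilon> n = 1 / real (Suc n)" for n
  have \<epsilon>: "0 < \<epsilon> n" for n by (simp add: \<epsilon>_def)
  have \<epsilon>0: "\<epsilon> \<longlonglongrightarrow> 0" unfolding \<epsilon>_def using LIMSEQ_inverse_real_of_nat by (simp add: inverse_eq_divide)
  have \<gamma>1: "\<bar>\<gamma> x\<bar> \<le> 1" for x by (simp add: \<gamma>_def)
  have int\<gamma>: "integrable lborel (\<lambda>x. complex_of_real (\<gamma> x))"
    using gaussian_integral(1)[of "0 :: real^'n"] by (simp add: \<gamma>_def)
  have FG: "(\<integral>x. exp (\<i> * of_real (x \<bullet> \<zeta>)) * of_real (\<gamma> x) \<partial>lborel) = of_real (sqrt (2 * pi) ^ CARD('n) * \<gamma> \<zeta>)" for \<zeta>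
    using gaussian_integral(2)[of \<zeta>] by (simp add: \<gamma>_def)
  have tend: "(\<lambda>n. \<epsilon> n *\<^sub>R s) \<longlonglongrightarrow> 0" for s :: "real^'n"
    using tendsto_scaleR[OF \<epsilon>0 tendsto_const, of s] by simp
  have isC: "isCont f y" for y using cont by (simp add: continuous_on_eq_continuous_at)
  have isCg: "isCont \<gamma> y" for y unfolding \<gamma>_def by (intro continuous_intros) auto
  let ?L = "\<lambda>n. \<integral>\<xi>. fourier f \<xi> * exp (\<i> * of_real (x \<bullet> \<xi>)) * of_real (\<gamma> (\<epsilon> n *\<^sub>R \<xi>)) \<partial>lborel"
  have lim1: "?L \<longlonglongrightarrow> (\<integral>\<xi>. fourier f \<xi> * exp (\<i> * of_real (x \<bullet> \<xi>)) \<partial>lborel)"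
  proof (rule integral_dominated_convergence[where w="\<lambda>\<xi>. cmod (fourier f \<xi>)"])
    show "AE \<xi> in lborel. (\<lambda>n. fourier f \<xi> * exp (\<i> * of_real (x \<bullet> \<xi>)) * of_real (\<gamma> (\<epsilon> n *\<^sub>R \<xi>)))
        \<longlonglongrightarrow> fourier f \<xi> * exp (\<i> * of_real (x \<bullet> \<xi>))"
    proof (rule AE_I2)
      fix \<xi> :: "real^'n"
      have "(\<lambda>n. \<gamma> (\<epsilon> n *\<^sub>R \<xi>)) \<longlonglongrightarrow> \<gamma> 0"
        by (rule isCont_tendsto_compose[OF isCg tend])
      then have "(\<lambda>n. of_real (\<gamma> (\<epsilon> n *\<^sub>R \<xi>)) :: complex) \<longlonglongrightarrow> 1"
        by (auto simp: \<gamma>_def dest: tendsto_of_real)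
      from tendsto_mult[OF tendsto_const this]
      show "(\<lambda>n. fourier f \<xi> * exp (\<i> * of_real (x \<bullet> \<xi>)) * of_real (\<gamma> (\<epsilon> n *\<^sub>R \<xi>)))
        \<longlonglongrightarrow> fourier f \<xi> * exp (\<i> * of_real (x \<bullet> \<xi>))" by (metis mult.right_neutral)
    qed
  qed (use intF \<gamma>1 in \<open>auto simp: norm_mult mult_left_le\<close>)
  \<comment> \<open>Integrating out \<xi> leaves the transform of a rescaled Gaussian, again a
    Gaussian; the substitution y = x + \<epsilon> s cancels the factor 1 / \<epsilon>^N. This
    accounts for one factor (2 pi)^(N/2); the other is the mass of \<gamma> in the limit
    below.\<close>
  have Leq: "?L n = of_real (sqrt (2 * pi) ^ CARD('n)) * (\<integral>s. f (x + \<epsilon> n *\<^sub>R s) * of_real (\<gamma> s) \<partial>lborel)" for n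
  proof -
    let ?a = "\<lambda>\<xi>. exp (\<i> * of_real (x \<bullet> \<xi>)) * of_real (\<gamma> (\<epsilon> n *\<^sub>R \<xi>))"
    have inta: "integrable lborel ?a"
      using integrable_lborel_affine[OF int\<gamma>, of "\<epsilon> n" 0] \<epsilon>[of n]
      by (intro integrable_unimodular_mult) auto
    have "?L n = (\<integral>\<xi>. ?a \<xi> * (\<integral>y. f y * exp (- \<i> * of_real (y \<bullet> \<xi>)) \<partial>lborel) \<partial>lborel)"
      by (simp add: fourier_def mult_ac)
    also have "\<dots> = (\<integral>y. f y * (\<integral>\<xi>. ?a \<xi> * exp (- \<i> * of_real (y \<bullet> \<xi>)) \<partial>lborel) \<partial>lborel)"
      by (rule Fubini_bounded_kernel[OF inta int, where C=1]) auto
    also have "\<dots> = (\<integral>y. f y * (of_real (1 / \<epsilon> n ^ CARD('n)) * of_real (sqrt (2 * pi) ^ CARD('n) * \<gamma> ((1 / \<epsilon> n) *\<^sub>R (x - y)))) \<partial>lborel)"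
    proof (intro Bochner_Integration.integral_cong refl arg_cong2[where f="(*)"])
      fix y
      have "(\<integral>\<xi>. ?a \<xi> * exp (- \<i> * of_real (y \<bullet> \<xi>)) \<partial>lborel)
          = \<bar>1 / \<epsilon> n\<bar> ^ CARD('n) *\<^sub>R (\<integral>s. ?a (0 + (1 / \<epsilon> n) *\<^sub>R s) * exp (- \<i> * of_real (y \<bullet> (0 + (1 / \<epsilon> n) *\<^sub>R s))) \<partial>lborel)"
        using integral_lborel_affine[of "1 / \<epsilon> n" "\<lambda>\<xi>. ?a \<xi> * exp (- \<i> * of_real (y \<bullet> \<xi>))" 0] \<epsilon>[of n] by simp
      also have "(\<integral>s. ?a (0 + (1 / \<epsilon> n) *\<^sub>R s) * exp (- \<i> * of_real (y \<bullet> (0 + (1 / \<epsilon> n) *\<^sub>R s))) \<partial>lborel)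
          = (\<integral>s. exp (\<i> * of_real (s \<bullet> ((1 / \<epsilon> n) *\<^sub>R (x - y)))) * of_real (\<gamma> s) \<partial>lborel)"
      proof (intro Bochner_Integration.integral_cong refl)
        fix s
        have "exp (\<i> * of_real (x \<bullet> (s /\<^sub>R \<epsilon> n))) * exp (- \<i> * of_real (y \<bullet> (s /\<^sub>R \<epsilon> n)))
            = exp (\<i> * of_real (s \<bullet> ((1 / \<epsilon> n) *\<^sub>R (x - y))))"
          unfolding exp_add[symmetric]
          by (rule arg_cong[where f=exp]) (simp add: inner_diff_right inner_commute field_simps)
        then show "?a (0 + (1 / \<epsilon> n) *\<^sub>R s) * exp (- \<i> * of_real (y \<bullet> (0 + (1 / \<epsilon> n) *\<^sub>R s)))
            = exp (\<i> * of_real (s \<bullet> ((1 / \<epsilon> n) *\<^sub>R (x - y)))) * of_real (\<gamma> s)"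
          using \<epsilon>[of n] by (simp add: mult_ac inverse_eq_divide)
      qed
      finally show "(\<integral>\<xi>. ?a \<xi> * exp (- \<i> * of_real (y \<bullet> \<xi>)) \<partial>lborel)
          = of_real (1 / \<epsilon> n ^ CARD('n)) * of_real (sqrt (2 * pi) ^ CARD('n) * \<gamma> ((1 / \<epsilon> n) *\<^sub>R (x - y)))"
        unfolding FG using \<epsilon>[of n] by (simp add: scaleR_conv_of_real power_divide)
    qed
    also have "\<dots> = \<bar>\<epsilon> n\<bar> ^ CARD('n) *\<^sub>R (\<integral>s. f (x + \<epsilon> n *\<^sub>R s) * (of_real (1 / \<epsilon> n ^ CARD('n)) * of_real (sqrt (2 * pi) ^ CARD('n) * \<gamma> ((1 / \<epsilon> n) *\<^sub>R (x - (x + \<epsilon> n *\<^sub>R s))))) \<partial>lborel)"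
      using \<epsilon>[of n] by (subst integral_lborel_affine[of "\<epsilon> n" _ x]) (simp, simp only: DIM_cart DIM_real mult_1_right)
    also have "\<dots> = \<bar>\<epsilon> n\<bar> ^ CARD('n) *\<^sub>R (\<integral>s. of_real (1 / \<epsilon> n ^ CARD('n) * sqrt (2 * pi) ^ CARD('n)) * (f (x + \<epsilon> n *\<^sub>R s) * of_real (\<gamma> s)) \<partial>lborel)"
      using \<epsilon>[of n] by (simp add: \<gamma>_def mult_ac)
    also have "\<dots> = of_real (sqrt (2 * pi) ^ CARD('n)) * (\<integral>s. f (x + \<epsilon> n *\<^sub>R s) * of_real (\<gamma> s) \<partial>lborel)"
      using \<epsilon>[of n] by (simp add: scaleR_conv_of_real)
    finally show ?thesis .
  qed
  have "(\<lambda>n. \<integral>s. f (x + \<epsilon> n *\<^sub>R s) * of_real (\<gamma> s) \<partial>lborel) \<longlonglongrightarrow> (\<integral>s. f x * of_real (\<gamma> s) \<partial>lborel)"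
  proof (rule integral_dominated_convergence[where w="\<lambda>s. B * \<gamma> s"])
    show "AE s in lborel. (\<lambda>n. f (x + \<epsilon> n *\<^sub>R s) * of_real (\<gamma> s)) \<longlonglongrightarrow> f x * of_real (\<gamma> s)"
    proof (rule AE_I2)
      fix s
      have "(\<lambda>n. x + \<epsilon> n *\<^sub>R s) \<longlonglongrightarrow> x + 0" by (intro tendsto_intros tend)
      then have "(\<lambda>n. f (x + \<epsilon> n *\<^sub>R s)) \<longlonglongrightarrow> f x"
        using isCont_tendsto_compose[OF isC] by fastforce
      then show "(\<lambda>n. f (x + \<epsilon> n *\<^sub>R s) * of_real (\<gamma> s)) \<longlonglongrightarrow> f x * of_real (\<gamma> s)"
        by (intro tendsto_intros)
    qed
    have "integrable lborel \<gamma>" using integrable_Re[OF int\<gamma>] by simp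
    then show "integrable lborel (\<lambda>s. B * \<gamma> s)" by simp
    show "AE s in lborel. cmod (f (x + \<epsilon> n *\<^sub>R s) * of_real (\<gamma> s)) \<le> B * \<gamma> s" for n
      using B by (intro AE_I2) (auto simp: norm_mult \<gamma>_def)
  qed measurable
  moreover have "(\<integral>s. f x * of_real (\<gamma> s) \<partial>lborel) = f x * of_real (sqrt (2 * pi) ^ CARD('n))"
    using FG[of 0] by (simp add: \<gamma>_def)
  ultimately have "(\<lambda>n. \<integral>s. f (x + \<epsilon> n *\<^sub>R s) * of_real (\<gamma> s) \<partial>lborel) \<longlonglongrightarrow> f x * of_real (sqrt (2 * pi) ^ CARD('n))"
    by (simp only:)
  then have "?L \<longlonglongrightarrow> of_real (sqrt (2 * pi) ^ CARD('n)) * (f x * of_real (sqrt (2 * pi) ^ CARD('n)))"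
    unfolding Leq by (rule tendsto_mult_left)
  from LIMSEQ_unique[OF lim1 this]
  have "(\<integral>\<xi>. fourier f \<xi> * exp (\<i> * of_real (x \<bullet> \<xi>)) \<partial>lborel)
     = of_real (sqrt (2 * pi) ^ CARD('n) * sqrt (2 * pi) ^ CARD('n)) * f x" by (simp add: mult_ac)
  also have "sqrt (2 * pi) ^ CARD('n) * sqrt (2 * pi) ^ CARD('n) = (2 * pi) ^ CARD('n)"
    by (subst power_mult_distrib[symmetric]) simp
  finally show ?thesis .
qed

section \<open>Stability of the class under the operations of time-frequency analysis, convolution
  and Parseval\<close>

lemma wiener_algebraD:
  assumes "f \<in> wiener_algebra"
  shows "continuous_on UNIV f" "bounded (range f)" "integrable lborel f" "integrable lborel (fourier f)"
    "f \<in> borel_measurable borel" "fourier f \<in> borel_measurable borel"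
  using assms by (auto simp: wiener_algebra_def)

lemma fourier_affine:
  fixes f :: "real ^ 'n \<Rightarrow> complex"
  assumes c: "c \<noteq> 0"
  shows "fourier (\<lambda>x. f (t + c *\<^sub>R x)) \<xi> =
    exp (\<i> * of_real (t \<bullet> \<xi> / c)) * (\<bar>1 / c\<bar> ^ CARD('n) *\<^sub>R fourier f ((1 / c) *\<^sub>R \<xi>))"
proof -
  have "fourier (\<lambda>x. f (t + c *\<^sub>R x)) \<xi>
      = \<bar>1 / c\<bar> ^ CARD('n) *\<^sub>R (\<integral>s. exp (- \<i> * of_real (((- (1 / c)) *\<^sub>R t + (1 / c) *\<^sub>R s) \<bullet> \<xi>)) *
          f (t + c *\<^sub>R ((- (1 / c)) *\<^sub>R t + (1 / c) *\<^sub>R s)) \<partial>lborel)"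
    unfolding fourier_def using c
    by (subst integral_lborel_affine[of "1 / c" _ "(- (1 / c)) *\<^sub>R t"]) (simp, simp only: DIM_cart DIM_real mult_1_right)
  also have "(\<lambda>s. exp (- \<i> * of_real (((- (1 / c)) *\<^sub>R t + (1 / c) *\<^sub>R s) \<bullet> \<xi>)) *
          f (t + c *\<^sub>R ((- (1 / c)) *\<^sub>R t + (1 / c) *\<^sub>R s)))
      = (\<lambda>s. exp (\<i> * of_real (t \<bullet> \<xi> / c)) * (exp (- \<i> * of_real (s \<bullet> ((1 / c) *\<^sub>R \<xi>))) * f s))"
  proof
    fix s
    have "t + c *\<^sub>R ((- (1 / c)) *\<^sub>R t + (1 / c) *\<^sub>R s) = s"
      using c by (simp add: scaleR_right_distrib scaleR_diff_right)
    moreover have "exp (- \<i> * of_real (((- (1 / c)) *\<^sub>R t + (1 / c) *\<^sub>R s) \<bullet> \<xi>)) =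
        exp (\<i> * of_real (t \<bullet> \<xi> / c)) * exp (- \<i> * of_real (s \<bullet> ((1 / c) *\<^sub>R \<xi>)))"
      unfolding exp_add[symmetric]
      by (rule arg_cong[where f=exp]) (simp add: inner_diff_left inner_add_left algebra_simps)
    ultimately show "exp (- \<i> * of_real (((- (1 / c)) *\<^sub>R t + (1 / c) *\<^sub>R s) \<bullet> \<xi>)) *
          f (t + c *\<^sub>R ((- (1 / c)) *\<^sub>R t + (1 / c) *\<^sub>R s))
        = exp (\<i> * of_real (t \<bullet> \<xi> / c)) * (exp (- \<i> * of_real (s \<bullet> ((1 / c) *\<^sub>R \<xi>))) * f s)"
      by (simp only: mult.assoc)
  qed
  finally show ?thesis
    unfolding integral_mult_right_zero fourier_def[of f] mult_scaleR_right .
qed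

lemma fourier_cnj:
  fixes f :: "real ^ 'n \<Rightarrow> complex"
  shows "fourier (\<lambda>x. cnj (f x)) \<xi> = cnj (fourier f (- \<xi>))"
  unfolding fourier_def
  by (subst Bochner_Integration.integral_cnj[symmetric], intro Bochner_Integration.integral_cong refl) (simp add: exp_cnj)

lemma fourier_modulate:
  fixes f :: "real ^ 'n \<Rightarrow> complex"
  shows "fourier (\<lambda>x. exp (\<i> * of_real (x \<bullet> \<eta>)) * f x) \<xi> = fourier f (\<xi> - \<eta>)"
proof -
  have "exp (- \<i> * of_real (x \<bullet> (\<xi> - \<eta>))) = exp (- \<i> * of_real (x \<bullet> \<xi>)) * exp (\<i> * of_real (x \<bullet> \<eta>))" for x :: "real^'n"
    unfolding exp_add[symmetric]
    by (rule arg_cong[where f=exp]) (simp add: inner_diff_right right_diff_distrib)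
  then show ?thesis
    unfolding fourier_def by (simp only: mult.assoc)
qed

lemma wiener_algebra_affine:
  fixes f :: "real ^ 'n \<Rightarrow> complex"
  assumes f: "f \<in> wiener_algebra" and c: "c \<noteq> 0"
  shows "(\<lambda>x. f (t + c *\<^sub>R x)) \<in> wiener_algebra"
proof -
  note D = wiener_algebraD[OF f]
  have "continuous_on UNIV (\<lambda>x. f (t + c *\<^sub>R x))"
    by (rule continuous_on_compose2[OF D(1)]) (auto intro!: continuous_intros)
  moreover have "bounded (range (\<lambda>x. f (t + c *\<^sub>R x)))"
    by (rule bounded_subset[OF D(2)]) auto
  moreover have "integrable lborel (fourier (\<lambda>x. f (t + c *\<^sub>R x)))"
    unfolding fourier_affine[OF c]
    using integrable_lborel_affine[OF D(4), of "1 / c" 0] c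
    by (intro integrable_unimodular_mult) auto
  ultimately show ?thesis
    using integrable_lborel_affine[OF D(3) c] by (simp add: wiener_algebra_def)
qed

lemma wiener_algebra_cnj:
  fixes f :: "real ^ 'n \<Rightarrow> complex"
  assumes f: "f \<in> wiener_algebra"
  shows "(\<lambda>x. cnj (f x)) \<in> wiener_algebra"
proof -
  note D = wiener_algebraD[OF f]
  have "integrable lborel (fourier (\<lambda>x. cnj (f x)))"
    using integrable_lborel_affine[OF D(4), of "-1" 0] by (simp add: fourier_cnj[abs_def])
  moreover have "continuous_on UNIV (\<lambda>x. cnj (f x))"
    using D(1) by (intro continuous_intros)
  moreover have "bounded (range (\<lambda>x. cnj (f x)))" using D(2) by (auto simp: bounded_iff)
  ultimately show ?thesis
    using D(3) by (simp add: wiener_algebra_def)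
qed

lemma wiener_algebra_modulate:
  fixes f :: "real ^ 'n \<Rightarrow> complex"
  assumes f: "f \<in> wiener_algebra"
  shows "(\<lambda>x. exp (\<i> * of_real (x \<bullet> \<eta>)) * f x) \<in> wiener_algebra"
proof -
  note D = wiener_algebraD[OF f]
  have "integrable lborel (fourier (\<lambda>x. exp (\<i> * of_real (x \<bullet> \<eta>)) * f x))"
    using integrable_lborel_affine[OF D(4), of 1 "- \<eta>"] by (simp add: fourier_modulate[abs_def])
  moreover have "continuous_on UNIV (\<lambda>x. exp (\<i> * of_real (x \<bullet> \<eta>)) * f x)"
    using D(1) by (intro continuous_intros)
  moreover have "bounded (range (\<lambda>x. exp (\<i> * of_real (x \<bullet> \<eta>)) * f x))"
    using D(2) by (auto simp: bounded_iff norm_mult)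
  moreover have "integrable lborel (\<lambda>x. exp (\<i> * of_real (x \<bullet> \<eta>)) * f x)"
    using D(3) by (intro integrable_unimodular_mult) auto
  ultimately show ?thesis by (simp add: wiener_algebra_def)
qed

lemma fourier_inversion':
  fixes f :: "real ^ 'n \<Rightarrow> complex"
  assumes "f \<in> wiener_algebra"
  shows "f x = of_real (1 / (2 * pi) ^ CARD('n)) * (\<integral>\<xi>. fourier f \<xi> * exp (\<i> * of_real (x \<bullet> \<xi>)) \<partial>lborel)"
  unfolding fourier_inversion[OF assms] by simp

text \<open>Inserting the inversion formula for g and exchanging integrals turns each frequency
  \<theta> of g into a modulation of f, hence a translation of \<open>fourier f\<close>. It later
  rewrites the Wigner transform, a Fourier transform of a product, in terms of
  \<open>fourier g\<close>.\<close>

lemma fourier_mult: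
  fixes f g :: "real ^ 'n \<Rightarrow> complex"
  assumes f: "integrable lborel f" and g: "g \<in> wiener_algebra"
  shows "fourier (\<lambda>x. f x * g x) \<xi> =
    of_real (1 / (2 * pi) ^ CARD('n)) * (\<integral>\<theta>. fourier g \<theta> * fourier f (\<xi> - \<theta>) \<partial>lborel)"
proof -
  note D = wiener_algebraD[OF g]
  have "fourier (\<lambda>x. f x * g x) \<xi> = (\<integral>x. exp (- \<i> * of_real (x \<bullet> \<xi>)) * f x *
      (of_real (1 / (2 * pi) ^ CARD('n)) * (\<integral>\<theta>. fourier g \<theta> * exp (\<i> * of_real (x \<bullet> \<theta>)) \<partial>lborel)) \<partial>lborel)"
    unfolding fourier_def[of "\<lambda>x. f x * g x"]
    by (subst fourier_inversion'[OF g, symmetric]) (simp add: mult.assoc)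
  also have "\<dots> = of_real (1 / (2 * pi) ^ CARD('n)) * (\<integral>x. exp (- \<i> * of_real (x \<bullet> \<xi>)) * f x *
      (\<integral>\<theta>. fourier g \<theta> * exp (\<i> * of_real (x \<bullet> \<theta>)) \<partial>lborel) \<partial>lborel)"
    unfolding integral_mult_right_zero[symmetric] by (simp only: mult_ac)
  also have "(\<integral>x. exp (- \<i> * of_real (x \<bullet> \<xi>)) * f x *
      (\<integral>\<theta>. fourier g \<theta> * exp (\<i> * of_real (x \<bullet> \<theta>)) \<partial>lborel) \<partial>lborel) =
     (\<integral>\<theta>. fourier g \<theta> * (\<integral>x. exp (- \<i> * of_real (x \<bullet> \<xi>)) * f x * exp (\<i> * of_real (x \<bullet> \<theta>)) \<partial>lborel) \<partial>lborel)"
    using D f by (intro Fubini_bounded_kernel[where C=1] integrable_unimodular_mult) auto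
  also have "(\<lambda>\<theta>. \<integral>x. exp (- \<i> * of_real (x \<bullet> \<xi>)) * f x * exp (\<i> * of_real (x \<bullet> \<theta>)) \<partial>lborel) = (\<lambda>\<theta>. fourier f (\<xi> - \<theta>))"
    unfolding fourier_modulate[symmetric] by (simp add: fourier_def mult_ac)
  finally show ?thesis .
qed

lemma wiener_algebra_mult:
  fixes f g :: "real ^ 'n \<Rightarrow> complex"
  assumes f: "f \<in> wiener_algebra" and g: "g \<in> wiener_algebra"
  shows "(\<lambda>x. f x * g x) \<in> wiener_algebra"
proof -
  note F = wiener_algebraD[OF f] and G = wiener_algebraD[OF g]
  note [measurable] = F(5,6) G(5,6)
  obtain B where B: "\<And>x. cmod (g x) \<le> B" using G(2) by (auto simp: bounded_iff)
  obtain C where C: "\<And>x. cmod (f x) \<le> C" using F(2) by (auto simp: bounded_iff)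
  have "cmod (f x * g x) \<le> C * B" for x
    unfolding norm_mult using order_trans[OF norm_ge_zero C] by (intro mult_mono B C) auto
  then have bdd: "bounded (range (\<lambda>x. f x * g x))" by (auto simp: bounded_iff)
  have int: "integrable lborel (\<lambda>x. f x * g x)"
  proof (rule Bochner_Integration.integrable_bound)
    show "integrable lborel (\<lambda>x. B * cmod (f x))" using F(3) by simp
    show "AE x in lborel. norm (f x * g x) \<le> norm (B * cmod (f x))"
      using B order_trans[OF norm_ge_zero B]
      by (auto simp: norm_mult abs_mult mult.commute[of "cmod (f _)"] intro!: mult_right_mono)
  qed simp
  have "integrable lborel (\<lambda>\<xi>. \<integral>\<theta>. fourier g \<theta> * fourier f (\<xi> - \<theta>) \<partial>lborel)"
  proof (rule lborel_pair.integrable_fst)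
    show "integrable (lborel \<Otimes>\<^sub>M lborel) (\<lambda>(\<xi>, \<theta>). fourier g \<theta> * fourier f (\<xi> - \<theta>))"
    proof (rule integrableI_bounded)
      have "(\<integral>\<^sup>+ w. ennreal (cmod (case w of (\<xi>, \<theta>) \<Rightarrow> fourier g \<theta> * fourier f (\<xi> - \<theta>))) \<partial>(lborel \<Otimes>\<^sub>M lborel))
          = (\<integral>\<^sup>+ \<theta>. (\<integral>\<^sup>+ \<xi>. ennreal (cmod (fourier g \<theta>)) * ennreal (cmod (fourier f (\<xi> - \<theta>))) \<partial>lborel) \<partial>lborel)"
        by (subst lborel_pair.nn_integral_snd[symmetric]) (auto simp: norm_mult ennreal_mult simp del: lborel_prod)
      also have "\<dots> = (\<integral>\<^sup>+ \<theta>. ennreal (cmod (fourier g \<theta>)) * (\<integral>\<^sup>+ \<xi>. ennreal (cmod (fourier f \<xi>)) \<partial>lborel) \<partial>lborel)"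
      proof (intro nn_integral_cong)
        fix \<theta> :: "real^'n"
        show "(\<integral>\<^sup>+ \<xi>. ennreal (cmod (fourier g \<theta>)) * ennreal (cmod (fourier f (\<xi> - \<theta>))) \<partial>lborel)
            = ennreal (cmod (fourier g \<theta>)) * (\<integral>\<^sup>+ \<xi>. ennreal (cmod (fourier f \<xi>)) \<partial>lborel)"
          using nn_integral_lborel_affine[of "\<lambda>\<xi>. ennreal (cmod (fourier f \<xi>))" 1 "- \<theta>"]
          by (simp add: nn_integral_cmult)
      qed
      also have "\<dots> < \<infinity>"
        using F(4) G(4) by (simp add: nn_integral_multc integrable_iff_bounded ennreal_mult_less_top)
      finally show "(\<integral>\<^sup>+ w. ennreal (cmod (case w of (\<xi>, \<theta>) \<Rightarrow> fourier g \<theta> * fourier f (\<xi> - \<theta>))) \<partial>(lborel \<Otimes>\<^sub>M lborel)) < \<infinity>" .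
    qed (simp del: lborel_prod)
  qed
  then have "integrable lborel (fourier (\<lambda>x. f x * g x))"
    by (subst fourier_mult[OF F(3) g, abs_def]) (rule integrable_mult_right)
  with bdd int show ?thesis
    using F(1) G(1) by (simp add: wiener_algebra_def continuous_on_mult)
qed

text \<open>Inversion is inserted for f, the defining integral for h, hence the asymmetric
  hypotheses. The second claim is what permits moving the modulus inside the frequency integral in
  \<open>Moyal_le\<close>.\<close>

lemma Parseval:
  fixes f h :: "real ^ 'n \<Rightarrow> complex"
  assumes f: "f \<in> wiener_algebra" and h: "integrable lborel h"
  shows "(\<integral>\<eta>. fourier f \<eta> * cnj (fourier h \<eta>) \<partial>lborel) = of_real ((2 * pi) ^ CARD('n)) * (\<integral>t. f t * cnj (h t) \<partial>lborel)"
    and "integrable lborel (\<lambda>\<eta>. fourier f \<eta> * cnj (fourier h \<eta>))"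
proof -
  note F = wiener_algebraD[OF f]
  have ch: "cnj (fourier h \<eta>) = (\<integral>t. cnj (h t) * exp (\<i> * of_real (t \<bullet> \<eta>)) \<partial>lborel)" for \<eta>
    unfolding fourier_def
    by (subst Bochner_Integration.integral_cnj[symmetric], intro Bochner_Integration.integral_cong refl) (simp add: exp_cnj)
  have "of_real ((2 * pi) ^ CARD('n)) * (\<integral>t. f t * cnj (h t) \<partial>lborel)
      = (\<integral>t. cnj (h t) * (\<integral>\<eta>. fourier f \<eta> * exp (\<i> * of_real (t \<bullet> \<eta>)) \<partial>lborel) \<partial>lborel)"
    unfolding fourier_inversion[OF f] integral_mult_right_zero[symmetric] by (simp only: mult_ac)
  also have "\<dots> = (\<integral>\<eta>. fourier f \<eta> * (\<integral>t. cnj (h t) * exp (\<i> * of_real (t \<bullet> \<eta>)) \<partial>lborel) \<partial>lborel)"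
    using F h by (intro Fubini_bounded_kernel[where C=1]) auto
  finally show "(\<integral>\<eta>. fourier f \<eta> * cnj (fourier h \<eta>) \<partial>lborel) = of_real ((2 * pi) ^ CARD('n)) * (\<integral>t. f t * cnj (h t) \<partial>lborel)"
    by (simp add: ch)
  show "integrable lborel (\<lambda>\<eta>. fourier f \<eta> * cnj (fourier h \<eta>))"
    unfolding ch using F h by (intro Fubini_bounded_kernel[where C=1]) auto
qed

section \<open>Time-frequency shifts and Wigner transforms\<close>

text \<open>Translation comes first and modulation second, so that \<open>stft g f z\<close> is
  exactly the inner product of f with this shift, without an extra phase.\<close>

definition tf_shift :: "(real ^ 'n) \<times> (real ^ 'n) \<Rightarrow> (real ^ 'n \<Rightarrow> complex) \<Rightarrow> real ^ 'n \<Rightarrow> complex" where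
  "tf_shift z g = (\<lambda>y. exp (\<i> * of_real (y \<bullet> snd z)) * g (y - fst z))"

text \<open>The sesquilinear form with diagonal \<open>wigner\<close>. Two separate slots are needed
  because f is expanded into shifts of g one slot at a time, leaving mixed terms.\<close>

definition cross_wigner ::
  "real \<Rightarrow> (real ^ 'n \<Rightarrow> complex) \<Rightarrow> (real ^ 'n \<Rightarrow> complex) \<Rightarrow> (real ^ 'n) \<times> (real ^ 'n) \<Rightarrow> complex" where
  "cross_wigner \<tau> f h = (\<lambda>(x, \<xi>). \<integral>t. exp (- \<i> * of_real (t \<bullet> \<xi>)) *
       f (x + \<tau> *\<^sub>R t) * cnj (h (x - (1 - \<tau>) *\<^sub>R t)) \<partial>lborel)"

text \<open>Brings the second argument of the Wigner integrand into the shape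
  \<open>t + c *\<^sub>R x\<close> of the affine lemmas, with a negative coefficient.\<close>

lemma add_scaleR_neg: "x + (- c) *\<^sub>R t = x - c *\<^sub>R (t::'a::real_vector)"
  by simp

lemma borel_measurable_cnj [measurable (raw)]:
  assumes "f \<in> borel_measurable M"
  shows "(\<lambda>x. cnj (f x)) \<in> borel_measurable M"
  by (rule borel_measurable_continuous_on[OF _ assms]) (intro continuous_intros)

lemma borel_measurable_lebesgue_integral_borel:
  fixes F :: "'a \<Rightarrow> 'b::euclidean_space \<Rightarrow> complex"
  assumes "(\<lambda>p. F (fst p) (snd p)) \<in> borel_measurable (M \<Otimes>\<^sub>M borel)"
  shows "(\<lambda>x. \<integral>t. F x t \<partial>lborel) \<in> borel_measurable M"
proof -
  have "sets (M \<Otimes>\<^sub>M (lborel :: 'b measure)) = sets (M \<Otimes>\<^sub>M borel)"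
    by (intro sets_pair_measure_cong) auto
  then have "case_prod F \<in> borel_measurable (M \<Otimes>\<^sub>M lborel)"
    using assms by (subst measurable_cong_sets) (auto simp: case_prod_beta')
  then show ?thesis by (rule lborel.borel_measurable_lebesgue_integral)
qed

lemma wigner_eq_cross_wigner: "wigner \<tau> f = cross_wigner \<tau> f f"
  by (simp add: wigner_def cross_wigner_def)

lemma cross_wigner_eq_fourier:
  "cross_wigner \<tau> f h (x, \<xi>) = fourier (\<lambda>t. f (x + \<tau> *\<^sub>R t) * cnj (h (x + (- (1 - \<tau>)) *\<^sub>R t))) \<xi>"
  unfolding add_scaleR_neg by (simp add: cross_wigner_def fourier_def mult.assoc)

lemma stft_eq_fourier: "stft g f (x, \<xi>) = fourier (\<lambda>y. f y * cnj (g (- x + 1 *\<^sub>R y))) \<xi>"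
  by (simp add: stft_def fourier_def mult_ac)

lemma stft_eq_inner: "stft g f z = (\<integral>y. f y * cnj (tf_shift z g y) \<partial>lborel)"
  by (cases z) (simp add: stft_def tf_shift_def exp_cnj mult_ac)

lemma borel_measurable_cross_wigner [measurable]:
  assumes [measurable]: "f \<in> borel_measurable borel" "h \<in> borel_measurable borel"
  shows "cross_wigner \<tau> f h \<in> borel_measurable borel"
proof -
  have "cross_wigner \<tau> f h = (\<lambda>z. \<integral>t. exp (- \<i> * of_real (t \<bullet> snd z)) *
       f (fst z + \<tau> *\<^sub>R t) * cnj (h (fst z - (1 - \<tau>) *\<^sub>R t)) \<partial>lborel)"
    by (auto simp: cross_wigner_def)
  also have "\<dots> \<in> borel_measurable (borel \<Otimes>\<^sub>M borel)"
    by (rule borel_measurable_lebesgue_integral_borel) measurable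
  finally show ?thesis by (simp add: borel_prod)
qed

lemma borel_measurable_wigner [measurable]:
  assumes "f \<in> borel_measurable borel"
  shows "wigner \<tau> f \<in> borel_measurable borel"
  using assms by (simp add: wigner_eq_cross_wigner)

lemma borel_measurable_stft [measurable]:
  assumes [measurable]: "f \<in> borel_measurable borel" "g \<in> borel_measurable borel"
  shows "stft g f \<in> borel_measurable borel"
proof -
  have "stft g f = (\<lambda>z. \<integral>y. f y * cnj (g (y - fst z)) * exp (- \<i> * of_real (y \<bullet> snd z)) \<partial>lborel)"
    by (auto simp: stft_def)
  also have "\<dots> \<in> borel_measurable (borel \<Otimes>\<^sub>M borel)"
    by (rule borel_measurable_lebesgue_integral_borel) measurable
  finally show ?thesis by (simp add: borel_prod)
qed

lemma cmod_tf_shift: "cmod (tf_shift z g y) = cmod (g (y - fst z))"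
  by (simp add: tf_shift_def norm_mult)

lemma wiener_algebra_tf_shift:
  assumes "g \<in> wiener_algebra"
  shows "tf_shift z g \<in> wiener_algebra"
  using wiener_algebra_modulate[OF wiener_algebra_affine[OF assms, of 1 "- fst z"]]
  by (simp add: tf_shift_def)

text \<open>Substituting t + (z1 - w1) for t centres both slots at the same point. The part of the
  accumulated phase that does not depend on t is the unimodular constant \<open>U\<close>; the part
  linear in t shifts the frequency.\<close>

lemma cmod_cross_wigner_tf_shift:
  "cmod (cross_wigner \<tau> (tf_shift (z1, z2) g) (tf_shift (w1, w2) h) (x, \<xi>)) =
   cmod (cross_wigner \<tau> g h (x - (1 - \<tau>) *\<^sub>R z1 - \<tau> *\<^sub>R w1, \<xi> - \<tau> *\<^sub>R z2 - (1 - \<tau>) *\<^sub>R w2))"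
proof -
  let ?F = "\<lambda>t. exp (- \<i> * of_real (t \<bullet> \<xi>)) *
       tf_shift (z1, z2) g (x + \<tau> *\<^sub>R t) * cnj (tf_shift (w1, w2) h (x - (1 - \<tau>) *\<^sub>R t))"
  let ?x = "x - (1 - \<tau>) *\<^sub>R z1 - \<tau> *\<^sub>R w1" and ?\<xi> = "\<xi> - \<tau> *\<^sub>R z2 - (1 - \<tau>) *\<^sub>R w2"
  define U where "U = exp (\<i> * of_real (- ((z1 - w1) \<bullet> \<xi>) + (x + \<tau> *\<^sub>R (z1 - w1)) \<bullet> z2 - (x - (1 - \<tau>) *\<^sub>R (z1 - w1)) \<bullet> w2))"
  have "cross_wigner \<tau> (tf_shift (z1, z2) g) (tf_shift (w1, w2) h) (x, \<xi>) = integral\<^sup>L lborel ?F"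
    by (simp add: cross_wigner_def)
  also have "\<dots> = (\<integral>t. ?F ((z1 - w1) + 1 *\<^sub>R t) \<partial>lborel)"
    using integral_lborel_affine[of 1 ?F "z1 - w1"] by simp
  also have "(\<lambda>t. ?F ((z1 - w1) + 1 *\<^sub>R t)) = (\<lambda>t. U * (exp (- \<i> * of_real (t \<bullet> ?\<xi>)) *
       g (?x + \<tau> *\<^sub>R t) * cnj (h (?x - (1 - \<tau>) *\<^sub>R t))))"
  proof
    fix t
    have 1: "x + \<tau> *\<^sub>R (z1 - w1 + 1 *\<^sub>R t) - z1 = ?x + \<tau> *\<^sub>R t"
      by (simp add: algebra_simps)
    have 2: "x - (1 - \<tau>) *\<^sub>R (z1 - w1 + 1 *\<^sub>R t) - w1 = ?x - (1 - \<tau>) *\<^sub>R t"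
      by (simp add: algebra_simps)
    have "exp (- \<i> * of_real ((z1 - w1 + 1 *\<^sub>R t) \<bullet> \<xi>)) *
        exp (\<i> * of_real ((x + \<tau> *\<^sub>R (z1 - w1 + 1 *\<^sub>R t)) \<bullet> z2)) *
        exp (- \<i> * of_real ((x - (1 - \<tau>) *\<^sub>R (z1 - w1 + 1 *\<^sub>R t)) \<bullet> w2))
      = U * exp (- \<i> * of_real (t \<bullet> ?\<xi>))"
      unfolding U_def exp_add[symmetric]
      by (rule arg_cong[where f=exp])
        (simp add: inner_diff_right inner_diff_left inner_add_left inner_add_right algebra_simps)
    then show "?F ((z1 - w1) + 1 *\<^sub>R t) = U * (exp (- \<i> * of_real (t \<bullet> ?\<xi>)) *
       g (?x + \<tau> *\<^sub>R t) * cnj (h (?x - (1 - \<tau>) *\<^sub>R t)))"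
      unfolding tf_shift_def fst_conv snd_conv 1 2 by (simp add: exp_cnj mult_ac)
  qed
  also have "integral\<^sup>L lborel \<dots> = U * cross_wigner \<tau> g h (?x, ?\<xi>)"
    by (simp add: cross_wigner_def)
  finally show ?thesis by (simp add: norm_mult U_def)
qed

lemma cmod_wigner_tf_shift: "cmod (wigner \<tau> (tf_shift z g) w) = cmod (wigner \<tau> g (w - z))"
  by (cases z; cases w)
    (simp add: wigner_eq_cross_wigner cmod_cross_wigner_tf_shift algebra_simps)

lemma wigner_reflect: "wigner (1 - \<tau>) (\<lambda>t. g (- t)) z = cnj (wigner \<tau> g (- z))"
proof (cases z)
  case (Pair x \<xi>)
  have "cnj (wigner \<tau> g (- z)) = (\<integral>t. cnj (exp (- \<i> * of_real (t \<bullet> (- \<xi>))) *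
       g (- x + \<tau> *\<^sub>R t) * cnj (g (- x - (1 - \<tau>) *\<^sub>R t))) \<partial>lborel)"
    unfolding Pair by (simp add: wigner_def flip: Bochner_Integration.integral_cnj)
  also have "\<dots> = wigner (1 - \<tau>) (\<lambda>t. g (- t)) z"
    unfolding Pair wigner_def prod.case
    by (intro Bochner_Integration.integral_cong refl) (simp add: exp_cnj mult_ac)
  finally show ?thesis by simp
qed

text \<open>Reflecting t exchanges the two slots at the price of a conjugation and of 1 - \<tau> in
  place of \<tau>. An expansion of the first slot thereby also serves for the second.\<close>

lemma cnj_cross_wigner: "cross_wigner (1 - \<tau>) h f z = cnj (cross_wigner \<tau> f h z)"
proof (cases z)
  case (Pair x \<xi>)
  let ?F = "\<lambda>t. exp (- \<i> * of_real (t \<bullet> \<xi>)) * h (x + (1 - \<tau>) *\<^sub>R t) * cnj (f (x - (1 - (1 - \<tau>)) *\<^sub>R t))"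
  have "cross_wigner (1 - \<tau>) h f z = integral\<^sup>L lborel ?F"
    by (simp add: cross_wigner_def Pair)
  also have "\<dots> = (\<integral>t. ?F (0 + (-1) *\<^sub>R t) \<partial>lborel)"
    using integral_lborel_affine[of "-1" ?F 0] by simp
  also have "\<dots> = (\<integral>t. cnj (exp (- \<i> * of_real (t \<bullet> \<xi>)) *
       f (x + \<tau> *\<^sub>R t) * cnj (h (x - (1 - \<tau>) *\<^sub>R t))) \<partial>lborel)"
    by (intro Bochner_Integration.integral_cong refl) (simp add: exp_cnj mult_ac)
  also have "\<dots> = cnj (cross_wigner \<tau> f h z)"
    unfolding Pair cross_wigner_def prod.case by (rule Bochner_Integration.integral_cnj)
  finally show ?thesis .
qed

text \<open>The map taking (y, t) to (y + \<tau> t, y - (1 - \<tau>) t) has determinant of modulus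
  1. It is carried out by one-variable substitutions: a translation in y gives the integrand a(u)
  b(u - t), then t is replaced by u - t.\<close>

lemma shear_integral:
  fixes a b :: "'a::euclidean_space \<Rightarrow> complex"
  assumes a: "integrable lborel a" and b: "integrable lborel b"
  shows "(\<integral>y. (\<integral>t. a (y + \<tau> *\<^sub>R t) * b (y - (1 - \<tau>) *\<^sub>R t) \<partial>lborel) \<partial>lborel)
      = (\<integral>u. a u \<partial>lborel) * (\<integral>v. b v \<partial>lborel)"
    and "integrable lborel (\<lambda>y. \<integral>t. a (y + \<tau> *\<^sub>R t) * b (y - (1 - \<tau>) *\<^sub>R t) \<partial>lborel)"
proof -
  have [measurable]: "a \<in> borel_measurable borel" "b \<in> borel_measurable borel" using a b by auto
  let ?H = "\<lambda>u t. a u * b (u - t)"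
  let ?G = "\<lambda>y t. a (y + \<tau> *\<^sub>R t) * b (y - (1 - \<tau>) *\<^sub>R t)"
  have refl_b: "(\<integral>\<^sup>+ t. ennreal (cmod (b (u - t))) \<partial>lborel) = (\<integral>\<^sup>+ t. ennreal (cmod (b t)) \<partial>lborel)" for u
    using nn_integral_lborel_affine[of "\<lambda>t. ennreal (cmod (b t))" "-1" u] by simp
  have nnH: "(\<integral>\<^sup>+ u. (\<integral>\<^sup>+ t. ennreal (cmod (?H u t)) \<partial>lborel) \<partial>lborel)
      = (\<integral>\<^sup>+ u. ennreal (cmod (a u)) \<partial>lborel) * (\<integral>\<^sup>+ t. ennreal (cmod (b t)) \<partial>lborel)"
    by (simp add: norm_mult ennreal_mult nn_integral_cmult nn_integral_multc refl_b)
  also have fin: "\<dots> < \<infinity>"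
    using a b by (simp add: integrable_iff_bounded ennreal_mult_less_top)
  finally have nnH_fin: "(\<integral>\<^sup>+ u. (\<integral>\<^sup>+ t. ennreal (cmod (?H u t)) \<partial>lborel) \<partial>lborel) < \<infinity>" .
  have intH: "integrable (lborel \<Otimes>\<^sub>M lborel) (\<lambda>(u, t). ?H u t)"
  proof (rule integrableI_bounded)
    show "(\<integral>\<^sup>+ w. ennreal (cmod (case w of (u, t) \<Rightarrow> ?H u t)) \<partial>(lborel \<Otimes>\<^sub>M lborel)) < \<infinity>"
      using nnH_fin by (subst lborel.nn_integral_fst[symmetric]) (auto simp del: lborel_prod)
  qed (simp del: lborel_prod)
  have transl: "(\<integral>\<^sup>+ y. ennreal (cmod (?G y t)) \<partial>lborel) = (\<integral>\<^sup>+ u. ennreal (cmod (?H u t)) \<partial>lborel)" for t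
    using nn_integral_lborel_affine[of "\<lambda>y. ennreal (cmod (?H y t))" 1 "\<tau> *\<^sub>R t"]
    by (simp add: algebra_simps)
  have intG: "integrable (lborel \<Otimes>\<^sub>M lborel) (\<lambda>(y, t). ?G y t)"
  proof (rule integrableI_bounded)
    have "(\<integral>\<^sup>+ w. ennreal (cmod (case w of (u, t) \<Rightarrow> ?G u t)) \<partial>(lborel \<Otimes>\<^sub>M lborel))
        = (\<integral>\<^sup>+ t. (\<integral>\<^sup>+ y. ennreal (cmod (?G y t)) \<partial>lborel) \<partial>lborel)"
      by (subst lborel_pair.nn_integral_snd[symmetric]) (auto simp del: lborel_prod)
    also have "\<dots> = (\<integral>\<^sup>+ u. (\<integral>\<^sup>+ t. ennreal (cmod (?H u t)) \<partial>lborel) \<partial>lborel)"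
      unfolding transl by (rule lborel_pair.Fubini') (simp del: lborel_prod)
    also note nnH_fin
    finally show "(\<integral>\<^sup>+ w. ennreal (cmod (case w of (u, t) \<Rightarrow> ?G u t)) \<partial>(lborel \<Otimes>\<^sub>M lborel)) < \<infinity>" .
  qed (simp del: lborel_prod)
  show "integrable lborel (\<lambda>y. \<integral>t. ?G y t \<partial>lborel)"
    by (rule lborel_pair.integrable_fst[OF intG])
  have "(\<integral>y. (\<integral>t. ?G y t \<partial>lborel) \<partial>lborel) = (\<integral>t. (\<integral>y. ?G y t \<partial>lborel) \<partial>lborel)"
    by (rule lborel_pair.Fubini_integral[OF intG, symmetric])
  also have "(\<lambda>t. \<integral>y. ?G y t \<partial>lborel) = (\<lambda>t. \<integral>u. ?H u t \<partial>lborel)"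
  proof
    fix t
    show "(\<integral>y. ?G y t \<partial>lborel) = (\<integral>u. ?H u t \<partial>lborel)"
      using integral_lborel_affine[of 1 "\<lambda>y. ?H y t" "\<tau> *\<^sub>R t"] by (simp add: algebra_simps)
  qed
  also have "(\<integral>t. (\<integral>u. ?H u t \<partial>lborel) \<partial>lborel) = (\<integral>u. (\<integral>t. ?H u t \<partial>lborel) \<partial>lborel)"
    by (rule lborel_pair.Fubini_integral[OF intH])
  also have "(\<lambda>u. \<integral>t. ?H u t \<partial>lborel) = (\<lambda>u. a u * (\<integral>v. b v \<partial>lborel))"
  proof
    fix u
    show "(\<integral>t. ?H u t \<partial>lborel) = a u * (\<integral>v. b v \<partial>lborel)"
      using integral_lborel_affine[of "-1" b u] by simp
  qed
  also have "(\<integral>u. a u * (\<integral>v. b v \<partial>lborel) \<partial>lborel) = (\<integral>u. a u \<partial>lborel) * (\<integral>v. b v \<partial>lborel)"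
    by (rule integral_mult_left_zero)
  finally show "(\<integral>y. (\<integral>t. ?G y t \<partial>lborel) \<partial>lborel) = (\<integral>u. a u \<partial>lborel) * (\<integral>v. b v \<partial>lborel)" .
qed

lemma wiener_algebra_wigner_slice:
  assumes "f \<in> wiener_algebra" "h \<in> wiener_algebra" "0 < \<tau>" "\<tau> < 1"
  shows "(\<lambda>t. f (x + \<tau> *\<^sub>R t) * cnj (h (x + (- (1 - \<tau>)) *\<^sub>R t))) \<in> wiener_algebra"
  using assms by (intro wiener_algebra_mult wiener_algebra_cnj wiener_algebra_affine) auto

lemma nn_integral_lborel_fst:
  fixes F :: "'a::euclidean_space \<times> 'b::euclidean_space \<Rightarrow> ennreal"
  assumes "F \<in> borel_measurable borel"
  shows "(\<integral>\<^sup>+ w. F w \<partial>lborel) = (\<integral>\<^sup>+ x. (\<integral>\<^sup>+ y. F (x, y) \<partial>lborel) \<partial>lborel)"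
  using lborel.nn_integral_fst[of F lborel] assms by (simp add: lborel_prod)

text \<open>Moyal's identity for \<open>|\<langle>f, h\<rangle>|\<^sup>2\<close>, with the integrand replaced by its modulus: Parseval on each
  slice \<open>{y} \<times> \<real>\<^sup>N\<close> then suffices, and no integrability on phase space is required.\<close>

lemma Moyal_le:
  fixes f h :: "real ^ 'n \<Rightarrow> complex"
  assumes f: "f \<in> wiener_algebra" and h: "h \<in> wiener_algebra" and \<tau>: "0 < \<tau>" "\<tau> < 1"
  shows "ennreal ((2 * pi) ^ CARD('n) * (cmod (\<integral>y. f y * cnj (h y) \<partial>lborel))\<^sup>2)
    \<le> (\<integral>\<^sup>+ w. ennreal (cmod (wigner \<tau> f w) * cmod (wigner \<tau> h w)) \<partial>lborel)"
proof -
  note F = wiener_algebraD[OF f] and H = wiener_algebraD[OF h]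
  note [measurable] = F(5) H(5)
  define a where "a = (\<lambda>y. f y * cnj (h y))"
  have inta: "integrable lborel a"
    unfolding a_def by (rule wiener_algebraD(3)[OF wiener_algebra_mult[OF f wiener_algebra_cnj[OF h]]])
  then have intb: "integrable lborel (\<lambda>y. cnj (a y))" by simp
  define S where "S f y = (\<lambda>t. f (y + \<tau> *\<^sub>R t) * cnj (f (y + (- (1 - \<tau>)) *\<^sub>R t)))"
    for f :: "real ^ 'n \<Rightarrow> complex" and y
  have SW: "S f y \<in> wiener_algebra" "S h y \<in> wiener_algebra" for y
    unfolding S_def using f h \<tau> by (intro wiener_algebra_wigner_slice; simp)+
  have W: "wigner \<tau> f (y, \<eta>) = fourier (S f y) \<eta>" for f y \<eta>
    by (simp add: S_def wigner_eq_cross_wigner cross_wigner_eq_fourier)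
  \<comment> \<open>Regrouping the four factors leaves only the pointwise product a of f and the
    conjugate of h, evaluated at the two sheared points; \<open>shear_integral\<close> then yields
    the squared modulus of its integral.\<close>
  have SS: "S f y t * cnj (S h y t) = a (y + \<tau> *\<^sub>R t) * cnj (a (y - (1 - \<tau>) *\<^sub>R t))" for y t
    unfolding S_def a_def add_scaleR_neg by (simp add: mult_ac)
  note shear = shear_integral[OF inta intb, of \<tau>]
  have "(2 * pi) ^ CARD('n) * (cmod (integral\<^sup>L lborel a))\<^sup>2
      = (2 * pi) ^ CARD('n) * cmod (\<integral>y. (\<integral>t. S f y t * cnj (S h y t) \<partial>lborel) \<partial>lborel)"
    unfolding SS shear(1) by (simp add: norm_mult power2_eq_square)
  also have "\<dots> = cmod (\<integral>y. of_real ((2 * pi) ^ CARD('n)) * (\<integral>t. S f y t * cnj (S h y t) \<partial>lborel) \<partial>lborel)"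
    by (simp add: norm_mult norm_power)
  also have "\<dots> = cmod (\<integral>y. (\<integral>\<eta>. wigner \<tau> f (y, \<eta>) * cnj (wigner \<tau> h (y, \<eta>)) \<partial>lborel) \<partial>lborel)"
    unfolding W by (subst Parseval(1)[OF SW(1) wiener_algebraD(3)[OF SW(2)]]) rule
  finally have eq: "(2 * pi) ^ CARD('n) * (cmod (integral\<^sup>L lborel a))\<^sup>2
     = cmod (\<integral>y. (\<integral>\<eta>. wigner \<tau> f (y, \<eta>) * cnj (wigner \<tau> h (y, \<eta>)) \<partial>lborel) \<partial>lborel)" .
  have "integrable lborel (\<lambda>y. \<integral>t. S f y t * cnj (S h y t) \<partial>lborel)"
    unfolding SS by (rule shear(2))
  then have "integrable lborel (\<lambda>y. \<integral>\<eta>. wigner \<tau> f (y, \<eta>) * cnj (wigner \<tau> h (y, \<eta>)) \<partial>lborel)"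
    unfolding W by (subst Parseval(1)[OF SW(1) wiener_algebraD(3)[OF SW(2)]]) (rule integrable_mult_right)
  then have "ennreal ((2 * pi) ^ CARD('n) * (cmod (integral\<^sup>L lborel a))\<^sup>2)
      \<le> (\<integral>\<^sup>+ y. ennreal (cmod (\<integral>\<eta>. wigner \<tau> f (y, \<eta>) * cnj (wigner \<tau> h (y, \<eta>)) \<partial>lborel)) \<partial>lborel)"
    unfolding eq by (rule integral_norm_bound_ennreal)
  also have "\<dots> \<le> (\<integral>\<^sup>+ y. (\<integral>\<^sup>+ \<eta>. ennreal (cmod (wigner \<tau> f (y, \<eta>) * cnj (wigner \<tau> h (y, \<eta>)))) \<partial>lborel) \<partial>lborel)"
    unfolding W
    by (intro nn_integral_mono integral_norm_bound_ennreal Parseval(2) SW wiener_algebraD(3)[OF SW(2)])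
  also have "\<dots> = (\<integral>\<^sup>+ w. ennreal (cmod (wigner \<tau> f w) * cmod (wigner \<tau> h w)) \<partial>lborel)"
    by (subst nn_integral_lborel_fst) (simp_all add: norm_mult)
  finally show ?thesis unfolding a_def .
qed

lemma spectrogram_le_convolution:
  fixes f g :: "real ^ 'n \<Rightarrow> complex"
  assumes f: "f \<in> wiener_algebra" and g: "g \<in> wiener_algebra" and \<tau>: "0 < \<tau>" "\<tau> < 1"
  shows "ennreal ((2 * pi) ^ CARD('n) * spectrogram g f z)
    \<le> (\<integral>\<^sup>+ w. ennreal (cmod (wigner \<tau> f w) * cmod (wigner (1 - \<tau>) (\<lambda>t. g (- t)) (z - w))) \<partial>lborel)"
  using Moyal_le[OF f wiener_algebra_tf_shift[OF g, of z] \<tau>]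
  by (simp add: spectrogram_def stft_eq_inner cmod_wigner_tf_shift wigner_reflect)

text \<open>For fixed x, \<open>stft g f (x, \<xi>)\<close> is the Fourier transform of the slice y
  \<mapsto> f(y) cnj(g(y - x)), so integrating over \<xi> recovers that slice at s. Multiplied by
  g(s - x) and integrated over x, it leaves f(s) times the squared L2 norm of g. Integrability of
  \<open>stft g f\<close> justifies the iterated integral.\<close>

lemma stft_inversion:
  fixes f g :: "real ^ 'n \<Rightarrow> complex"
  assumes f: "f \<in> wiener_algebra" and g: "g \<in> wiener_algebra" and V: "integrable lborel (stft g f)"
  shows "of_real ((2 * pi) ^ CARD('n) * (\<integral>y. (cmod (g y))\<^sup>2 \<partial>lborel)) * f s
    = (\<integral>z. stft g f z * tf_shift z g s \<partial>lborel)"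
proof -
  note F = wiener_algebraD[OF f] and G = wiener_algebraD[OF g]
  note [measurable] = F(5) G(5)
  obtain B where B: "\<And>x. cmod (g x) \<le> B" using G(2) by (auto simp: bounded_iff)
  have "integrable lborel (\<lambda>z. stft g f z * tf_shift z g s)"
  proof (rule Bochner_Integration.integrable_bound)
    show "integrable lborel (\<lambda>z. B * cmod (stft g f z))" using V by simp
    have [measurable]: "(\<lambda>z. tf_shift z g s) \<in> borel_measurable (borel \<Otimes>\<^sub>M borel)"
      unfolding tf_shift_def by measurable
    have [measurable]: "stft g f \<in> borel_measurable (borel \<Otimes>\<^sub>M borel)"
      by (simp add: borel_prod)
    have "(\<lambda>z. stft g f z * tf_shift z g s) \<in> borel_measurable (borel \<Otimes>\<^sub>M borel)" by measurable
    then show "(\<lambda>z. stft g f z * tf_shift z g s) \<in> borel_measurable lborel" by (simp add: borel_prod)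
    show "AE z in lborel. norm (stft g f z * tf_shift z g s) \<le> norm (B * cmod (stft g f z))"
      using B order_trans[OF norm_ge_zero B]
      by (auto simp: norm_mult abs_mult cmod_tf_shift mult.commute[of "cmod (stft _ _ _)"] intro!: mult_right_mono)
  qed
  then have int: "integrable (lborel \<Otimes>\<^sub>M lborel) (\<lambda>z. stft g f z * tf_shift z g s)"
    by (simp add: lborel_prod)
  have "(\<integral>z. stft g f z * tf_shift z g s \<partial>lborel) = (\<integral>z. stft g f z * tf_shift z g s \<partial>(lborel \<Otimes>\<^sub>M lborel))"
    by (simp add: lborel_prod)
  also have "\<dots> = (\<integral>x. (\<integral>\<xi>. stft g f (x, \<xi>) * tf_shift (x, \<xi>) g s \<partial>lborel) \<partial>lborel)"
    by (rule lborel_pair.integral_fst'[OF int, symmetric])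
  also have "\<dots> = (\<integral>x. of_real ((2 * pi) ^ CARD('n)) * f s * of_real ((cmod (g (s - x)))\<^sup>2) \<partial>lborel)"
  proof (intro Bochner_Integration.integral_cong refl)
    fix x
    let ?S = "\<lambda>y. f y * cnj (g (- x + 1 *\<^sub>R y))"
    have S: "?S \<in> wiener_algebra"
      by (intro wiener_algebra_mult wiener_algebra_cnj wiener_algebra_affine f g) auto
    have "(\<integral>\<xi>. stft g f (x, \<xi>) * tf_shift (x, \<xi>) g s \<partial>lborel)
        = (\<integral>\<xi>. g (s - x) * (fourier ?S \<xi> * exp (\<i> * of_real (s \<bullet> \<xi>))) \<partial>lborel)"
      unfolding stft_eq_fourier tf_shift_def fst_conv snd_conv by (simp only: mult_ac)
    also have "\<dots> = g (s - x) * (of_real ((2 * pi) ^ CARD('n)) * ?S s)"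
      unfolding integral_mult_right_zero fourier_inversion[OF S] ..
    also have "\<dots> = of_real ((2 * pi) ^ CARD('n)) * f s * (g (s - x) * cnj (g (s - x)))"
      by (simp add: mult_ac)
    finally show "(\<integral>\<xi>. stft g f (x, \<xi>) * tf_shift (x, \<xi>) g s \<partial>lborel)
        = of_real ((2 * pi) ^ CARD('n)) * f s * of_real ((cmod (g (s - x)))\<^sup>2)"
      unfolding complex_norm_square .
  qed
  also have "\<dots> = of_real ((2 * pi) ^ CARD('n)) * f s * of_real (\<integral>x. (cmod (g (s - x)))\<^sup>2 \<partial>lborel)"
    unfolding integral_mult_right_zero integral_complex_of_real ..
  also have "(\<integral>x. (cmod (g (s - x)))\<^sup>2 \<partial>lborel) = (\<integral>y. (cmod (g y))\<^sup>2 \<partial>lborel)"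
    using integral_lborel_affine[of "-1" "\<lambda>y. (cmod (g y))\<^sup>2" s] by simp
  finally show ?thesis by (simp add: mult_ac)
qed

text \<open>Time-frequency shifts of a bounded g are bounded uniformly in z, so they form an
  admissible kernel for \<open>Fubini_bounded_kernel\<close> between V and the second slot of the
  Wigner integrand; \<tau> < 1 keeps that slot integrable in t.\<close>

lemma cross_wigner_expand_fst:
  fixes f g h :: "real ^ 'n \<Rightarrow> complex"
  assumes h: "integrable lborel h" and V: "integrable lborel V" and \<tau>: "\<tau> < 1"
    and g [measurable]: "g \<in> borel_measurable borel" and B: "\<And>x. cmod (g x) \<le> B"
    and f: "\<And>s. f s = of_real c * (\<integral>z. V z * tf_shift z g s \<partial>lborel)"
  shows "ennreal (cmod (cross_wigner \<tau> f h u))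
    \<le> ennreal \<bar>c\<bar> * (\<integral>\<^sup>+ z. ennreal (cmod (V z) * cmod (cross_wigner \<tau> (tf_shift z g) h u)) \<partial>lborel)"
proof (cases u)
  case (Pair x \<xi>)
  define a where "a t = exp (- \<i> * of_real (t \<bullet> \<xi>)) * cnj (h (x - (1 - \<tau>) *\<^sub>R t))" for t
  define k where "k z t = tf_shift z g (x + \<tau> *\<^sub>R t)" for z t
  have "integrable lborel (\<lambda>t. h (x - (1 - \<tau>) *\<^sub>R t))"
    using integrable_lborel_affine[OF h, of "- (1 - \<tau>)" x] \<tau> unfolding add_scaleR_neg by simp
  then have inta: "integrable lborel a"
    unfolding a_def by (intro integrable_unimodular_mult) auto
  have meas: "case_prod k \<in> borel_measurable (borel \<Otimes>\<^sub>M borel)"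
  proof -
    have "(\<lambda>p. exp (\<i> * complex_of_real ((x + \<tau> *\<^sub>R snd p) \<bullet> snd (fst p))) * g (x + \<tau> *\<^sub>R snd p - fst (fst p)))
        \<in> borel_measurable ((borel \<Otimes>\<^sub>M borel) \<Otimes>\<^sub>M borel)" by measurable
    then show ?thesis by (simp add: k_def tf_shift_def case_prod_beta' borel_prod)
  qed
  have kB: "cmod (k z t) \<le> B" for z t by (simp add: k_def cmod_tf_shift B)
  note Fub = Fubini_bounded_kernel[OF inta V meas kB]
  have W: "cross_wigner \<tau> f' h u = (\<integral>t. a t * f' (x + \<tau> *\<^sub>R t) \<partial>lborel)" for f'
    by (simp add: cross_wigner_def Pair a_def mult_ac)
  have "cross_wigner \<tau> f h u = of_real c * (\<integral>t. a t * (\<integral>z. V z * k z t \<partial>lborel) \<partial>lborel)"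
    unfolding W f integral_mult_right_zero[symmetric] k_def by (simp only: mult_ac)
  also have "\<dots> = of_real c * (\<integral>z. V z * cross_wigner \<tau> (tf_shift z g) h u \<partial>lborel)"
    unfolding W k_def[symmetric] Fub(1) ..
  finally have "ennreal (cmod (cross_wigner \<tau> f h u))
      = ennreal \<bar>c\<bar> * ennreal (cmod (\<integral>z. V z * cross_wigner \<tau> (tf_shift z g) h u \<partial>lborel))"
    by (simp add: norm_mult ennreal_mult)
  also have "\<dots> \<le> ennreal \<bar>c\<bar> * (\<integral>\<^sup>+ z. ennreal (cmod (V z * cross_wigner \<tau> (tf_shift z g) h u)) \<partial>lborel)"
    using Fub(2) unfolding W k_def by (intro mult_left_mono integral_norm_bound_ennreal) auto
  finally show ?thesis by (simp add: norm_mult)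
qed

text \<open>The first slot is expanded directly, the second after exchanging slots and passing to 1
  - \<tau>. What remains is the cross-Wigner transform of two shifts of g, which by covariance has
  the modulus of \<open>wigner \<tau> g\<close> at a displaced point.\<close>

lemma wigner_expand:
  fixes f g :: "real ^ 'n \<Rightarrow> complex"
  assumes f: "integrable lborel f" and V: "integrable lborel V" and \<tau>: "0 < \<tau>" "\<tau> < 1"
    and g: "integrable lborel g" and B: "\<And>x. cmod (g x) \<le> B"
    and exp: "\<And>s. f s = of_real c * (\<integral>z. V z * tf_shift z g s \<partial>lborel)"
  shows "ennreal (cmod (wigner \<tau> f (x, \<xi>))) \<le> ennreal \<bar>c\<bar> * (\<integral>\<^sup>+ z. ennreal (cmod (V z)) *
     (ennreal \<bar>c\<bar> * (\<integral>\<^sup>+ w. ennreal (cmod (V w)) * ennreal (cmod (wigner \<tau> g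
        (x - (1 - \<tau>) *\<^sub>R fst z - \<tau> *\<^sub>R fst w, \<xi> - \<tau> *\<^sub>R snd z - (1 - \<tau>) *\<^sub>R snd w))) \<partial>lborel)) \<partial>lborel)"
proof -
  let ?u = "(x, \<xi>)"
  have gm: "g \<in> borel_measurable borel" using g by auto
  have swap: "cmod (cross_wigner (1 - \<tau>) h k u) = cmod (cross_wigner \<tau> k h u)" for h k :: "real ^ 'n \<Rightarrow> complex" and u
    by (simp add: cnj_cross_wigner)
  have "ennreal (cmod (wigner \<tau> f ?u))
      \<le> ennreal \<bar>c\<bar> * (\<integral>\<^sup>+ z. ennreal (cmod (V z) * cmod (cross_wigner \<tau> (tf_shift z g) f ?u)) \<partial>lborel)"
    unfolding wigner_eq_cross_wigner by (rule cross_wigner_expand_fst[OF f V \<tau>(2) gm B exp])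
  also have "\<dots> \<le> ennreal \<bar>c\<bar> * (\<integral>\<^sup>+ z. ennreal (cmod (V z)) *
     (ennreal \<bar>c\<bar> * (\<integral>\<^sup>+ w. ennreal (cmod (V w)) * ennreal (cmod (wigner \<tau> g
        (x - (1 - \<tau>) *\<^sub>R fst z - \<tau> *\<^sub>R fst w, \<xi> - \<tau> *\<^sub>R snd z - (1 - \<tau>) *\<^sub>R snd w))) \<partial>lborel)) \<partial>lborel)"
  proof (intro mult_left_mono nn_integral_mono)
    fix z
    have intg: "integrable lborel (tf_shift z g)"
      using integrable_unimodular_mult(1)[OF integrable_lborel_affine[OF g, of 1 "- fst z"], of "\<lambda>y. exp (\<i> * of_real (y \<bullet> snd z))"]
      by (simp add: tf_shift_def)
    have "ennreal (cmod (cross_wigner \<tau> (tf_shift z g) f ?u)) = ennreal (cmod (cross_wigner (1 - \<tau>) f (tf_shift z g) ?u))"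
      by (simp only: swap)
    also have "\<dots> \<le> ennreal \<bar>c\<bar> * (\<integral>\<^sup>+ w. ennreal (cmod (V w) * cmod (cross_wigner (1 - \<tau>) (tf_shift w g) (tf_shift z g) ?u)) \<partial>lborel)"
      using \<tau> by (intro cross_wigner_expand_fst[OF intg V _ gm B exp]) simp
    also have "(\<lambda>w. ennreal (cmod (V w) * cmod (cross_wigner (1 - \<tau>) (tf_shift w g) (tf_shift z g) ?u)))
        = (\<lambda>w. ennreal (cmod (V w)) * ennreal (cmod (wigner \<tau> g
        (x - (1 - \<tau>) *\<^sub>R fst z - \<tau> *\<^sub>R fst w, \<xi> - \<tau> *\<^sub>R snd z - (1 - \<tau>) *\<^sub>R snd w))))"
    proof
      fix w
      show "ennreal (cmod (V w) * cmod (cross_wigner (1 - \<tau>) (tf_shift w g) (tf_shift z g) ?u))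
        = ennreal (cmod (V w)) * ennreal (cmod (wigner \<tau> g
        (x - (1 - \<tau>) *\<^sub>R fst z - \<tau> *\<^sub>R fst w, \<xi> - \<tau> *\<^sub>R snd z - (1 - \<tau>) *\<^sub>R snd w)))"
        using cmod_cross_wigner_tf_shift[of \<tau> "fst z" "snd z" g "fst w" "snd w" g x \<xi>]
        by (simp add: swap wigner_eq_cross_wigner ennreal_mult)
    qed
    finally show "ennreal (cmod (V z) * cmod (cross_wigner \<tau> (tf_shift z g) f ?u)) \<le> ennreal (cmod (V z)) *
     (ennreal \<bar>c\<bar> * (\<integral>\<^sup>+ w. ennreal (cmod (V w)) * ennreal (cmod (wigner \<tau> g
        (x - (1 - \<tau>) *\<^sub>R fst z - \<tau> *\<^sub>R fst w, \<xi> - \<tau> *\<^sub>R snd z - (1 - \<tau>) *\<^sub>R snd w))) \<partial>lborel))"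
      by (simp add: ennreal_mult mult_left_mono)
  qed auto
  finally show ?thesis .
qed

section \<open>Weights\<close>

lemma weight_nonneg: "weight_function \<omega> \<Longrightarrow> 0 \<le> t \<Longrightarrow> 0 \<le> \<omega> t"
  by (simp add: weight_function_def)

lemma weight_mono: "weight_function \<omega> \<Longrightarrow> 0 \<le> s \<Longrightarrow> s \<le> t \<Longrightarrow> \<omega> s \<le> \<omega> t"
  unfolding weight_function_def by (auto intro: mono_onD)

lemma continuous_on_weight_norm:
  fixes S :: "'a::real_normed_vector set"
  assumes "weight_function \<omega>"
  shows "continuous_on S (\<lambda>z. \<omega> (norm z))"
proof -
  have c: "continuous_on {0..} \<omega>" using assms by (simp add: weight_function_def)
  show ?thesis by (rule continuous_on_compose2[OF c]) (auto intro: continuous_intros)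
qed

lemma borel_measurable_weight_norm:
  assumes "weight_function \<omega>"
  shows "(\<lambda>z::'a::euclidean_space. \<omega> (norm z)) \<in> borel_measurable borel"
  by (rule borel_measurable_continuous_onI) (rule continuous_on_weight_norm[OF assms])

lemma borel_measurable_weighted:
  fixes f :: "'a::euclidean_space \<Rightarrow> 'b::{real_normed_vector, second_countable_topology}"
  assumes "weight_function \<omega>" and [measurable]: "f \<in> borel_measurable borel"
  shows "weighted \<omega> a f \<in> borel_measurable borel"
proof -
  note [measurable] = borel_measurable_weight_norm[OF assms(1)]
  show ?thesis unfolding weighted_def by measurable
qed

lemma norm_weighted: "norm (weighted \<omega> a f z) = exp (a * \<omega> (norm z)) * norm (f z)"
  by (simp add: weighted_def)

text \<open>Doubling substitutes for subadditivity: r is at most twice the larger of s and t, and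
  nonnegativity bounds the larger weight by the sum.\<close>

lemma weight_add_le:
  assumes \<omega>: "weight_function \<omega>" and K: "weight_doubling \<omega> K"
    and "0 \<le> r" "0 \<le> s" "0 \<le> t" "r \<le> s + t"
  shows "\<omega> r \<le> K * (1 + \<omega> s + \<omega> t)"
proof -
  have K1: "1 \<le> K" and K2: "\<And>t. 0 \<le> t \<Longrightarrow> \<omega> (2 * t) \<le> K * (1 + \<omega> t)"
    using K by (auto simp: weight_doubling_def)
  have "\<omega> r \<le> \<omega> (2 * max s t)" using assms by (intro weight_mono[OF \<omega>]) auto
  also have "\<dots> \<le> K * (1 + \<omega> (max s t))" using assms by (intro K2) auto
  also have "\<dots> \<le> K * (1 + \<omega> s + \<omega> t)"
    using K1 weight_nonneg[OF \<omega>, of s] weight_nonneg[OF \<omega>, of t] assms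
    by (intro mult_left_mono) (auto simp: max_def)
  finally show ?thesis .
qed

lemma weight_norm_le:
  assumes "weight_function \<omega>" and "weight_doubling \<omega> K" and "norm u \<le> norm v + norm w"
  shows "\<omega> (norm u) \<le> K * (1 + \<omega> (norm v) + \<omega> (norm w))"
  using assms(3) by (intro weight_add_le[OF assms(1,2)]) auto

lemma integrable_inverse_1_plus_square': "integrable lborel (\<lambda>x::real. complex_of_real (1 / (1 + x\<^sup>2)))"
proof -
  have "integrable lborel (\<lambda>x::real. 1 / (1 + x\<^sup>2))"
    using integrable_inverse_1_plus_square
    by (simp add: set_integrable_def einterval_def inverse_eq_divide)
  then show ?thesis by (rule integrable_of_real)
qed

text \<open>With exponent 2N/b the logarithmic lower bound gives decay like (1 + |x|)^(-2N). Since 1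
  + x_i^2 is at most (1 + |x|)^2 for each coordinate, this is dominated by a product of N
  one-dimensional functions 1 / (1 + x_i^2).\<close>

lemma integrable_exp_neg_weight:
  assumes \<omega>: "weight_function \<omega>" and b: "weight_log_bound \<omega> b"
  shows "integrable lborel (\<lambda>x::real ^ 'n. exp (- (2 * real CARD('n) / b) * \<omega> (norm x)))"
proof -
  obtain a where b0: "0 < b" and a: "\<And>t. 0 \<le> t \<Longrightarrow> a + b * ln (1 + t) \<le> \<omega> t"
    using b by (auto simp: weight_log_bound_def)
  note [measurable] = borel_measurable_weight_norm[OF \<omega>]
  define N where "N = CARD('n)"
  define \<mu> where "\<mu> = 2 * real N / b"
  have \<mu>: "0 \<le> \<mu>" "\<mu> * b = 2 * real N" using b0 by (auto simp: \<mu>_def)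
  have "integrable lborel (\<lambda>x::real ^ 'n. \<Prod>i\<in>Basis. complex_of_real (1 / (1 + (x \<bullet> i)\<^sup>2)))"
    by (rule lborel_integral_prod) (rule integrable_inverse_1_plus_square')
  then have "integrable lborel (\<lambda>x::real ^ 'n. exp (- \<mu> * a) * norm (\<Prod>i\<in>Basis. complex_of_real (1 / (1 + (x \<bullet> i)\<^sup>2))))"
    by simp
  then have "integrable lborel (\<lambda>x::real ^ 'n. exp (- \<mu> * \<omega> (norm x)))"
  proof (rule Bochner_Integration.integrable_bound, goal_cases)
    case 2
    show ?case
    proof (rule AE_I2)
      fix x :: "real ^ 'n"
      have "(\<Prod>i\<in>Basis. (1 + (x \<bullet> i)\<^sup>2)) \<le> (\<Prod>i\<in>(Basis::(real^'n) set). (1 + norm x)\<^sup>2)"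
      proof (rule prod_mono, safe)
        fix i :: "real ^ 'n" assume "i \<in> Basis"
        then have "\<bar>x \<bullet> i\<bar> \<le> norm x" by (rule Basis_le_norm)
        then have "(x \<bullet> i)\<^sup>2 \<le> (norm x)\<^sup>2" using abs_le_square_iff[of "x \<bullet> i" "norm x"] by simp
        then show "1 + (x \<bullet> i)\<^sup>2 \<le> (1 + norm x)\<^sup>2"
          unfolding power2_sum power_one using norm_ge_zero[of x] by linarith
        show "0 \<le> 1 + (x \<bullet> i)\<^sup>2" by simp
      qed
      also have "\<dots> = ((1 + norm x)\<^sup>2) ^ N" by (simp add: N_def)
      also have "\<dots> = (1 + norm x) ^ (2 * N)" by (rule power_mult[symmetric])
      finally have le: "(\<Prod>i\<in>Basis. (1 + (x \<bullet> i)\<^sup>2)) \<le> (1 + norm x) ^ (2 * N)" .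
      have pos: "0 < (\<Prod>i\<in>Basis. (1 + (x \<bullet> i)\<^sup>2))"
        by (rule prod_pos) (auto intro: add_pos_nonneg)
      have n1: "0 < 1 + norm x" by (simp add: add_pos_nonneg)
      have "exp (- \<mu> * \<omega> (norm x)) \<le> exp (- \<mu> * (a + b * ln (1 + norm x)))"
        using mult_left_mono[OF a[of "norm x"] \<mu>(1)] by simp
      also have "- \<mu> * (a + b * ln (1 + norm x)) = - \<mu> * a + - (real (2 * N) * ln (1 + norm x))"
        using \<mu>(2) by (simp add: algebra_simps)
      also have "exp \<dots> = exp (- \<mu> * a) * inverse (exp (real (2 * N) * ln (1 + norm x)))"
        by (simp only: exp_add exp_minus)
      also have "exp (real (2 * N) * ln (1 + norm x)) = (1 + norm x) ^ (2 * N)"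
        by (simp only: exp_of_nat_mult exp_ln[OF n1])
      also have "exp (- \<mu> * a) * inverse ((1 + norm x) ^ (2 * N)) \<le> exp (- \<mu> * a) * inverse (\<Prod>i\<in>Basis. (1 + (x \<bullet> i)\<^sup>2))"
        using le pos by (intro mult_left_mono le_imp_inverse_le) auto
      also have "inverse (\<Prod>i\<in>Basis. (1 + (x \<bullet> i)\<^sup>2)) = norm (\<Prod>i\<in>Basis. complex_of_real (1 / (1 + (x \<bullet> i)\<^sup>2)))"
        by (simp add: prod_norm[symmetric] norm_divide prod_dividef inverse_eq_divide del: of_real_add)
      finally show "norm (exp (- \<mu> * \<omega> (norm x))) \<le> norm (exp (- \<mu> * a) * norm (\<Prod>i\<in>Basis. complex_of_real (1 / (1 + (x \<bullet> i)\<^sup>2))))"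
        by simp
    qed
  qed measurable
  then show ?thesis by (simp add: \<mu>_def N_def)
qed

lemma weighted_sup_bound:
  fixes f :: "'a::euclidean_space \<Rightarrow> complex"
  assumes \<omega>: "weight_function \<omega>" and f: "continuous_on UNIV f"
  shows "ennreal (cmod (f x)) \<le> ennreal (exp (- a * \<omega> (norm x))) * Lnorm \<infinity> (weighted \<omega> a f)"
proof -
  have "continuous_on UNIV (weighted \<omega> a f)"
    unfolding weighted_def by (intro continuous_intros continuous_on_weight_norm \<omega> f)
  from Lnorm_infinity_ge[OF this, of x]
  have "ennreal (exp (- a * \<omega> (norm x))) * ennreal (exp (a * \<omega> (norm x)) * cmod (f x))
      \<le> ennreal (exp (- a * \<omega> (norm x))) * Lnorm \<infinity> (weighted \<omega> a f)"
    unfolding norm_weighted by (rule mult_left_mono) simp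
  moreover have "exp (- a * \<omega> (norm x)) * (exp (a * \<omega> (norm x)) * cmod (f x)) = cmod (f x)"
    by (simp add: mult.assoc[symmetric] exp_add[symmetric])
  ultimately show ?thesis by (simp only: ennreal_mult'[symmetric] exp_ge_zero)
qed

section \<open>Decay and integrability of the functions in \<open>S_omega\<close>\<close>

lemma S_omegaD:
  assumes "f \<in> S_omega \<omega>"
  shows "integrable lborel f" "continuous_on UNIV f" "continuous_on UNIV (fourier f)"
    "0 < a \<Longrightarrow> Lnorm \<infinity> (weighted \<omega> a f) < \<infinity>" "0 < a \<Longrightarrow> Lnorm \<infinity> (weighted \<omega> a (fourier f)) < \<infinity>"
proof -
  \<comment> \<open>The empty list encodes the zero multi-index, so the defining conditions contain
    continuity and decay of f and of its transform themselves.\<close>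
  have *: "iter_partial_deriv [] h = h" for h :: "real ^ 'n \<Rightarrow> complex"
    by (simp add: iter_partial_deriv_def)
  have s: "smooth_fun f" "smooth_fun (fourier f)"
    and w: "\<And>a js. 0 < a \<Longrightarrow> Lnorm \<infinity> (weighted \<omega> a (iter_partial_deriv js f)) < \<infinity>"
      "\<And>a js. 0 < a \<Longrightarrow> Lnorm \<infinity> (weighted \<omega> a (iter_partial_deriv js (fourier f))) < \<infinity>"
    using assms by (auto simp: S_omega_def)
  show "continuous_on UNIV f" "continuous_on UNIV (fourier f)"
    using s *[of f] *[of "fourier f"] unfolding smooth_fun_def by metis+
  show "0 < a \<Longrightarrow> Lnorm \<infinity> (weighted \<omega> a f) < \<infinity>" "0 < a \<Longrightarrow> Lnorm \<infinity> (weighted \<omega> a (fourier f)) < \<infinity>"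
    using w[of a "[]"] by (simp_all add: *)
  show "integrable lborel f" using assms by (simp add: S_omega_def)
qed

lemma weighted_bound_real:
  fixes f :: "'a::euclidean_space \<Rightarrow> complex"
  assumes \<omega>: "weight_function \<omega>" and f: "continuous_on UNIV f"
    and fin: "Lnorm \<infinity> (weighted \<omega> a f) < \<infinity>"
  obtains C where "\<And>x. cmod (f x) \<le> C * exp (- a * \<omega> (norm x))" "0 \<le> C"
proof -
  obtain C where C: "Lnorm \<infinity> (weighted \<omega> a f) = ennreal C" "0 \<le> C"
    using fin by (cases "Lnorm \<infinity> (weighted \<omega> a f)") auto
  have "cmod (f x) \<le> C * exp (- a * \<omega> (norm x))" for x
    using weighted_sup_bound[OF \<omega> f, of x a] C by (simp add: ennreal_mult[symmetric] mult.commute)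
  with C(2) that show ?thesis by blast
qed

text \<open>The decay rate 2N/b of \<open>integrable_exp_neg_weight\<close> is available for both f
  and its transform: for f it yields boundedness, for \<open>fourier f\<close>
  integrability.\<close>

lemma S_omega_subset_wiener_algebra:
  assumes \<omega>: "weight_function \<omega>" and f: "f \<in> S_omega \<omega>"
  shows "f \<in> (wiener_algebra :: (real ^ 'n \<Rightarrow> complex) set)"
proof -
  note D = S_omegaD[OF f]
  obtain b where b: "weight_log_bound \<omega> b" using \<omega> by (auto simp: weight_function_def)
  then have b0: "0 < b" by (simp add: weight_log_bound_def)
  let ?a = "2 * real CARD('n) / b"
  have a: "0 < ?a" using b0 by simp
  obtain C where C: "\<And>x. cmod (f x) \<le> C * exp (- ?a * \<omega> (norm x))" "0 \<le> C"
    using weighted_bound_real[OF \<omega> D(2) D(4)[OF a]] by blast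
  obtain C' where C': "\<And>x. cmod (fourier f x) \<le> C' * exp (- ?a * \<omega> (norm x))" "0 \<le> C'"
    using weighted_bound_real[OF \<omega> D(3) D(5)[OF a]] by blast
  have "cmod (f x) \<le> C" for x
  proof -
    have "0 \<le> ?a * \<omega> (norm x)" using a weight_nonneg[OF \<omega>, of "norm x"] by (intro mult_nonneg_nonneg) auto
    then have "exp (- ?a * \<omega> (norm x)) \<le> 1" by (simp only: mult_minus_left exp_le_one_iff neg_le_0_iff_le)
    then have "C * exp (- ?a * \<omega> (norm x)) \<le> C" using C(2) by (rule mult_left_le)
    with C(1)[of x] show ?thesis by linarith
  qed
  then have "bounded (range f)" by (auto simp: bounded_iff)
  moreover have "integrable lborel (fourier f)"
  proof (rule Bochner_Integration.integrable_bound)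
    show "integrable lborel (\<lambda>x::real^'n. C' * exp (- ?a * \<omega> (norm x)))"
      by (intro integrable_mult_right integrable_exp_neg_weight \<omega> b)
    show "fourier f \<in> borel_measurable lborel"
      using borel_measurable_continuous_onI[OF D(3)] by simp
    show "AE x in lborel. norm (fourier f x) \<le> norm (C' * exp (- ?a * \<omega> (norm x)))"
      using C' by auto
  qed
  ultimately show ?thesis using D by (simp add: wiener_algebra_def)
qed

section \<open>The weighted estimate of the spectrogram by the Wigner transform\<close>

lemma AE_lborel_reflect:
  fixes P :: "'a::euclidean_space \<Rightarrow> bool"
  assumes "Measurable.pred borel P" and "AE x in lborel. P x"
  shows "AE x in lborel. P (z - x)"
  using assms by (subst lborel_affine[of "-1" z]) (simp_all add: AE_density AE_distr_iff)

lemma Lnorm_reflect_le: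
  fixes F :: "'a::euclidean_space \<Rightarrow> 'b::real_normed_vector"
  assumes [measurable]: "F \<in> borel_measurable borel"
  shows "Lnorm q (\<lambda>w. F (z - w)) \<le> Lnorm q F"
proof (cases "q = \<infinity>")
  case True
  have "AE w in lborel. ennreal (norm (F (z - w))) \<le> Lnorm \<infinity> F"
    by (rule AE_lborel_reflect[of "\<lambda>w. ennreal (norm (F w)) \<le> Lnorm \<infinity> F"]) (measurable, rule Lnorm_infinity_AE)
  then show ?thesis
    unfolding True Lnorm_infinity[of "\<lambda>w. F (z - w)"] by (intro esssup_I) measurable
next
  case False
  have "(\<integral>\<^sup>+ w. ennreal (norm (F (z - w)) powr r) \<partial>lborel) = (\<integral>\<^sup>+ w. ennreal (norm (F w) powr r) \<partial>lborel)" for r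
    using nn_integral_lborel_affine[of "\<lambda>w. ennreal (norm (F w) powr r)" "-1" z] by simp
  with False show ?thesis by (simp add: Lnorm_def)
qed

lemma spectrogram_weighted_le:
  fixes f g :: "real ^ 'n \<Rightarrow> complex"
  assumes \<omega>: "weight_function \<omega>" and K: "weight_doubling \<omega> K"
    and f: "f \<in> wiener_algebra" and g: "g \<in> wiener_algebra" and \<tau>: "0 < \<tau>" "\<tau> < 1" and p: "1 \<le> p"
    and lam: "0 \<le> lam"
  shows "Lnorm \<infinity> (weighted \<omega> lam (spectrogram g f)) \<le>
    D5 \<omega> K p \<tau> g lam * Lnorm p (weighted \<omega> (K * lam) (wigner \<tau> f))"
proof (rule Lnorm_infinity_le)
  note [measurable] = wiener_algebraD(5)[OF f] wiener_algebraD(5)[OF g]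
  have Sp [measurable]: "spectrogram g f \<in> borel_measurable borel"
    unfolding spectrogram_def by measurable
  then show "weighted \<omega> lam (spectrogram g f) \<in> borel_measurable borel"
    by (rule borel_measurable_weighted[OF \<omega>])
  let ?F = "weighted \<omega> (K * lam) (wigner \<tau> f)"
  let ?W = "wigner (1 - \<tau>) (\<lambda>t. g (- t))"
  let ?G = "weighted \<omega> (K * lam) ?W"
  have W [measurable]: "?W \<in> borel_measurable borel" by (intro borel_measurable_wigner) measurable
  have [measurable]: "?F \<in> borel_measurable borel" "?G \<in> borel_measurable borel"
    by (intro borel_measurable_weighted \<omega>; measurable)+
  have K1: "1 \<le> K" using K by (simp add: weight_doubling_def)
  fix z :: "(real ^ 'n) \<times> (real ^ 'n)"
  \<comment> \<open>The factor (2 pi)^N supplied by Moyal's identity is at least 1 and is discarded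
    here, which is why \<open>D5\<close> contains no power of 2 pi.\<close>
  have N: "1 \<le> (2 * pi) ^ CARD('n)" using pi_gt3 by (intro one_le_power) auto
  have "spectrogram g f z \<le> (2 * pi) ^ CARD('n) * spectrogram g f z"
    using mult_right_mono[OF N, of "spectrogram g f z"] by (simp add: spectrogram_def)
  then have "ennreal (spectrogram g f z) \<le> ennreal ((2 * pi) ^ CARD('n) * spectrogram g f z)"
    by (rule ennreal_leI)
  also have "\<dots> \<le> (\<integral>\<^sup>+ w. ennreal (cmod (wigner \<tau> f w) * cmod (?W (z - w))) \<partial>lborel)"
    by (rule spectrogram_le_convolution[OF f g \<tau>])
  finally have "ennreal (norm (weighted \<omega> lam (spectrogram g f) z))
      \<le> ennreal (exp (lam * \<omega> (norm z))) * (\<integral>\<^sup>+ w. ennreal (cmod (wigner \<tau> f w) * cmod (?W (z - w))) \<partial>lborel)"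
    unfolding norm_weighted by (simp add: ennreal_mult mult_left_mono spectrogram_def)
  also have "\<dots> = (\<integral>\<^sup>+ w. ennreal (exp (lam * \<omega> (norm z))) * ennreal (cmod (wigner \<tau> f w) * cmod (?W (z - w))) \<partial>lborel)"
    by (rule nn_integral_cmult[symmetric]) measurable
  also have "\<dots> \<le> (\<integral>\<^sup>+ w. ennreal (exp (K * lam)) * ennreal (norm (?F w) * norm (?G (z - w))) \<partial>lborel)"
  proof (intro nn_integral_mono)
    fix w :: "(real ^ 'n) \<times> (real ^ 'n)"
    have "lam * \<omega> (norm z) \<le> lam * (K * (1 + \<omega> (norm w) + \<omega> (norm (z - w))))"
      using norm_triangle_ineq[of w "z - w"] by (intro mult_left_mono weight_norm_le[OF \<omega> K] lam) simp
    then have "exp (lam * \<omega> (norm z)) \<le> exp (K * lam + K * lam * \<omega> (norm w) + K * lam * \<omega> (norm (z - w)))"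
      by (simp add: algebra_simps)
    then have "exp (lam * \<omega> (norm z)) * (cmod (wigner \<tau> f w) * cmod (?W (z - w)))
        \<le> exp (K * lam + K * lam * \<omega> (norm w) + K * lam * \<omega> (norm (z - w))) * (cmod (wigner \<tau> f w) * cmod (?W (z - w)))"
      by (rule mult_right_mono) simp
    also have "\<dots> = exp (K * lam) * (norm (?F w) * norm (?G (z - w)))"
      unfolding norm_weighted by (simp add: exp_add mult_ac)
    finally show "ennreal (exp (lam * \<omega> (norm z))) * ennreal (cmod (wigner \<tau> f w) * cmod (?W (z - w)))
        \<le> ennreal (exp (K * lam)) * ennreal (norm (?F w) * norm (?G (z - w)))"
      by (simp add: ennreal_mult'[symmetric] ennreal_leI)
  qed
  also have "\<dots> = ennreal (exp (K * lam)) * (\<integral>\<^sup>+ w. ennreal (norm (?F w) * norm (?G (z - w))) \<partial>lborel)"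
    by (rule nn_integral_cmult) measurable
  also have "\<dots> \<le> ennreal (exp (K * lam)) * (Lnorm p ?F * Lnorm (conj_exponent p) (\<lambda>w. ?G (z - w)))"
    using p by (intro mult_left_mono Lnorm_Holder) auto
  also have "\<dots> \<le> ennreal (exp (K * lam)) * (Lnorm p ?F * Lnorm (conj_exponent p) ?G)"
    by (intro mult_left_mono Lnorm_reflect_le) auto
  also have "\<dots> = D5 \<omega> K p \<tau> g lam * Lnorm p ?F"
    by (simp add: D5_def mult_ac)
  finally show "ennreal (norm (weighted \<omega> lam (spectrogram g f) z)) \<le> D5 \<omega> K p \<tau> g lam * Lnorm p ?F" .
qed

section \<open>Decay of the Wigner transform\<close>

lemma integral_norm_bound_nn:
  fixes f :: "'a \<Rightarrow> 'b::{banach, second_countable_topology}"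
  shows "ennreal (norm (integral\<^sup>L M f)) \<le> (\<integral>\<^sup>+ x. ennreal (norm (f x)) \<partial>M)"
  by (cases "integrable M f") (simp_all add: integral_norm_bound_ennreal not_integrable_integral_eq)

text \<open>The geometric mean of two bounds is taken by multiplying their squares; this extracts
  the resulting fourth root without defining roots on \<open>ennreal\<close>.\<close>

lemma ennreal_power_le_imp_le:
  fixes x y :: ennreal
  assumes "x ^ n \<le> y ^ n" and "0 < n"
  shows "x \<le> y"
proof (cases x; cases y)
  fix r s assume r: "x = ennreal r" "0 \<le> r" and s: "y = ennreal s" "0 \<le> s"
  then have "r ^ n \<le> s ^ n" using assms by (simp add: ennreal_power)
  then have "r \<le> s" using s assms(2) by (meson power_mono_iff r(2))
  then show ?thesis using r s by simp
next
  fix s assume "x = top" and s: "y = ennreal s" "0 \<le> s"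
  then show ?thesis using assms by (simp add: ennreal_power top_unique)
qed auto

text \<open>Both x and \<xi> will be convex combinations of the two points at which g, respectively
  its transform, is evaluated; so one of these points is at least as long, and its decay can be
  charged.\<close>

lemma norm_convex_combination_le_max:
  fixes u v :: "'a::real_normed_vector"
  assumes "0 \<le> s" "s \<le> 1"
  shows "norm (s *\<^sub>R u + (1 - s) *\<^sub>R v) \<le> max (norm u) (norm v)"
proof -
  have "norm (s *\<^sub>R u + (1 - s) *\<^sub>R v) \<le> s * norm u + (1 - s) * norm v"
    using norm_triangle_ineq[of "s *\<^sub>R u" "(1 - s) *\<^sub>R v"] assms by simp
  also have "\<dots> \<le> s * max (norm u) (norm v) + (1 - s) * max (norm u) (norm v)"
    using assms by (intro add_mono mult_left_mono) auto
  finally show ?thesis by (simp add: algebra_simps)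
qed

text \<open>Splitting \<open>a1 + a2\<close>: the \<open>a1\<close>-part gives decay in \<open>x\<close>, since one of the two arguments is at least as
  long as \<open>x\<close>, and the \<open>a2\<close>-part is integrated by Cauchy--Schwarz.\<close>

lemma weight_product_integral_le:
  fixes x c d :: "real ^ 'n"
  assumes \<omega>: "weight_function \<omega>" and a: "0 \<le> a1" "0 \<le> a2" and ab: "\<alpha> \<noteq> 0" "\<beta> \<noteq> 0"
    and x: "\<And>t. norm x \<le> max (norm (c + \<alpha> *\<^sub>R t)) (norm (d + \<beta> *\<^sub>R t))"
  shows "(\<integral>\<^sup>+ t. ennreal (exp (- (a1 + a2) * \<omega> (norm (c + \<alpha> *\<^sub>R t)))) *
             ennreal (exp (- (a1 + a2) * \<omega> (norm (d + \<beta> *\<^sub>R t)))) \<partial>lborel)\<^sup>2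
    \<le> ennreal (exp (- 2 * a1 * \<omega> (norm x)) / (\<bar>\<alpha>\<bar> * \<bar>\<beta>\<bar>) ^ CARD('n)) *
       (\<integral>\<^sup>+ s. ennreal (exp (- 2 * a2 * \<omega> (norm (s :: real ^ 'n)))) \<partial>lborel)\<^sup>2"
proof -
  note [measurable] = borel_measurable_weight_norm[OF \<omega>, where 'a="real ^ 'n"]
  define E where "E a y = ennreal (exp (- a * \<omega> (norm y)))" for a and y :: "real ^ 'n"
  have [measurable]: "E a \<in> borel_measurable borel" for a unfolding E_def by measurable
  define e where "e = ennreal (exp (- a1 * \<omega> (norm x)))"
  have aff: "(\<integral>\<^sup>+ t. E (2 * a2) (c + \<alpha> *\<^sub>R t) \<partial>lborel) = ennreal (1 / \<bar>\<alpha>\<bar> ^ CARD('n)) * (\<integral>\<^sup>+ s. E (2 * a2) s \<partial>lborel)"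
    if "\<alpha> \<noteq> 0" for \<alpha> c
  proof -
    have "ennreal (1 / \<bar>\<alpha>\<bar> ^ CARD('n)) * (\<integral>\<^sup>+ s. E (2 * a2) s \<partial>lborel)
        = ennreal (1 / \<bar>\<alpha>\<bar> ^ CARD('n)) * (ennreal (\<bar>\<alpha>\<bar> ^ CARD('n)) * (\<integral>\<^sup>+ t. E (2 * a2) (c + \<alpha> *\<^sub>R t) \<partial>lborel))"
      using nn_integral_lborel_affine[of "E (2 * a2)" \<alpha> c] that by simp
    also have "\<dots> = (\<integral>\<^sup>+ t. E (2 * a2) (c + \<alpha> *\<^sub>R t) \<partial>lborel)"
      using that by (simp add: mult.assoc[symmetric] ennreal_mult[symmetric])
    finally show ?thesis ..
  qed
  have sq: "(E a2 y)\<^sup>2 = E (2 * a2) y" for y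
    unfolding E_def by (simp add: ennreal_power exp_double[symmetric] mult.assoc)
  have "E (a1 + a2) (c + \<alpha> *\<^sub>R t) * E (a1 + a2) (d + \<beta> *\<^sub>R t) \<le> e * (E a2 (c + \<alpha> *\<^sub>R t) * E a2 (d + \<beta> *\<^sub>R t))" for t
  proof -
    let ?p = "\<omega> (norm (c + \<alpha> *\<^sub>R t))" and ?q = "\<omega> (norm (d + \<beta> *\<^sub>R t))"
    have nn: "0 \<le> ?p" "0 \<le> ?q" by (auto intro: weight_nonneg[OF \<omega>])
    have "\<omega> (norm x) \<le> \<omega> (max (norm (c + \<alpha> *\<^sub>R t)) (norm (d + \<beta> *\<^sub>R t)))"
      using x[of t] by (intro weight_mono[OF \<omega>]) auto
    also have "\<dots> \<le> ?p + ?q" using nn by (auto simp: max_def)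
    finally have "a1 * \<omega> (norm x) \<le> a1 * (?p + ?q)" using a(1) by (rule mult_left_mono)
    then have "exp (- (a1 + a2) * ?p + - (a1 + a2) * ?q) \<le> exp (- a1 * \<omega> (norm x) + (- a2 * ?p + - a2 * ?q))"
      by (simp add: algebra_simps)
    then show ?thesis
      unfolding E_def e_def by (simp only: exp_add ennreal_mult[symmetric] exp_ge_zero mult_nonneg_nonneg ennreal_leI)
  qed
  then have "(\<integral>\<^sup>+ t. E (a1 + a2) (c + \<alpha> *\<^sub>R t) * E (a1 + a2) (d + \<beta> *\<^sub>R t) \<partial>lborel)
      \<le> (\<integral>\<^sup>+ t. e * (E a2 (c + \<alpha> *\<^sub>R t) * E a2 (d + \<beta> *\<^sub>R t)) \<partial>lborel)"
    by (rule nn_integral_mono)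
  also have "\<dots> = e * (\<integral>\<^sup>+ t. E a2 (c + \<alpha> *\<^sub>R t) * E a2 (d + \<beta> *\<^sub>R t) \<partial>lborel)"
    by (rule nn_integral_cmult) measurable
  finally have "(\<integral>\<^sup>+ t. E (a1 + a2) (c + \<alpha> *\<^sub>R t) * E (a1 + a2) (d + \<beta> *\<^sub>R t) \<partial>lborel)\<^sup>2
      \<le> (e * (\<integral>\<^sup>+ t. E a2 (c + \<alpha> *\<^sub>R t) * E a2 (d + \<beta> *\<^sub>R t) \<partial>lborel))\<^sup>2"
    by (rule power_mono) simp
  also have "\<dots> = e\<^sup>2 * (\<integral>\<^sup>+ t. E a2 (c + \<alpha> *\<^sub>R t) * E a2 (d + \<beta> *\<^sub>R t) \<partial>lborel)\<^sup>2"
    by (rule power_mult_distrib)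
  also have "\<dots> \<le> e\<^sup>2 * ((\<integral>\<^sup>+ t. (E a2 (c + \<alpha> *\<^sub>R t))\<^sup>2 \<partial>lborel) * (\<integral>\<^sup>+ t. (E a2 (d + \<beta> *\<^sub>R t))\<^sup>2 \<partial>lborel))"
    by (intro mult_left_mono Cauchy_Schwarz_nn_integral) measurable
  also have "\<dots> = (e\<^sup>2 * ennreal (1 / \<bar>\<alpha>\<bar> ^ CARD('n)) * ennreal (1 / \<bar>\<beta>\<bar> ^ CARD('n))) * (\<integral>\<^sup>+ s. E (2 * a2) s \<partial>lborel)\<^sup>2"
    unfolding sq aff[OF ab(1)] aff[OF ab(2)] by (simp add: power2_eq_square mult_ac)
  also have "e\<^sup>2 * ennreal (1 / \<bar>\<alpha>\<bar> ^ CARD('n)) * ennreal (1 / \<bar>\<beta>\<bar> ^ CARD('n))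
      = ennreal (exp (- 2 * a1 * \<omega> (norm x)) / (\<bar>\<alpha>\<bar> * \<bar>\<beta>\<bar>) ^ CARD('n))"
    unfolding e_def by (simp add: ennreal_power exp_double[symmetric] ennreal_mult[symmetric] power_mult_distrib mult.assoc)
  finally show ?thesis unfolding E_def by (simp add: mult.assoc)
qed

text \<open>The square of an integral over N dimensions is an integral over 2N dimensions, and the
  weight of a pair is at most K (1 + the sum of the weights). This is how an L2 norm on phase space
  enters an estimate whose integrals run over N variables.\<close>

lemma weight_integral_square_le:
  assumes \<omega>: "weight_function \<omega>" and K: "weight_doubling \<omega> K" and \<mu>: "0 \<le> \<mu>"
  shows "(\<integral>\<^sup>+ s. ennreal (exp (- 2 * (K * \<mu>) * \<omega> (norm (s :: real ^ 'n)))) \<partial>lborel)\<^sup>2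
    \<le> (ennreal (exp (K * \<mu>)) * Lnorm 2 (\<lambda>z :: (real ^ 'n) \<times> (real ^ 'n). exp (- \<mu> * \<omega> (norm z))))\<^sup>2"
proof -
  note [measurable] = borel_measurable_weight_norm[OF \<omega>, where 'a="real ^ 'n"]
    borel_measurable_weight_norm[OF \<omega>, where 'a="(real ^ 'n) \<times> (real ^ 'n)"]
  define h where "h s = ennreal (exp (- 2 * (K * \<mu>) * \<omega> (norm s)))" for s :: "real ^ 'n"
  have [measurable]: "h \<in> borel_measurable borel" unfolding h_def by measurable
  have "(\<integral>\<^sup>+ s. h s \<partial>lborel)\<^sup>2 = (\<integral>\<^sup>+ s. (\<integral>\<^sup>+ t. h s * h t \<partial>lborel) \<partial>lborel)"
    by (simp add: power2_eq_square nn_integral_cmult nn_integral_multc)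
  also have "\<dots> \<le> (\<integral>\<^sup>+ s. (\<integral>\<^sup>+ t. ennreal (exp (K * \<mu>) ^ 2) * ennreal ((norm (exp (- \<mu> * \<omega> (norm (s :: real ^ 'n, t :: real ^ 'n)))))\<^sup>2) \<partial>lborel) \<partial>lborel)"
  proof (intro nn_integral_mono)
    fix s t :: "real ^ 'n"
    have "\<omega> (norm (s, t)) \<le> K * (1 + \<omega> (norm s) + \<omega> (norm t))"
      by (rule weight_norm_le[OF \<omega> K]) (rule norm_Pair_le)
    then have "\<mu> * \<omega> (norm (s, t)) \<le> \<mu> * (K * (1 + \<omega> (norm s) + \<omega> (norm t)))"
      using \<mu> by (rule mult_left_mono)
    then have "exp (- 2 * (K * \<mu>) * \<omega> (norm s) + - 2 * (K * \<mu>) * \<omega> (norm t)) \<le> exp (2 * (K * \<mu>) + 2 * (- \<mu> * \<omega> (norm (s, t))))"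
      by (simp add: algebra_simps)
    also have "\<dots> = exp (K * \<mu>) ^ 2 * (exp (- \<mu> * \<omega> (norm (s, t)))) ^ 2"
      unfolding exp_add exp_double ..
    finally show "h s * h t \<le> ennreal (exp (K * \<mu>) ^ 2) * ennreal ((norm (exp (- \<mu> * \<omega> (norm (s, t)))))\<^sup>2)"
      unfolding h_def exp_add by (simp only: ennreal_mult'[symmetric] exp_ge_zero zero_le_power real_norm_def power2_abs ennreal_leI)
  qed
  also have "\<dots> = (\<integral>\<^sup>+ z. ennreal (exp (K * \<mu>) ^ 2) * ennreal ((norm (exp (- \<mu> * \<omega> (norm z))))\<^sup>2) \<partial>(lborel :: ((real ^ 'n) \<times> (real ^ 'n)) measure))"
    by (rule nn_integral_lborel_fst[symmetric]) measurable
  also have "\<dots> = ennreal (exp (K * \<mu>) ^ 2) * (Lnorm 2 (\<lambda>z :: (real ^ 'n) \<times> (real ^ 'n). exp (- \<mu> * \<omega> (norm z))))\<^sup>2"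
    unfolding Lnorm_2_power2 by (rule nn_integral_cmult) measurable
  also have "\<dots> = (ennreal (exp (K * \<mu>)) * Lnorm 2 (\<lambda>z :: (real ^ 'n) \<times> (real ^ 'n). exp (- \<mu> * \<omega> (norm z))))\<^sup>2"
    by (simp add: power_mult_distrib ennreal_power)
  finally show ?thesis unfolding h_def .
qed

text \<open>Taking moduli discards the oscillation, so this bound decays in x only. The estimate is
  kept squared to match the Cauchy-Schwarz form of
  \<open>weight_product_integral_le\<close>.\<close>

lemma wigner_time_bound:
  fixes g :: "real ^ 'n \<Rightarrow> complex"
  assumes \<omega>: "weight_function \<omega>" and g: "g \<in> wiener_algebra" and \<tau>: "0 < \<tau>" "\<tau> < 1"
    and a: "0 \<le> a1" "0 \<le> a2"
  shows "(ennreal (cmod (wigner \<tau> g (x, \<xi>))))\<^sup>2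
    \<le> Lnorm \<infinity> (weighted \<omega> (a1 + a2) g) ^ 4 * ennreal (exp (- 2 * a1 * \<omega> (norm x)) / (\<tau> - \<tau>\<^sup>2) ^ CARD('n)) *
       (\<integral>\<^sup>+ s. ennreal (exp (- 2 * a2 * \<omega> (norm (s :: real ^ 'n)))) \<partial>lborel)\<^sup>2"
proof -
  note [measurable] = wiener_algebraD(5)[OF g] borel_measurable_weight_norm[OF \<omega>, where 'a="real ^ 'n"]
  note sup = weighted_sup_bound[OF \<omega> wiener_algebraD(1)[OF g], of _ "a1 + a2"]
  define G where "G = Lnorm \<infinity> (weighted \<omega> (a1 + a2) g)"
  let ?e = "\<lambda>y. ennreal (exp (- (a1 + a2) * \<omega> (norm y)))"
  let ?u = "\<lambda>t. x + \<tau> *\<^sub>R t" and ?v = "\<lambda>t. x + (- (1 - \<tau>)) *\<^sub>R t"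
  have "ennreal (cmod (wigner \<tau> g (x, \<xi>)))
      \<le> (\<integral>\<^sup>+ t. ennreal (cmod (exp (- \<i> * of_real (t \<bullet> \<xi>)) * g (?u t) * cnj (g (?v t)))) \<partial>lborel)"
    unfolding wigner_def prod.case add_scaleR_neg by (rule integral_norm_bound_nn)
  also have "\<dots> \<le> (\<integral>\<^sup>+ t. G\<^sup>2 * (?e (?u t) * ?e (?v t)) \<partial>lborel)"
  proof (intro nn_integral_mono)
    fix t
    have "ennreal (cmod (exp (- \<i> * of_real (t \<bullet> \<xi>)) * g (?u t) * cnj (g (?v t)))) = ennreal (cmod (g (?u t))) * ennreal (cmod (g (?v t)))"
      by (simp add: norm_mult ennreal_mult)
    also have "\<dots> \<le> (?e (?u t) * G) * (?e (?v t) * G)"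
      unfolding G_def by (intro mult_mono sup) auto
    finally show "ennreal (cmod (exp (- \<i> * of_real (t \<bullet> \<xi>)) * g (?u t) * cnj (g (?v t)))) \<le> G\<^sup>2 * (?e (?u t) * ?e (?v t))"
      by (simp add: power2_eq_square mult_ac)
  qed
  also have "\<dots> = G\<^sup>2 * (\<integral>\<^sup>+ t. ?e (?u t) * ?e (?v t) \<partial>lborel)"
    by (rule nn_integral_cmult) measurable
  finally have "(ennreal (cmod (wigner \<tau> g (x, \<xi>))))\<^sup>2 \<le> (G\<^sup>2 * (\<integral>\<^sup>+ t. ?e (?u t) * ?e (?v t) \<partial>lborel))\<^sup>2"
    by (rule power_mono) simp
  also have "\<dots> = G ^ 4 * (\<integral>\<^sup>+ t. ?e (?u t) * ?e (?v t) \<partial>lborel)\<^sup>2"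
    by (simp add: power_mult_distrib flip: power_mult)
  also have "\<dots> \<le> G ^ 4 * (ennreal (exp (- 2 * a1 * \<omega> (norm x)) / (\<bar>\<tau>\<bar> * \<bar>- (1 - \<tau>)\<bar>) ^ CARD('n)) *
       (\<integral>\<^sup>+ s. ennreal (exp (- 2 * a2 * \<omega> (norm (s :: real ^ 'n)))) \<partial>lborel)\<^sup>2)"
  proof (intro mult_left_mono weight_product_integral_le[OF \<omega> a])
    fix t
    \<comment> \<open>The convex weights are swapped against the shifts \<tau> and 1 - \<tau>, so
      that the multiples of t cancel.\<close>
    have "(1 - \<tau>) *\<^sub>R ?u t + (1 - (1 - \<tau>)) *\<^sub>R ?v t = x" by (simp add: algebra_simps)
    then show "norm x \<le> max (norm (?u t)) (norm (?v t))"
      using norm_convex_combination_le_max[of "1 - \<tau>" "?u t" "?v t"] \<tau> by simp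
  qed (use \<tau> in auto)
  also have "\<bar>\<tau>\<bar> * \<bar>- (1 - \<tau>)\<bar> = \<tau> - \<tau>\<^sup>2" using \<tau> by (simp add: algebra_simps power2_eq_square)
  finally show ?thesis unfolding G_def by (simp only: mult.assoc)
qed

lemma cmod_fourier_affine:
  fixes f :: "real ^ 'n \<Rightarrow> complex"
  assumes "c \<noteq> 0"
  shows "cmod (fourier (\<lambda>x. f (t + c *\<^sub>R x)) \<xi>) = \<bar>1 / c\<bar> ^ CARD('n) * cmod (fourier f ((1 / c) *\<^sub>R \<xi>))"
  unfolding fourier_affine[OF assms] by (simp add: norm_mult power_abs)

text \<open>As a function of \<xi> the Wigner transform is the Fourier transform of a product, hence
  a convolution of affine copies of \<open>fourier g\<close> and its conjugate. This has the form of
  the time-side integral, with \<xi> taking over the role of x.\<close>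

lemma wigner_freq_bound:
  fixes g :: "real ^ 'n \<Rightarrow> complex"
  assumes \<omega>: "weight_function \<omega>" and g: "g \<in> wiener_algebra" and Fg: "continuous_on UNIV (fourier g)"
    and \<tau>: "0 < \<tau>" "\<tau> < 1" and a: "0 \<le> a1" "0 \<le> a2"
  shows "(ennreal (cmod (wigner \<tau> g (x, \<xi>))))\<^sup>2
    \<le> Lnorm \<infinity> (weighted \<omega> (a1 + a2) (fourier g)) ^ 4 *
       ennreal (exp (- 2 * a1 * \<omega> (norm \<xi>)) / ((2 * pi) ^ (2 * CARD('n)) * (\<tau> - \<tau>\<^sup>2) ^ CARD('n))) *
       (\<integral>\<^sup>+ s. ennreal (exp (- 2 * a2 * \<omega> (norm (s :: real ^ 'n)))) \<partial>lborel)\<^sup>2"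
proof -
  note [measurable] = borel_measurable_continuous_onI[OF Fg] borel_measurable_weight_norm[OF \<omega>, where 'a="real ^ 'n"]
  note sup = weighted_sup_bound[OF \<omega> Fg, of _ "a1 + a2"]
  define G where "G = Lnorm \<infinity> (weighted \<omega> (a1 + a2) (fourier g))"
  let ?e = "\<lambda>y. ennreal (exp (- (a1 + a2) * \<omega> (norm y)))"
  let ?A = "\<lambda>t. g (x + \<tau> *\<^sub>R t)" and ?B = "\<lambda>t. g (x + (- (1 - \<tau>)) *\<^sub>R t)"
  \<comment> \<open>The points where \<open>fourier g\<close> is evaluated: (\<xi> - \<theta>) /
    \<tau> from the plain slot and \<theta> / (1 - \<tau>) from the conjugated one, where the
    reflection caused by conjugation cancels the sign of -(1 - \<tau>).\<close>
  let ?u = "\<lambda>\<theta>. (1 / \<tau>) *\<^sub>R \<xi> + (- (1 / \<tau>)) *\<^sub>R \<theta>" and ?v = "\<lambda>\<theta>. 0 + (1 / (1 - \<tau>)) *\<^sub>R \<theta>"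
  define D where "D = 1 / (2 * pi) ^ CARD('n) * (1 / (\<tau> - \<tau>\<^sup>2) ^ CARD('n))"
  have \<tau>2: "0 < \<tau> - \<tau>\<^sup>2" using \<tau> by (simp add: power2_eq_square)
  then have D0: "0 \<le> D" by (simp add: D_def)
  have A: "cmod (fourier ?A (\<xi> - \<theta>)) = (1 / \<tau>) ^ CARD('n) * cmod (fourier g (?u \<theta>))" for \<theta>
    using \<tau> by (subst cmod_fourier_affine) (auto simp: scaleR_diff_right)
  have B: "cmod (fourier (\<lambda>t. cnj (?B t)) \<theta>) = (1 / (1 - \<tau>)) ^ CARD('n) * cmod (fourier g (?v \<theta>))" for \<theta>
  proof -
    have "\<bar>1 / (- (1 - \<tau>))\<bar> = 1 / (1 - \<tau>)" unfolding divide_minus_right abs_minus_cancel using \<tau> by simp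
    moreover have "(1 / (- (1 - \<tau>))) *\<^sub>R (- \<theta>) = ?v \<theta>"
      unfolding divide_minus_right by simp
    ultimately show ?thesis
      unfolding fourier_cnj complex_mod_cnj using cmod_fourier_affine[of "- (1 - \<tau>)" g x "- \<theta>"] \<tau> by simp
  qed
  have "\<tau> ^ CARD('n) * (1 - \<tau>) ^ CARD('n) = (\<tau> - \<tau>\<^sup>2) ^ CARD('n)"
    unfolding power_mult_distrib[symmetric] by (simp add: algebra_simps power2_eq_square)
  then have scal: "1 / (2 * pi) ^ CARD('n) * ((1 / (1 - \<tau>)) ^ CARD('n) * (1 / \<tau>) ^ CARD('n)) = D"
    unfolding D_def by (simp add: power_divide mult.commute)
  have "wigner \<tau> g (x, \<xi>) = of_real (1 / (2 * pi) ^ CARD('n)) * (\<integral>\<theta>. fourier (\<lambda>t. cnj (?B t)) \<theta> * fourier ?A (\<xi> - \<theta>) \<partial>lborel)"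
    unfolding wigner_eq_cross_wigner cross_wigner_eq_fourier
    by (rule fourier_mult) (use g \<tau> in \<open>auto intro!: wiener_algebra_cnj wiener_algebra_affine[OF g] wiener_algebraD(3)[OF wiener_algebra_affine[OF g]]\<close>)
  then have "ennreal (cmod (wigner \<tau> g (x, \<xi>)))
      = ennreal (1 / (2 * pi) ^ CARD('n)) * ennreal (cmod (\<integral>\<theta>. fourier (\<lambda>t. cnj (?B t)) \<theta> * fourier ?A (\<xi> - \<theta>) \<partial>lborel))"
    by (simp add: norm_mult norm_divide norm_power ennreal_mult'[symmetric])
  also have "\<dots> \<le> ennreal (1 / (2 * pi) ^ CARD('n)) * (\<integral>\<^sup>+ \<theta>. ennreal (cmod (fourier (\<lambda>t. cnj (?B t)) \<theta> * fourier ?A (\<xi> - \<theta>))) \<partial>lborel)"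
    by (intro mult_left_mono integral_norm_bound_nn) auto
  also have "\<dots> \<le> ennreal (1 / (2 * pi) ^ CARD('n)) * (\<integral>\<^sup>+ \<theta>. ennreal ((1 / (1 - \<tau>)) ^ CARD('n) * (1 / \<tau>) ^ CARD('n)) * G\<^sup>2 * (?e (?u \<theta>) * ?e (?v \<theta>)) \<partial>lborel)"
  proof (intro mult_left_mono nn_integral_mono)
    fix \<theta>
    let ?c = "(1 / (1 - \<tau>)) ^ CARD('n) * (1 / \<tau>) ^ CARD('n)"
    have "ennreal (cmod (fourier (\<lambda>t. cnj (?B t)) \<theta> * fourier ?A (\<xi> - \<theta>)))
        = ennreal ?c * (ennreal (cmod (fourier g (?u \<theta>))) * ennreal (cmod (fourier g (?v \<theta>))))"
      unfolding norm_mult A B using \<tau> by (simp add: ennreal_mult'[symmetric] mult_ac)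
    also have "\<dots> \<le> ennreal ?c * ((?e (?u \<theta>) * G) * (?e (?v \<theta>) * G))"
      unfolding G_def by (intro mult_left_mono mult_mono sup) auto
    finally show "ennreal (cmod (fourier (\<lambda>t. cnj (?B t)) \<theta> * fourier ?A (\<xi> - \<theta>))) \<le> ennreal ?c * G\<^sup>2 * (?e (?u \<theta>) * ?e (?v \<theta>))"
      by (simp add: power2_eq_square mult_ac)
  qed auto
  also have "\<dots> = ennreal (1 / (2 * pi) ^ CARD('n)) * (ennreal ((1 / (1 - \<tau>)) ^ CARD('n) * (1 / \<tau>) ^ CARD('n)) * G\<^sup>2 * (\<integral>\<^sup>+ \<theta>. ?e (?u \<theta>) * ?e (?v \<theta>) \<partial>lborel))"
    by (subst nn_integral_cmult) measurable
  also have "\<dots> = ennreal D * G\<^sup>2 * (\<integral>\<^sup>+ \<theta>. ?e (?u \<theta>) * ?e (?v \<theta>) \<partial>lborel)"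
  proof -
    have "ennreal D = ennreal (1 / (2 * pi) ^ CARD('n)) * ennreal ((1 / (1 - \<tau>)) ^ CARD('n) * (1 / \<tau>) ^ CARD('n))"
      unfolding scal[symmetric] by (rule ennreal_mult') simp
    then show ?thesis by (simp only: mult.assoc)
  qed
  finally have "(ennreal (cmod (wigner \<tau> g (x, \<xi>))))\<^sup>2 \<le> (ennreal D * G\<^sup>2 * (\<integral>\<^sup>+ \<theta>. ?e (?u \<theta>) * ?e (?v \<theta>) \<partial>lborel))\<^sup>2"
    by (rule power_mono) simp
  also have "\<dots> = ennreal (D\<^sup>2) * G ^ 4 * (\<integral>\<^sup>+ \<theta>. ?e (?u \<theta>) * ?e (?v \<theta>) \<partial>lborel)\<^sup>2"
    using D0 by (simp add: power_mult_distrib ennreal_power flip: power_mult)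
  also have "\<dots> \<le> ennreal (D\<^sup>2) * G ^ 4 * (ennreal (exp (- 2 * a1 * \<omega> (norm \<xi>)) / (\<bar>- (1 / \<tau>)\<bar> * \<bar>1 / (1 - \<tau>)\<bar>) ^ CARD('n)) *
       (\<integral>\<^sup>+ s. ennreal (exp (- 2 * a2 * \<omega> (norm (s :: real ^ 'n)))) \<partial>lborel)\<^sup>2)"
  proof (intro mult_left_mono weight_product_integral_le[OF \<omega> a])
    fix \<theta>
    have "\<tau> *\<^sub>R ?u \<theta> + (1 - \<tau>) *\<^sub>R ?v \<theta> = \<xi>" using \<tau> by (simp add: algebra_simps)
    then show "norm \<xi> \<le> max (norm (?u \<theta>)) (norm (?v \<theta>))"
      using norm_convex_combination_le_max[of \<tau> "?u \<theta>" "?v \<theta>"] \<tau> by simp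
  qed (use \<tau> in auto)
  \<comment> \<open>The substitution contributes the Jacobian inverted, a factor (\<tau> -
    \<tau>^2)^N; against (\<tau> - \<tau>^2)^(-2N) from the square of \<open>D\<close> this leaves
    the same power as on the time side.\<close>
  also have "\<bar>- (1 / \<tau>)\<bar> * \<bar>1 / (1 - \<tau>)\<bar> = 1 / (\<tau> - \<tau>\<^sup>2)" using \<tau> by (simp add: algebra_simps power2_eq_square)
  also have "ennreal (D\<^sup>2) * G ^ 4 * (ennreal (exp (- 2 * a1 * \<omega> (norm \<xi>)) / (1 / (\<tau> - \<tau>\<^sup>2)) ^ CARD('n)) *
       (\<integral>\<^sup>+ s. ennreal (exp (- 2 * a2 * \<omega> (norm (s :: real ^ 'n)))) \<partial>lborel)\<^sup>2)
     = G ^ 4 * ennreal (D\<^sup>2 * (exp (- 2 * a1 * \<omega> (norm \<xi>)) / (1 / (\<tau> - \<tau>\<^sup>2)) ^ CARD('n))) *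
       (\<integral>\<^sup>+ s. ennreal (exp (- 2 * a2 * \<omega> (norm (s :: real ^ 'n)))) \<partial>lborel)\<^sup>2"
    by (subst ennreal_mult') (simp, simp only: mult_ac)
  also have "D\<^sup>2 * (exp (- 2 * a1 * \<omega> (norm \<xi>)) / (1 / (\<tau> - \<tau>\<^sup>2)) ^ CARD('n))
      = exp (- 2 * a1 * \<omega> (norm \<xi>)) / ((2 * pi) ^ (2 * CARD('n)) * (\<tau> - \<tau>\<^sup>2) ^ CARD('n))"
  proof -
    have "(1 / P * (1 / T))\<^sup>2 * (e / (1 / T)) = e / (P * P * T)" if "0 < P" "0 < T" for P T e :: real
      using that by (simp add: field_simps power2_eq_square)
    from this[of "(2 * pi) ^ CARD('n)" "(\<tau> - \<tau>\<^sup>2) ^ CARD('n)"] \<tau>2 show ?thesis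
      unfolding D_def mult_2 power_add power_one_over by simp
  qed
  finally show ?thesis unfolding G_def .
qed

text \<open>The time-side bound decays in x, the frequency-side one in \<xi>; multiplying the two
  squared bounds and taking the fourth root keeps half of each rate, one factor each of the norms of
  g and \<open>fourier g\<close>, and (2 pi)^(-N/2).\<close>

lemma wigner_weight_bound:
  fixes g :: "real ^ 'n \<Rightarrow> complex"
  assumes \<omega>: "weight_function \<omega>" and K: "weight_doubling \<omega> K" and g: "g \<in> wiener_algebra"
    and Fg: "continuous_on UNIV (fourier g)"
    and \<tau>: "0 < \<tau>" "\<tau> < 1" and a: "0 \<le> a1" "0 \<le> \<mu>"
  shows "ennreal (cmod (wigner \<tau> g (x, \<xi>)))
    \<le> ennreal (exp (K * \<mu> - a1 / 2 * (\<omega> (norm x) + \<omega> (norm \<xi>))) / ((2 * pi) powr (real CARD('n) / 2) * (\<tau> - \<tau>\<^sup>2) powr (real CARD('n) / 2))) *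
       Lnorm \<infinity> (weighted \<omega> (a1 + K * \<mu>) g) * Lnorm \<infinity> (weighted \<omega> (a1 + K * \<mu>) (fourier g)) *
       Lnorm 2 (\<lambda>z :: (real ^ 'n) \<times> (real ^ 'n). exp (- \<mu> * \<omega> (norm z)))"
proof (rule ennreal_power_le_imp_le[where n=4])
  have K1: "1 \<le> K" using K by (simp add: weight_doubling_def)
  have \<tau>2: "0 < \<tau> - \<tau>\<^sup>2" using \<tau> by (simp add: power2_eq_square)
  let ?W = "ennreal (cmod (wigner \<tau> g (x, \<xi>)))"
  let ?I = "\<integral>\<^sup>+ s. ennreal (exp (- 2 * (K * \<mu>) * \<omega> (norm (s :: real ^ 'n)))) \<partial>lborel"
  let ?G = "Lnorm \<infinity> (weighted \<omega> (a1 + K * \<mu>) g)" and ?H = "Lnorm \<infinity> (weighted \<omega> (a1 + K * \<mu>) (fourier g))"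
  let ?L = "Lnorm 2 (\<lambda>z :: (real ^ 'n) \<times> (real ^ 'n). exp (- \<mu> * \<omega> (norm z)))"
  let ?N = "CARD('n)"
  have Km: "0 \<le> K * \<mu>" using K1 a by simp
  have P: "(y powr (real ?N / 2)) ^ 4 = y ^ (2 * ?N)" if "0 < y" for y :: real
  proof -
    have "(y powr (real ?N / 2)) ^ 4 = y powr (4 * (real ?N / 2))"
      using that by (simp add: powr_powr flip: powr_numeral)
    also have "\<dots> = y powr real (2 * ?N)" by simp
    also have "\<dots> = y ^ (2 * ?N)" using that by (rule powr_realpow)
    finally show ?thesis .
  qed
  define c1 where "c1 = exp (- 2 * a1 * \<omega> (norm x)) / (\<tau> - \<tau>\<^sup>2) ^ ?N"
  define c2 where "c2 = exp (- 2 * a1 * \<omega> (norm \<xi>)) / ((2 * pi) ^ (2 * ?N) * (\<tau> - \<tau>\<^sup>2) ^ ?N)"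
  define E where "E = exp (K * \<mu> - a1 / 2 * (\<omega> (norm x) + \<omega> (norm \<xi>))) / ((2 * pi) powr (real ?N / 2) * (\<tau> - \<tau>\<^sup>2) powr (real ?N / 2))"
  have c: "0 \<le> c1" "0 \<le> c2" "0 \<le> E" using \<tau>2 by (auto simp: c1_def c2_def E_def)
  have "?W ^ 4 = ?W\<^sup>2 * ?W\<^sup>2" by (simp flip: power_add)
  also have "\<dots> \<le> (?G ^ 4 * ennreal c1 * ?I\<^sup>2) * (?H ^ 4 * ennreal c2 * ?I\<^sup>2)"
    unfolding c1_def c2_def
    by (rule mult_mono[OF wigner_time_bound[OF \<omega> g \<tau> a(1) Km] wigner_freq_bound[OF \<omega> g Fg \<tau> a(1) Km]]) auto
  also have "\<dots> = ennreal (c1 * c2) * (?G * ?H) ^ 4 * (?I\<^sup>2)\<^sup>2"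
    using c by (simp add: ennreal_mult power_mult_distrib power2_eq_square mult_ac)
  also have "\<dots> \<le> ennreal (c1 * c2) * (?G * ?H) ^ 4 * ((ennreal (exp (K * \<mu>)) * ?L)\<^sup>2)\<^sup>2"
    by (intro mult_left_mono power_mono[OF weight_integral_square_le[OF \<omega> K a(2)]]) auto
  also have "\<dots> = ennreal (c1 * c2 * exp (K * \<mu>) ^ 4) * (?G * ?H * ?L) ^ 4"
    using c by (simp add: ennreal_mult ennreal_power power_mult_distrib mult_ac flip: power_mult)
  also have "c1 * c2 * exp (K * \<mu>) ^ 4 = E ^ 4"
  proof -
    have "exp (- 2 * a1 * \<omega> (norm x)) * exp (- 2 * a1 * \<omega> (norm \<xi>)) * exp (K * \<mu>) ^ 4
        = exp (K * \<mu> - a1 / 2 * (\<omega> (norm x) + \<omega> (norm \<xi>))) ^ 4"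
      unfolding exp_of_nat_mult[symmetric] exp_add[symmetric] by (rule arg_cong[where f=exp]) (simp add: algebra_simps)
    moreover have "((2 * pi) powr (real ?N / 2) * (\<tau> - \<tau>\<^sup>2) powr (real ?N / 2)) ^ 4
        = (\<tau> - \<tau>\<^sup>2) ^ ?N * ((2 * pi) ^ (2 * ?N) * (\<tau> - \<tau>\<^sup>2) ^ ?N)"
    proof -
      have "0 < 2 * pi" by simp
      then have "((2 * pi) powr (real ?N / 2) * (\<tau> - \<tau>\<^sup>2) powr (real ?N / 2)) ^ 4
        = (2 * pi) ^ (2 * ?N) * (\<tau> - \<tau>\<^sup>2) ^ (2 * ?N)"
        using \<tau>2 by (simp only: power_mult_distrib[of _ _ 4] P)
      also have "(\<tau> - \<tau>\<^sup>2) ^ (2 * ?N) = (\<tau> - \<tau>\<^sup>2) ^ ?N * (\<tau> - \<tau>\<^sup>2) ^ ?N"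
        by (simp only: mult_2 power_add)
      finally show ?thesis by (simp only: mult_ac)
    qed
    ultimately show ?thesis
      unfolding c1_def c2_def E_def power_divide by (simp add: mult_ac)
  qed
  also have "ennreal (E ^ 4) * (?G * ?H * ?L) ^ 4 = (ennreal E * ?G * ?H * ?L) ^ 4"
    using c by (simp add: power_mult_distrib ennreal_power mult_ac)
  finally show "?W ^ 4 \<le> (ennreal (exp (K * \<mu> - a1 / 2 * (\<omega> (norm x) + \<omega> (norm \<xi>))) / ((2 * pi) powr (real ?N / 2) * (\<tau> - \<tau>\<^sup>2) powr (real ?N / 2))) * ?G * ?H * ?L) ^ 4"
    unfolding E_def .
qed simp

section \<open>From the spectrogram to the Wigner transform\<close>

lemma norm_Pair_scaleR_le:
  fixes x y :: "'a::real_normed_vector"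
  assumes "\<bar>s\<bar> \<le> 1" "\<bar>t\<bar> \<le> 1"
  shows "norm (s *\<^sub>R x, t *\<^sub>R y) \<le> norm (x, y)"
proof -
  have "\<bar>s\<bar> * norm x \<le> norm x" "\<bar>t\<bar> * norm y \<le> norm y"
    using assms by (simp_all add: mult_left_le_one_le)
  then have "(norm (s *\<^sub>R x))\<^sup>2 + (norm (t *\<^sub>R y))\<^sup>2 \<le> (norm x)\<^sup>2 + (norm y)\<^sup>2"
    unfolding norm_scaleR by (intro add_mono power_mono) auto
  then show ?thesis by (simp add: norm_Pair)
qed

text \<open>The point (x, \<xi>) is (x', \<xi>') plus componentwise contractions of z and w. One use
  of doubling separates (x', \<xi>') from the sum of the lengths of z and w, and a second splits
  each of these two; the constants add up to K + 2 K^2.\<close>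

lemma weight_phase_shift_le:
  fixes x \<xi> :: "real ^ 'n" and z w :: "(real ^ 'n) \<times> (real ^ 'n)"
  assumes \<omega>: "weight_function \<omega>" and K: "weight_doubling \<omega> K" and \<tau>: "0 < \<tau>" "\<tau> < 1"
  defines "x' \<equiv> x - (1 - \<tau>) *\<^sub>R fst z - \<tau> *\<^sub>R fst w" and "\<xi>' \<equiv> \<xi> - \<tau> *\<^sub>R snd z - (1 - \<tau>) *\<^sub>R snd w"
  shows "\<omega> (norm (x, \<xi>)) \<le> K * (1 + 2 * K) + K\<^sup>2 * (\<omega> (norm x') + \<omega> (norm \<xi>')) + K\<^sup>2 * (\<omega> (norm z) + \<omega> (norm w))"
proof -
  have K1: "1 \<le> K" using K by (simp add: weight_doubling_def)
  let ?Tz = "((1 - \<tau>) *\<^sub>R fst z, \<tau> *\<^sub>R snd z)" and ?Tw = "(\<tau> *\<^sub>R fst w, (1 - \<tau>) *\<^sub>R snd w)"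
  have "(x, \<xi>) = (x', \<xi>') + (?Tz + ?Tw)" by (simp add: x'_def \<xi>'_def)
  then have "norm (x, \<xi>) = norm ((x', \<xi>') + (?Tz + ?Tw))" by (rule arg_cong)
  then have "norm (x, \<xi>) \<le> norm (x', \<xi>') + (norm ?Tz + norm ?Tw)"
    using norm_triangle_ineq[of "(x', \<xi>')" "?Tz + ?Tw"] norm_triangle_ineq[of ?Tz ?Tw] by linarith
  moreover have "norm ?Tz \<le> norm z" "norm ?Tw \<le> norm w"
    using norm_Pair_scaleR_le[of "1 - \<tau>" \<tau> "fst z" "snd z"] norm_Pair_scaleR_le[of \<tau> "1 - \<tau>" "fst w" "snd w"] \<tau> by auto
  ultimately have "norm (x, \<xi>) \<le> norm (x', \<xi>') + (norm z + norm w)" by linarith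
  then have "\<omega> (norm (x, \<xi>)) \<le> K * (1 + \<omega> (norm (x', \<xi>')) + \<omega> (norm z + norm w))"
    by (intro weight_add_le[OF \<omega> K]) auto
  also have "\<dots> \<le> K * (1 + K * (1 + \<omega> (norm x') + \<omega> (norm \<xi>')) + K * (1 + \<omega> (norm z) + \<omega> (norm w)))"
    using K1 by (intro mult_left_mono add_mono weight_norm_le[OF \<omega> K] weight_add_le[OF \<omega> K] norm_Pair_le) auto
  finally show ?thesis by (simp add: algebra_simps power2_eq_square)
qed

text \<open>The case of finite \<open>J\<close>: it makes \<open>stft g f\<close> integrable, so the
  double expansion applies. The weight at (x, \<xi>) is then distributed over the displaced point,
  absorbed by the decay of \<open>wigner \<tau> g\<close>, and over z and w, each of which yields
  one factor \<open>J\<close>.\<close>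

lemma wigner_weighted_le:
  fixes f g :: "real ^ 'n \<Rightarrow> complex"
  assumes \<omega>: "weight_function \<omega>" and K: "weight_doubling \<omega> K"
    and f: "f \<in> wiener_algebra" and g: "g \<in> wiener_algebra" and Fg: "continuous_on UNIV (fourier g)"
    and \<tau>: "0 < \<tau>" "\<tau> < 1" and lam: "0 \<le> lam" and \<mu>: "0 \<le> \<mu>"
    and I: "I = (\<integral>y. (cmod (g y))\<^sup>2 \<partial>lborel)" "0 < I"
    and \<nu>: "\<nu> = 4 * K\<^sup>2 * lam + \<mu>"
    and J: "J = (\<integral>\<^sup>+ z. ennreal (exp (K\<^sup>2 * \<nu> * \<omega> (norm z)) * cmod (stft g f z)) \<partial>lborel)" "J \<noteq> \<infinity>"
    and E: "E = exp (K / 2 * (1 + 2 * K) * lam + K * (1 + 2 * K) * \<nu>) / ((2 * pi) powr (real CARD('n) / 2) * (\<tau> - \<tau>\<^sup>2) powr (real CARD('n) / 2))"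
    and B: "B = ennreal E * Lnorm \<infinity> (weighted \<omega> (K\<^sup>2 * \<nu>) g) * Lnorm \<infinity> (weighted \<omega> (K\<^sup>2 * \<nu>) (fourier g)) *
       Lnorm 2 (\<lambda>z :: (real ^ 'n) \<times> (real ^ 'n). exp (- \<mu> * \<omega> (norm z)))"
  shows "ennreal (norm (weighted \<omega> lam (wigner \<tau> f) u)) \<le> ennreal ((1 / ((2 * pi) ^ CARD('n) * I))\<^sup>2) * B * J\<^sup>2"
proof (cases u)
  case (Pair x \<xi>)
  note F = wiener_algebraD[OF f] and G = wiener_algebraD[OF g]
  note [measurable] = F(5) G(5) borel_measurable_weight_norm[OF \<omega>, where 'a="(real ^ 'n) \<times> (real ^ 'n)"]
  have K1: "1 \<le> K" using K by (simp add: weight_doubling_def)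
  define a where "a = K\<^sup>2 * \<nu>"
  define V where "V = stft g f"
  define c where "c = 1 / ((2 * pi) ^ CARD('n) * I)"
  have c0: "0 \<le> c" using I by (simp add: c_def)
  have \<nu>0: "0 \<le> \<nu>" using \<mu> lam by (simp add: \<nu>)
  have a0: "0 \<le> a" using \<nu>0 by (simp add: a_def)
  have [measurable]: "V \<in> borel_measurable borel" unfolding V_def by measurable
  have intV: "integrable lborel V"
  proof (rule integrableI_bounded)
    have "(\<integral>\<^sup>+ z. ennreal (cmod (V z)) \<partial>lborel) \<le> J"
      unfolding J V_def[symmetric] a_def[symmetric]
    proof (intro nn_integral_mono ennreal_leI)
      fix z :: "(real ^ 'n) \<times> (real ^ 'n)"
      have "1 \<le> exp (a * \<omega> (norm z))" using a0 weight_nonneg[OF \<omega>, of "norm z"] by simp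
      from mult_right_mono[OF this, of "cmod (V z)"]
      show "cmod (V z) \<le> exp (a * \<omega> (norm z)) * cmod (V z)" by simp
    qed
    also have "J < \<infinity>" using J(2) by (simp add: top.not_eq_extremum)
    finally show "(\<integral>\<^sup>+ z. ennreal (cmod (V z)) \<partial>lborel) < \<infinity>" .
  qed simp
  have expand: "f s = of_real c * (\<integral>z. V z * tf_shift z g s \<partial>lborel)" for s
    unfolding V_def stft_inversion[OF f g intV[unfolded V_def], symmetric] c_def I(1)[symmetric]
    using I(2) by simp
  obtain b where b: "\<And>x. cmod (g x) \<le> b" using G(2) by (auto simp: bounded_iff)
  define X where "X z w = x - (1 - \<tau>) *\<^sub>R fst z - \<tau> *\<^sub>R fst w" for z w :: "(real ^ 'n) \<times> (real ^ 'n)"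
  define Y where "Y z w = \<xi> - \<tau> *\<^sub>R snd z - (1 - \<tau>) *\<^sub>R snd w" for z w :: "(real ^ 'n) \<times> (real ^ 'n)"
  define e where "e = ennreal (exp (lam * \<omega> (norm (x, \<xi>))))"
  \<comment> \<open>The factor \<open>e\<close> is wanted inside both integrals, but moving it into
    the outer one would call for measurability in z of the inner integral. Writing the pointwise
    bound with the reciprocal \<open>e'\<close> keeps \<open>e\<close> outside and leaves only
    monotonicity.\<close>
  define e' where "e' = ennreal (exp (- (lam * \<omega> (norm (x, \<xi>)))))"
  have ee': "e' * e = 1" unfolding e_def e'_def by (simp add: ennreal_mult'[symmetric] exp_minus_inverse mult.commute)
  define h where "h z = ennreal (exp (a * \<omega> (norm z)))" for z :: "(real ^ 'n) \<times> (real ^ 'n)"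
  have [measurable]: "h \<in> borel_measurable borel" unfolding h_def by measurable
  have [measurable]: "(\<lambda>w. ennreal (cmod (wigner \<tau> g (X z w, Y z w)))) \<in> borel_measurable borel" for z
  proof -
    have m: "wigner \<tau> g \<in> borel_measurable (borel \<Otimes>\<^sub>M borel)" by (simp add: borel_prod)
    have "(\<lambda>w. (X z w, Y z w)) \<in> (borel \<Otimes>\<^sub>M borel) \<rightarrow>\<^sub>M (borel \<Otimes>\<^sub>M borel)"
      unfolding X_def Y_def by measurable
    from measurable_compose[OF this m] show ?thesis by (simp add: borel_prod)
  qed
  have key: "e * ennreal (cmod (wigner \<tau> g (X z w, Y z w))) \<le> B * h z * h w" for z w
  proof -
    \<comment> \<open>Of the total decay rate a of g and its transform, K \<mu> is spent on
      integrability. The remainder is at least 4 K^4 lam, so its half still covers the rate K^2 lam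
      that the weight demands at the displaced point.\<close>
    define a1 where "a1 = a - K * \<mu>"
    have aa: "a = a1 + K * \<mu>" by (simp add: a1_def)
    have "K * \<mu> \<le> K\<^sup>2 * \<mu>"
      using mult_left_mono[OF K1, of "K * \<mu>"] K1 \<mu> by (simp add: power2_eq_square mult_ac)
    then have a1_ge: "4 * K ^ 4 * lam \<le> a1"
      unfolding a1_def a_def \<nu> by (simp add: algebra_simps power2_eq_square power4_eq_xxxx)
    have KK: "1 \<le> K\<^sup>2" using K1 by simp
    have K4: "K\<^sup>2 * lam \<le> K ^ 4 * lam"
      using mult_right_mono[OF mult_left_mono[OF KK, of "K\<^sup>2"] lam] by (simp add: power2_eq_square power4_eq_xxxx)
    have l0: "0 \<le> K\<^sup>2 * lam" using lam by simp
    have a1: "0 \<le> a1" and half: "K\<^sup>2 * lam \<le> a1 / 2" using a1_ge K4 l0 by linarith+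
    have aK: "K\<^sup>2 * lam \<le> a" using half a1 K1 \<mu> unfolding aa by (smt (verit) field_sum_of_halves mult_nonneg_nonneg)
    let ?P = "\<omega> (norm (X z w)) + \<omega> (norm (Y z w))" and ?Q = "\<omega> (norm z) + \<omega> (norm w)"
    have P: "0 \<le> ?P" and Q: "0 \<le> ?Q" using weight_nonneg[OF \<omega>] by (auto intro!: add_nonneg_nonneg)
    have lamK: "lam \<le> 4 * K\<^sup>2 * lam" using mult_right_mono[OF KK lam] lam by linarith
    \<comment> \<open>Two additive constants must fit into the exponent of \<open>E\<close>: K \<mu>
      from \<open>wigner_weight_bound\<close> and K (1 + 2 K) lam from
      \<open>weight_phase_shift_le\<close>. The part K (1 + 2 K) \<nu> absorbs both, because \<nu>
      contains \<mu> and 4 K^2 lam.\<close>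
    have kk: "K * \<mu> + K * (1 + 2 * K) * lam \<le> K / 2 * (1 + 2 * K) * lam + K * (1 + 2 * K) * \<nu>"
    proof -
      have "K * \<mu> \<le> K * (1 + 2 * K) * \<mu>"
        using K1 \<mu> mult_right_mono[of 1 "1 + 2 * K" "K * \<mu>"] by (simp add: mult_ac)
      moreover have "K * (1 + 2 * K) * lam \<le> K * (1 + 2 * K) * (4 * K\<^sup>2 * lam)"
        using K1 lamK by (intro mult_left_mono) auto
      moreover have "0 \<le> K / 2 * (1 + 2 * K) * lam" using K1 lam by simp
      ultimately show ?thesis unfolding \<nu> by (simp add: distrib_left)
    qed
    have "lam * \<omega> (norm (x, \<xi>)) \<le> lam * (K * (1 + 2 * K) + K\<^sup>2 * ?P + K\<^sup>2 * ?Q)"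
      unfolding X_def Y_def by (intro mult_left_mono weight_phase_shift_le[OF \<omega> K \<tau>] lam)
    also have "\<dots> = K * (1 + 2 * K) * lam + K\<^sup>2 * lam * ?P + K\<^sup>2 * lam * ?Q"
      by (simp add: algebra_simps)
    also have "\<dots> \<le> K * (1 + 2 * K) * lam + a1 / 2 * ?P + a * ?Q"
      using half aK P Q by (intro add_mono mult_right_mono order_refl)
    finally have "lam * \<omega> (norm (x, \<xi>)) + (K * \<mu> - a1 / 2 * ?P)
        \<le> (K / 2 * (1 + 2 * K) * lam + K * (1 + 2 * K) * \<nu>) + a * \<omega> (norm z) + a * \<omega> (norm w)"
      using kk by (simp add: distrib_left)
    then have "exp (lam * \<omega> (norm (x, \<xi>)) + (K * \<mu> - a1 / 2 * ?P))
        \<le> exp ((K / 2 * (1 + 2 * K) * lam + K * (1 + 2 * K) * \<nu>) + a * \<omega> (norm z) + a * \<omega> (norm w))"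
      by simp
    then have ex: "exp (lam * \<omega> (norm (x, \<xi>))) * exp (K * \<mu> - a1 / 2 * ?P)
        \<le> exp (K / 2 * (1 + 2 * K) * lam + K * (1 + 2 * K) * \<nu>) * exp (a * \<omega> (norm z)) * exp (a * \<omega> (norm w))"
      unfolding exp_add .
    define d where "d = (2 * pi) powr (real CARD('n) / 2) * (\<tau> - \<tau>\<^sup>2) powr (real CARD('n) / 2)"
    have d: "0 \<le> d" by (simp add: d_def)
    have E0: "0 \<le> E" by (simp add: E)
    have ee: "e * ennreal (exp (K * \<mu> - a1 / 2 * ?P) / d) \<le> ennreal E * h z * h w"
    proof -
      have "e * ennreal (exp (K * \<mu> - a1 / 2 * ?P) / d) = ennreal (exp (lam * \<omega> (norm (x, \<xi>))) * exp (K * \<mu> - a1 / 2 * ?P) / d)"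
        unfolding e_def by (subst ennreal_mult'[symmetric]) auto
      also have "\<dots> \<le> ennreal (exp (K / 2 * (1 + 2 * K) * lam + K * (1 + 2 * K) * \<nu>) * exp (a * \<omega> (norm z)) * exp (a * \<omega> (norm w)) / d)"
        using ex d by (intro ennreal_leI divide_right_mono)
      also have "\<dots> = ennreal (E * exp (a * \<omega> (norm z)) * exp (a * \<omega> (norm w)))"
        by (simp add: E d_def)
      also have "\<dots> = ennreal E * h z * h w"
        unfolding h_def using E0 by (simp add: ennreal_mult)
      finally show ?thesis .
    qed
    let ?GHL = "Lnorm \<infinity> (weighted \<omega> a g) * Lnorm \<infinity> (weighted \<omega> a (fourier g)) *
       Lnorm 2 (\<lambda>z :: (real ^ 'n) \<times> (real ^ 'n). exp (- \<mu> * \<omega> (norm z)))"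
    have "e * ennreal (cmod (wigner \<tau> g (X z w, Y z w))) \<le> e * (ennreal (exp (K * \<mu> - a1 / 2 * ?P) / d) * ?GHL)"
      using wigner_weight_bound[OF \<omega> K g Fg \<tau> a1 \<mu>, of "X z w" "Y z w"]
      unfolding aa[symmetric] d_def[symmetric] by (intro mult_left_mono) (simp_all only: mult.assoc zero_le)
    also have "\<dots> \<le> (ennreal E * h z * h w) * ?GHL"
      unfolding mult.assoc[symmetric] by (intro mult_right_mono ee) auto
    also have "\<dots> = B * h z * h w"
      unfolding B a_def[symmetric] by (simp only: mult_ac)
    finally show ?thesis .
  qed
  have JV: "J = (\<integral>\<^sup>+ z. h z * ennreal (cmod (V z)) \<partial>lborel)"
    unfolding J h_def V_def a_def by (simp add: ennreal_mult)
  have "ennreal (norm (weighted \<omega> lam (wigner \<tau> f) u)) = e * ennreal (cmod (wigner \<tau> f (x, \<xi>)))"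
    unfolding norm_weighted Pair e_def by (simp add: ennreal_mult)
  also have "\<dots> \<le> e * (ennreal \<bar>c\<bar> * (\<integral>\<^sup>+ z. ennreal (cmod (V z)) *
     (ennreal \<bar>c\<bar> * (\<integral>\<^sup>+ w. ennreal (cmod (V w)) * ennreal (cmod (wigner \<tau> g (X z w, Y z w))) \<partial>lborel)) \<partial>lborel))"
    unfolding X_def Y_def by (intro mult_left_mono wigner_expand[OF F(3) intV \<tau> G(3) b expand]) auto
  also have "\<dots> = ennreal c * (e * (\<integral>\<^sup>+ z. ennreal (cmod (V z)) *
     (ennreal c * (\<integral>\<^sup>+ w. ennreal (cmod (V w)) * ennreal (cmod (wigner \<tau> g (X z w, Y z w))) \<partial>lborel)) \<partial>lborel))"
    using c0 by (simp add: mult_ac)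
  also have "\<dots> \<le> ennreal c * (e * (\<integral>\<^sup>+ z. e' * (ennreal c * B * J) * (h z * ennreal (cmod (V z))) \<partial>lborel))"
  proof (intro mult_left_mono nn_integral_mono)
    fix z
    have "e * (\<integral>\<^sup>+ w. ennreal (cmod (V w)) * ennreal (cmod (wigner \<tau> g (X z w, Y z w))) \<partial>lborel)
        = (\<integral>\<^sup>+ w. ennreal (cmod (V w)) * (e * ennreal (cmod (wigner \<tau> g (X z w, Y z w)))) \<partial>lborel)"
      by (subst nn_integral_cmult[symmetric]) (auto simp: mult_ac)
    also have "\<dots> \<le> (\<integral>\<^sup>+ w. ennreal (cmod (V w)) * (B * h z * h w) \<partial>lborel)"
      by (intro nn_integral_mono mult_left_mono key) auto
    also have "\<dots> = (\<integral>\<^sup>+ w. B * h z * (h w * ennreal (cmod (V w))) \<partial>lborel)"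
      by (simp add: mult_ac)
    also have "\<dots> = B * h z * J" unfolding JV by (rule nn_integral_cmult) measurable
    finally have *: "e * (\<integral>\<^sup>+ w. ennreal (cmod (V w)) * ennreal (cmod (wigner \<tau> g (X z w, Y z w))) \<partial>lborel) \<le> B * h z * J" .
    have "e * (ennreal (cmod (V z)) * (ennreal c * (\<integral>\<^sup>+ w. ennreal (cmod (V w)) * ennreal (cmod (wigner \<tau> g (X z w, Y z w))) \<partial>lborel)))
        = ennreal c * ennreal (cmod (V z)) * (e * (\<integral>\<^sup>+ w. ennreal (cmod (V w)) * ennreal (cmod (wigner \<tau> g (X z w, Y z w))) \<partial>lborel))"
      by (simp only: mult_ac)
    also have "\<dots> \<le> ennreal c * ennreal (cmod (V z)) * (B * h z * J)"
      by (intro mult_left_mono *) auto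
    also have "\<dots> = ennreal c * B * J * (h z * ennreal (cmod (V z)))" by (simp only: mult_ac)
    finally have "e' * (e * (ennreal (cmod (V z)) * (ennreal c * (\<integral>\<^sup>+ w. ennreal (cmod (V w)) * ennreal (cmod (wigner \<tau> g (X z w, Y z w))) \<partial>lborel))))
        \<le> e' * (ennreal c * B * J * (h z * ennreal (cmod (V z))))" by (rule mult_left_mono) simp
    then show "ennreal (cmod (V z)) * (ennreal c * (\<integral>\<^sup>+ w. ennreal (cmod (V w)) * ennreal (cmod (wigner \<tau> g (X z w, Y z w))) \<partial>lborel))
        \<le> e' * (ennreal c * B * J) * (h z * ennreal (cmod (V z)))"
      unfolding mult.assoc[symmetric] ee' by (simp only: mult_1_left mult.assoc)
  qed auto
  also have "\<dots> = ennreal c * ((e' * e) * (ennreal c * B * J * J))"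
    by (subst nn_integral_cmult, measurable) (simp only: JV[symmetric] mult_ac)
  also have "\<dots> = ennreal c * (ennreal c * B * J * J)" by (simp add: ee')
  also have "\<dots> = ennreal (c\<^sup>2) * B * J\<^sup>2"
    using c0 by (simp add: power2_eq_square ennreal_mult mult_ac)
  finally show ?thesis unfolding c_def .
qed

text \<open>The factor exp (a \<omega>) is split as exp ((a + \<mu>) \<omega>) times exp (- \<mu>
  \<omega>), the second going into the dual norm. Squaring then turns the transform into the
  spectrogram and doubles the weight exponent.\<close>

lemma stft_weighted_integral_le:
  fixes f g :: "real ^ 'n \<Rightarrow> complex"
  assumes \<omega>: "weight_function \<omega>" and [measurable]: "f \<in> borel_measurable borel" "g \<in> borel_measurable borel"
    and p: "1 \<le> p"
  shows "(\<integral>\<^sup>+ z. ennreal (exp (a * \<omega> (norm z)) * cmod (stft g f z)) \<partial>lborel)\<^sup>2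
    \<le> (Lnorm (conj_exponent (2 * p)) (\<lambda>z :: (real ^ 'n) \<times> (real ^ 'n). exp (- \<mu> * \<omega> (norm z))))\<^sup>2 *
       Lnorm p (weighted \<omega> (2 * (a + \<mu>)) (spectrogram g f))"
proof -
  note [measurable] = borel_measurable_weight_norm[OF \<omega>, where 'a="(real ^ 'n) \<times> (real ^ 'n)"]
  let ?F = "weighted \<omega> (a + \<mu>) (stft g f)"
  let ?h = "\<lambda>z :: (real ^ 'n) \<times> (real ^ 'n). exp (- \<mu> * \<omega> (norm z))"
  have [measurable]: "?F \<in> borel_measurable borel"
    by (intro borel_measurable_weighted \<omega>) measurable
  have p2: "1 \<le> 2 * p" using mult_mono[OF _ p, of 1 2] by simp
  have "exp (a * \<omega> (norm z)) * cmod (stft g f z) = norm (?F z) * norm (?h z)" for z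
    unfolding norm_weighted real_norm_def abs_exp_cancel
    by (simp add: mult_ac exp_add[symmetric] mult.assoc[symmetric] algebra_simps)
  then have "(\<integral>\<^sup>+ z. ennreal (exp (a * \<omega> (norm z)) * cmod (stft g f z)) \<partial>lborel) \<le> Lnorm (2 * p) ?F * Lnorm (conj_exponent (2 * p)) ?h"
    by (simp only:) (rule Lnorm_Holder, measurable, rule p2)
  then have "(\<integral>\<^sup>+ z. ennreal (exp (a * \<omega> (norm z)) * cmod (stft g f z)) \<partial>lborel)\<^sup>2 \<le> (Lnorm (2 * p) ?F * Lnorm (conj_exponent (2 * p)) ?h)\<^sup>2"
    by (rule power_mono) simp
  also have "\<dots> = (Lnorm (conj_exponent (2 * p)) ?h)\<^sup>2 * (Lnorm (2 * p) ?F)\<^sup>2"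
    by (simp only: power_mult_distrib mult.commute)
  also have "(Lnorm (2 * p) ?F)\<^sup>2 = Lnorm p (\<lambda>z. (norm (?F z))\<^sup>2)"
    by (rule Lnorm_power2[OF _ p]) measurable
  also have "\<dots> = Lnorm p (weighted \<omega> (2 * (a + \<mu>)) (spectrogram g f))"
    by (rule Lnorm_cong_norm, unfold norm_weighted)
      (simp only: spectrogram_def power_mult_distrib exp_double mult.assoc real_norm_def abs_mult abs_power2 abs_exp_cancel power_abs[symmetric] abs_norm_cancel)
  finally show ?thesis .
qed

text \<open>Multiplication does not commute with infima in \<open>ennreal\<close> when L is infinite
  and the infimum is 0, since 0 * \<infinity> = 0; the uniform lower bound m excludes this. For L =
  0 a single index is enough, and otherwise P * L is positive and finite and can be divided
  out.\<close>

lemma le_mult_INF_mult_ennreal: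
  fixes y P L m :: ennreal
  assumes le: "\<And>i. i \<in> S \<Longrightarrow> y \<le> P * X i * L" and S: "S \<noteq> {}"
    and m: "0 < m" "\<And>i. i \<in> S \<Longrightarrow> m \<le> X i" and P: "P \<noteq> 0" "P \<noteq> \<infinity>"
  shows "y \<le> P * (INF i\<in>S. X i) * L"
proof -
  have "m \<le> (INF i\<in>S. X i)" by (rule INF_greatest) (rule m(2))
  with m(1) have "(INF i\<in>S. X i) \<noteq> 0" by auto
  show ?thesis
  proof (cases "L = 0 \<or> L = \<infinity>")
    case True
    then show ?thesis
    proof
      assume "L = 0"
      moreover obtain i where "i \<in> S" using S by auto
      ultimately show ?thesis using le[of i] by simp
    next
      assume "L = \<infinity>"
      then show ?thesis using P \<open>(INF i\<in>S. X i) \<noteq> 0\<close> by (simp add: ennreal_mult_top)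
    qed
  next
    case False
    then have "P * L \<noteq> 0" "P * L \<noteq> \<infinity>" using P by (auto simp: ennreal_mult_eq_top_iff)
    then obtain r where r: "P * L = ennreal r" "0 < r" by (cases "P * L") (auto simp: less_le)
    have inv: "ennreal (1 / r) * ennreal r = 1" using r(2) by (simp add: ennreal_mult[symmetric])
    have "ennreal (1 / r) * y \<le> X i" if "i \<in> S" for i
    proof -
      have "ennreal (1 / r) * y \<le> ennreal (1 / r) * (P * X i * L)"
        by (intro mult_left_mono le that) auto
      also have "\<dots> = ennreal (1 / r) * (P * L) * X i" by (simp only: mult_ac)
      also have "\<dots> = X i" unfolding r(1) inv by simp
      finally show ?thesis .
    qed
    then have "ennreal (1 / r) * y \<le> (INF i\<in>S. X i)" by (rule INF_greatest)
    then have "ennreal r * (ennreal (1 / r) * y) \<le> ennreal r * (INF i\<in>S. X i)" by (rule mult_left_mono) simp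
    then have "y \<le> ennreal r * (INF i\<in>S. X i)"
      unfolding mult.assoc[symmetric] mult.commute[of "ennreal r" "ennreal (1 / r)"] inv by simp
    then show ?thesis unfolding r(1)[symmetric] by (simp only: mult_ac)
  qed
qed

section \<open>Positivity of the norms in the constant and the bound for a fixed admissible
  pair\<close>

lemma Lnorm_pos:
  fixes h :: "'a::euclidean_space \<Rightarrow> real"
  assumes "h \<in> borel_measurable borel" "\<And>x. h x \<noteq> 0" "0 < p"
  shows "Lnorm p h \<noteq> 0"
proof
  assume "Lnorm p h = 0"
  from Lnorm_eq_0_AE[OF assms(1,3) this] have "AE x in (lborel :: 'a measure). False"
    using assms(2) by simp
  then have "ae_filter (lborel :: 'a measure) = bot" by (simp add: trivial_limit_def)
  then show False by (simp add: ae_filter_eq_bot_iff)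
qed

lemma Lnorm_infinity_pos:
  assumes "continuous_on UNIV f" "f x \<noteq> 0"
  shows "Lnorm \<infinity> f \<noteq> 0"
  using Lnorm_infinity_ge[OF assms(1), of x] assms(2) by auto

lemma conj_exponent_pos: "0 < conj_exponent p"
proof -
  have "(1 - inverse p) \<noteq> (\<infinity> :: ennreal)"
    by (metis diff_le_self_ennreal ennreal_one_less_top infinity_ennreal_def leD)
  then show ?thesis
    unfolding conj_exponent_def by (cases "1 - inverse p") (auto simp: zero_less_iff_neq_zero)
qed

lemma Lnorm_2_wiener_algebra:
  assumes g: "g \<in> wiener_algebra" and g0: "g x0 \<noteq> 0"
  shows "(Lnorm 2 g)\<^sup>2 = ennreal (\<integral>y. (cmod (g y))\<^sup>2 \<partial>lborel)" and "0 < (\<integral>y. (cmod (g y))\<^sup>2 \<partial>lborel)"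
proof -
  note G = wiener_algebraD[OF g]
  let ?I = "\<integral>y. (cmod (g y))\<^sup>2 \<partial>lborel"
  have "integrable lborel (\<lambda>y. g y * cnj (g y))"
    by (rule wiener_algebraD(3)[OF wiener_algebra_mult[OF g wiener_algebra_cnj[OF g]]])
  then have "integrable lborel (\<lambda>y. of_real ((cmod (g y))\<^sup>2) :: complex)"
    by (simp only: complex_norm_square)
  then have "integrable lborel (\<lambda>y. (cmod (g y))\<^sup>2)"
    by (simp only: complex_of_real_integrable_eq)
  then show L2: "(Lnorm 2 g)\<^sup>2 = ennreal ?I"
    unfolding Lnorm_2_power2 by (intro nn_integral_eq_integral) auto
  have "?I \<noteq> 0"
  proof
    assume "?I = 0"
    with L2 have "Lnorm 2 g = 0" by simp
    from Lnorm_eq_0_AE[OF G(5) _ this] have "AE x in lborel. g x = 0" by simp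
    then have "Lnorm \<infinity> g \<le> 0"
      unfolding Lnorm_infinity using G(5) by (intro esssup_I) auto
    with Lnorm_infinity_pos[OF G(1) g0] show False by simp
  qed
  moreover have "0 \<le> ?I" by (rule integral_nonneg_AE) auto
  ultimately show "0 < ?I" unfolding less_le by metis
qed

text \<open>The estimate for one fixed pair of exponents, with both cases of \<open>J\<close>: a
  finite one goes through the expansion, an infinite one forces the right-hand side to be infinite.
  The infimum is taken afterwards.\<close>

lemma wigner_weighted_le_pair:
  fixes f g :: "real ^ 'n \<Rightarrow> complex"
  assumes \<omega>: "weight_function \<omega>" and K: "weight_doubling \<omega> K"
    and f: "f \<in> wiener_algebra" and g: "g \<in> wiener_algebra" and Fg: "continuous_on UNIV (fourier g)"
    and g0: "g x0 \<noteq> 0" "fourier g \<xi>0 \<noteq> 0"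
    and \<tau>: "0 < \<tau>" "\<tau> < 1" and lam: "0 \<le> lam" and \<mu>': "0 \<le> \<mu>'" and p: "1 \<le> p"
  shows "ennreal (norm (weighted \<omega> lam (wigner \<tau> f) u)) \<le>
    ennreal (exp (K / 2 * (1 + 2 * K) * lam)) /
      (ennreal ((2 * pi) powr (5 / 2 * real CARD('n)) * (\<tau> - \<tau>\<^sup>2) powr (real CARD('n) / 2)) * Lnorm 2 g ^ 4) *
    (ennreal (exp (K * (1 + 2 * K) * (4 * K\<^sup>2 * lam + \<mu>'))) *
      Lnorm \<infinity> (weighted \<omega> (K\<^sup>2 * (4 * K\<^sup>2 * lam + \<mu>')) g) *
      Lnorm \<infinity> (weighted \<omega> (K\<^sup>2 * (4 * K\<^sup>2 * lam + \<mu>')) (fourier g)) *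
      Lnorm 2 (\<lambda>z :: (real ^ 'n) \<times> (real ^ 'n). exp (- \<mu>' * \<omega> (norm z))) *
      (Lnorm (conj_exponent (2 * p)) (\<lambda>z :: (real ^ 'n) \<times> (real ^ 'n). exp (- \<mu>'' * \<omega> (norm z))))\<^sup>2) *
    Lnorm p (weighted \<omega> (8 * K ^ 4 * lam + 2 * (K\<^sup>2 * \<mu>' + \<mu>'')) (spectrogram g f))"
proof -
  note G = wiener_algebraD[OF g]
  note [measurable] = G(5) wiener_algebraD(5)[OF f] borel_measurable_weight_norm[OF \<omega>, where 'a="(real ^ 'n) \<times> (real ^ 'n)"]
  define N where "N = real CARD('n)"
  define I where "I = (\<integral>y. (cmod (g y))\<^sup>2 \<partial>lborel)"
  have L2: "(Lnorm 2 g)\<^sup>2 = ennreal I" and I: "0 < I"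
    unfolding I_def by (rule Lnorm_2_wiener_algebra[OF g g0(1)])+
  define \<nu> where "\<nu> = 4 * K\<^sup>2 * lam + \<mu>'"
  define a where "a = K\<^sup>2 * \<nu>"
  define J where "J = (\<integral>\<^sup>+ z. ennreal (exp (K\<^sup>2 * \<nu> * \<omega> (norm z)) * cmod (stft g f z)) \<partial>lborel)"
  define E where "E = exp (K / 2 * (1 + 2 * K) * lam + K * (1 + 2 * K) * \<nu>) / ((2 * pi) powr (real CARD('n) / 2) * (\<tau> - \<tau>\<^sup>2) powr (real CARD('n) / 2))"
  define GHL where "GHL = Lnorm \<infinity> (weighted \<omega> (K\<^sup>2 * \<nu>) g) * Lnorm \<infinity> (weighted \<omega> (K\<^sup>2 * \<nu>) (fourier g)) *
       Lnorm 2 (\<lambda>z :: (real ^ 'n) \<times> (real ^ 'n). exp (- \<mu>' * \<omega> (norm z)))"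
  define Q where "Q = Lnorm (conj_exponent (2 * p)) (\<lambda>z :: (real ^ 'n) \<times> (real ^ 'n). exp (- \<mu>'' * \<omega> (norm z)))"
  define L where "L = Lnorm p (weighted \<omega> (8 * K ^ 4 * lam + 2 * (K\<^sup>2 * \<mu>' + \<mu>'')) (spectrogram g f))"
  define P where "P = exp (K / 2 * (1 + 2 * K) * lam) / ((2 * pi) powr (5 / 2 * N) * (\<tau> - \<tau>\<^sup>2) powr (N / 2) * I\<^sup>2)"
  define C where "C = exp (K * (1 + 2 * K) * \<nu>)"
  have \<tau>2: "0 < \<tau> - \<tau>\<^sup>2" using \<tau> by (simp add: power2_eq_square)
  have P: "0 < P" using I \<tau>2 by (simp add: P_def)
  have C: "0 < C" by (simp add: C_def)
  have "8 * K ^ 4 * lam + 2 * (K\<^sup>2 * \<mu>' + \<mu>'') = 2 * (a + \<mu>'')"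
    unfolding a_def \<nu>_def by (simp add: algebra_simps power2_eq_square power4_eq_xxxx)
  note L_eq = this
  have JQ: "J\<^sup>2 \<le> Q\<^sup>2 * L"
    using stft_weighted_integral_le[OF \<omega> wiener_algebraD(5)[OF f] G(5) p, of a \<mu>'']
    unfolding J_def Q_def L_def L_eq a_def .
  \<comment> \<open>Needed when \<open>J\<close> is infinite: a vanishing factor would turn the
    infinite right-hand side into 0.\<close>
  have GHL0: "GHL \<noteq> 0"
  proof -
    have "Lnorm \<infinity> (weighted \<omega> (K\<^sup>2 * \<nu>) g) \<noteq> 0"
    proof (rule Lnorm_infinity_pos)
      show "continuous_on UNIV (weighted \<omega> (K\<^sup>2 * \<nu>) g)"
        unfolding weighted_def by (intro continuous_intros continuous_on_weight_norm \<omega> G(1))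
      show "weighted \<omega> (K\<^sup>2 * \<nu>) g x0 \<noteq> 0" using g0 by (simp add: weighted_def)
    qed
    moreover have "Lnorm \<infinity> (weighted \<omega> (K\<^sup>2 * \<nu>) (fourier g)) \<noteq> 0"
    proof (rule Lnorm_infinity_pos)
      show "continuous_on UNIV (weighted \<omega> (K\<^sup>2 * \<nu>) (fourier g))"
        unfolding weighted_def by (intro continuous_intros continuous_on_weight_norm \<omega> Fg)
      show "weighted \<omega> (K\<^sup>2 * \<nu>) (fourier g) \<xi>0 \<noteq> 0" using g0 by (simp add: weighted_def)
    qed
    moreover have "Lnorm 2 (\<lambda>z :: (real ^ 'n) \<times> (real ^ 'n). exp (- \<mu>' * \<omega> (norm z))) \<noteq> 0"
      by (rule Lnorm_pos) auto
    ultimately show ?thesis unfolding GHL_def by simp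
  qed
  have prefactor: "ennreal (exp (K / 2 * (1 + 2 * K) * lam)) /
      (ennreal ((2 * pi) powr (5 / 2 * N) * (\<tau> - \<tau>\<^sup>2) powr (N / 2)) * Lnorm 2 g ^ 4) = ennreal P"
  proof -
    have "Lnorm 2 g ^ 4 = ((Lnorm 2 g)\<^sup>2)\<^sup>2" by (simp flip: power_mult)
    also have "\<dots> = ennreal (I\<^sup>2)" unfolding L2 using I by (simp add: ennreal_power)
    finally have "Lnorm 2 g ^ 4 = ennreal (I\<^sup>2)" .
    then show ?thesis
      unfolding P_def using I \<tau>2 by (simp add: ennreal_mult[symmetric] divide_ennreal)
  qed
  have "ennreal (norm (weighted \<omega> lam (wigner \<tau> f) u)) \<le> ennreal P * ennreal C * GHL * (Q\<^sup>2 * L)"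
  proof (cases "J = \<infinity>")
    case True
    with JQ have "Q\<^sup>2 * L = \<infinity>" by (simp add: top_unique ennreal_top_mult power2_eq_square)
    with GHL0 P C show ?thesis by (simp add: ennreal_mult_top)
  next
    case False
    have "ennreal (norm (weighted \<omega> lam (wigner \<tau> f) u)) \<le> ennreal ((1 / ((2 * pi) ^ CARD('n) * I))\<^sup>2) * (ennreal E * GHL) * J\<^sup>2"
      by (rule wigner_weighted_le[OF \<omega> K f g Fg \<tau> lam \<mu>' I_def I \<nu>_def J_def False E_def])
        (simp only: GHL_def mult.assoc)
    also have "\<dots> = ennreal ((1 / ((2 * pi) ^ CARD('n) * I))\<^sup>2 * E) * GHL * J\<^sup>2"
      by (subst ennreal_mult') (simp, simp only: mult_ac)
    also have "(1 / ((2 * pi) ^ CARD('n) * I))\<^sup>2 * E = P * C"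
    proof -
      \<comment> \<open>The exponent 5N/2 is 2N from inverting in both slots plus N/2 from the
        geometric mean.\<close>
      have "(2 * pi) powr (5 / 2 * N) = (2 * pi) powr (real (2 * CARD('n)) + N / 2)"
        by (simp add: N_def field_simps)
      also have "\<dots> = (2 * pi) ^ (2 * CARD('n)) * (2 * pi) powr (N / 2)"
        by (simp only: powr_add powr_realpow pi_gt_zero zero_less_mult_iff zero_less_numeral simp_thms)
      finally have p5: "(2 * pi) powr (5 / 2 * N) = ((2 * pi) ^ CARD('n))\<^sup>2 * (2 * pi) powr (N / 2)"
        by (simp add: mult.commute[of 2] power_mult)
      show ?thesis
        unfolding P_def C_def E_def p5 N_def[symmetric] exp_add power_divide power_mult_distrib one_power2
        by (simp add: mult_ac)
    qed
    also have "ennreal (P * C) * GHL * J\<^sup>2 \<le> ennreal (P * C) * GHL * (Q\<^sup>2 * L)"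
      by (intro mult_left_mono JQ) auto
    finally show ?thesis using P C by (simp add: ennreal_mult)
  qed
  also have "ennreal P * ennreal C * GHL * (Q\<^sup>2 * L) = ennreal P * (ennreal C * GHL * Q\<^sup>2) * L"
    by (simp only: mult_ac)
  finally show ?thesis
    unfolding prefactor[symmetric] C_def GHL_def Q_def L_def \<nu>_def N_def by (simp only: mult.assoc)
qed

lemma wigner_weighted_le_D6:
  fixes f g :: "real ^ 'n \<Rightarrow> complex"
  assumes \<omega>: "weight_function \<omega>" and K: "weight_doubling \<omega> K" and b: "0 < b"
    and f: "f \<in> wiener_algebra" and g: "g \<in> wiener_algebra" and Fg: "continuous_on UNIV (fourier g)"
    and g0: "g x0 \<noteq> 0"
    and \<tau>: "0 < \<tau>" "\<tau> < 1" and lam: "0 \<le> lam" and p: "1 \<le> p"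
    and \<mu>: "\<mu> > 2 * real CARD('n) / b * (K\<^sup>2 + 2 / enn2real (conj_exponent (2 * p)))"
  shows "Lnorm \<infinity> (weighted \<omega> lam (wigner \<tau> f))
    \<le> D6 \<omega> K b p \<tau> g lam \<mu> * Lnorm p (weighted \<omega> (8 * K ^ 4 * lam + \<mu>) (spectrogram g f))"
proof (rule Lnorm_infinity_le)
  note G = wiener_algebraD[OF g]
  note [measurable] = G(5) wiener_algebraD(5)[OF f] borel_measurable_weight_norm[OF \<omega>, where 'a="(real ^ 'n) \<times> (real ^ 'n)"]
  have K1: "1 \<le> K" using K by (simp add: weight_doubling_def)
  show "weighted \<omega> lam (wigner \<tau> f) \<in> borel_measurable borel"
    by (intro borel_measurable_weighted \<omega>) measurable
  fix u :: "(real ^ 'n) \<times> (real ^ 'n)"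
  define N where "N = real CARD('n)"
  have N0: "0 \<le> N" by (simp add: N_def)
  define q where "q = conj_exponent (2 * p)"
  define S where "S = {(\<mu>', \<mu>''). 2 * (K\<^sup>2 * \<mu>' + \<mu>'') = \<mu> \<and> \<mu>' > N / b \<and> \<mu>'' > 2 * N / (b * enn2real q)}"
  define X where "X = (\<lambda>(\<mu>', \<mu>''). ennreal (exp (K * (1 + 2 * K) * (4 * K\<^sup>2 * lam + \<mu>'))) *
      Lnorm \<infinity> (weighted \<omega> (K\<^sup>2 * (4 * K\<^sup>2 * lam + \<mu>')) g) *
      Lnorm \<infinity> (weighted \<omega> (K\<^sup>2 * (4 * K\<^sup>2 * lam + \<mu>')) (fourier g)) *
      Lnorm 2 (\<lambda>z :: (real ^ 'n) \<times> (real ^ 'n). exp (- \<mu>' * \<omega> (norm z))) *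
      (Lnorm q (\<lambda>z :: (real ^ 'n) \<times> (real ^ 'n). exp (- \<mu>'' * \<omega> (norm z))))\<^sup>2)"
  define P where "P = ennreal (exp (K / 2 * (1 + 2 * K) * lam)) /
      (ennreal ((2 * pi) powr (5 / 2 * N) * (\<tau> - \<tau>\<^sup>2) powr (N / 2)) * Lnorm 2 g ^ 4)"
  define L where "L = Lnorm p (weighted \<omega> (8 * K ^ 4 * lam + \<mu>) (spectrogram g f))"
  have D6: "D6 \<omega> K b p \<tau> g lam \<mu> = P * (INF i\<in>S. X i)"
    unfolding D6_def Let_def P_def S_def X_def N_def q_def by (simp add: case_prod_beta')
  \<comment> \<open>If the transform of g vanished identically, inversion would give g = 0 at
    x0.\<close>
  obtain \<xi>0 where \<xi>0: "fourier g \<xi>0 \<noteq> 0"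
    using fourier_inversion'[OF g, of x0] g0 by fastforce
  have \<tau>2: "0 < \<tau> - \<tau>\<^sup>2" using \<tau> by (simp add: power2_eq_square)
  have "(Lnorm 2 g)\<^sup>2 \<noteq> 0" "(Lnorm 2 g)\<^sup>2 \<noteq> \<infinity>"
    unfolding Lnorm_2_wiener_algebra(1)[OF g g0] using Lnorm_2_wiener_algebra(2)[OF g g0] by simp_all
  then obtain l where "Lnorm 2 g = ennreal l" "0 < l"
    by (cases "Lnorm 2 g") (auto simp: less_le ennreal_power power2_eq_square[of "top :: ennreal"])
  then have P: "P \<noteq> 0" "P \<noteq> \<infinity>"
    unfolding P_def using \<tau>2 by (auto simp: ennreal_power ennreal_divide_eq_0_iff ennreal_divide_eq_top_iff ennreal_mult_eq_top_iff)
  have "S \<noteq> {}"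
  proof -
    \<comment> \<open>The slack \<delta> above the threshold for \<mu> is shared out: \<mu>' exceeds
      N/b by \<delta> / (4 K^2), so that K^2 \<mu>' uses \<delta> / 4 of the half budget \<mu> / 2,
      and \<mu>'' exceeds its own bound by the other \<delta> / 4.\<close>
    define \<delta> where "\<delta> = \<mu> - 2 * N / b * (K\<^sup>2 + 2 / enn2real q)"
    have \<delta>: "0 < \<delta>" using \<mu> by (simp add: \<delta>_def N_def q_def)
    define \<mu>' where "\<mu>' = N / b + \<delta> / (4 * K\<^sup>2)"
    define \<mu>'' where "\<mu>'' = \<mu> / 2 - K\<^sup>2 * \<mu>'"
    have KK: "0 < K\<^sup>2" using K1 by simp
    have "\<mu> = 2 * (N / b * K\<^sup>2) + 4 * (N / (b * enn2real q)) + \<delta>"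
      by (simp add: \<delta>_def distrib_left)
    moreover have "K\<^sup>2 * \<mu>' = N / b * K\<^sup>2 + \<delta> / 4"
      using KK by (simp add: \<mu>'_def distrib_left)
    ultimately have "\<mu>'' = 2 * (N / (b * enn2real q)) + \<delta> / 4"
      unfolding \<mu>''_def by linarith
    then have "(\<mu>', \<mu>'') \<in> S"
      using \<delta> KK by (simp add: S_def) (simp add: \<mu>'_def \<mu>''_def)
    then show ?thesis by auto
  qed
  have bounds: "0 \<le> \<mu>'" "0 \<le> \<mu>''" "\<mu>' \<le> \<mu>" "\<mu>'' \<le> \<mu>" "2 * (K\<^sup>2 * \<mu>' + \<mu>'') = \<mu>" if "(\<mu>', \<mu>'') \<in> S" for \<mu>' \<mu>''
  proof -
    have "0 \<le> N / b" "0 \<le> 2 * N / (b * enn2real q)" using b N0 by auto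
    then show nn: "0 \<le> \<mu>'" "0 \<le> \<mu>''" using that by (auto simp: S_def)
    show eq: "2 * (K\<^sup>2 * \<mu>' + \<mu>'') = \<mu>" using that by (auto simp: S_def)
    have "1 \<le> K\<^sup>2" using K1 by simp
    then have "\<mu>' \<le> K\<^sup>2 * \<mu>'" using nn(1) mult_right_mono[of 1 "K\<^sup>2" \<mu>'] by simp
    moreover have "x \<le> 2 * (y + z)" "z \<le> 2 * (y + z)" if "0 \<le> x" "0 \<le> z" "x \<le> y" for x y z :: real
      using that by simp_all
    ultimately show "\<mu>' \<le> \<mu>" "\<mu>'' \<le> \<mu>"
      unfolding eq[symmetric] using nn by blast+
  qed
  \<comment> \<open>A positive lower bound valid for all admissible pairs: the growing weights on g
    and its transform are dropped, and \<mu>', \<mu>'' are replaced by \<mu>, which dominates both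
    and so gives smaller exponentials.\<close>
  define m where "m = Lnorm \<infinity> g * Lnorm \<infinity> (fourier g) *
      Lnorm 2 (\<lambda>z :: (real ^ 'n) \<times> (real ^ 'n). exp (- \<mu> * \<omega> (norm z))) *
      (Lnorm q (\<lambda>z :: (real ^ 'n) \<times> (real ^ 'n). exp (- \<mu> * \<omega> (norm z))))\<^sup>2"
  have m: "0 < m"
  proof -
    have "Lnorm r (\<lambda>z :: (real ^ 'n) \<times> (real ^ 'n). exp (- \<mu> * \<omega> (norm z))) \<noteq> 0" if "0 < r" for r
      using that by (intro Lnorm_pos) auto
    then show ?thesis
      unfolding m_def q_def using Lnorm_infinity_pos[OF G(1) g0] Lnorm_infinity_pos[OF Fg \<xi>0] conj_exponent_pos[of "2 * p"]
      by (simp add: zero_less_iff_neq_zero)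
  qed
  have mX: "m \<le> X i" if "i \<in> S" for i
  proof -
    obtain \<mu>' \<mu>'' where i: "i = (\<mu>', \<mu>'')" by (cases i)
    note bd = bounds[OF that[unfolded i]]
    define a where "a = K\<^sup>2 * (4 * K\<^sup>2 * lam + \<mu>')"
    have s0: "0 \<le> 4 * K\<^sup>2 * lam + \<mu>'" using lam bd by simp
    then have a0: "0 \<le> a" by (simp add: a_def)
    have "0 \<le> K * (1 + 2 * K)" using K1 by simp
    then have "(1::ennreal) \<le> ennreal (exp (K * (1 + 2 * K) * (4 * K\<^sup>2 * lam + \<mu>')))"
      using mult_nonneg_nonneg[OF _ s0] by simp
    moreover have w: "Lnorm \<infinity> h \<le> Lnorm \<infinity> (weighted \<omega> a h)" if [measurable]: "h \<in> borel_measurable borel" for h :: "real ^ 'n \<Rightarrow> complex"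
    proof (rule Lnorm_mono)
      fix x :: "real ^ 'n"
      have "1 \<le> exp (a * \<omega> (norm x))" using a0 weight_nonneg[OF \<omega>, of "norm x"] by simp
      from mult_right_mono[OF this, of "cmod (h x)"]
      show "cmod (h x) \<le> cmod (weighted \<omega> a h x)" unfolding norm_weighted by simp
    qed measurable
    moreover have e: "Lnorm r (\<lambda>z :: (real ^ 'n) \<times> (real ^ 'n). exp (- \<mu> * \<omega> (norm z))) \<le> Lnorm r (\<lambda>z :: (real ^ 'n) \<times> (real ^ 'n). exp (- s * \<omega> (norm z)))" if "s \<le> \<mu>" for r s
    proof (rule Lnorm_mono)
      fix z :: "(real ^ 'n) \<times> (real ^ 'n)"
      show "norm (exp (- \<mu> * \<omega> (norm z))) \<le> norm (exp (- s * \<omega> (norm z)))"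
        using mult_right_mono[OF that weight_nonneg[OF \<omega>, of "norm z"]] by simp
    qed measurable
    ultimately have "1 * Lnorm \<infinity> g * Lnorm \<infinity> (fourier g) *
        Lnorm 2 (\<lambda>z :: (real ^ 'n) \<times> (real ^ 'n). exp (- \<mu> * \<omega> (norm z))) *
        (Lnorm q (\<lambda>z :: (real ^ 'n) \<times> (real ^ 'n). exp (- \<mu> * \<omega> (norm z))))\<^sup>2 \<le> X i"
      unfolding X_def i prod.case a_def[symmetric]
      using G(5) borel_measurable_continuous_onI[OF Fg] bd by (intro mult_mono power_mono) auto
    then show ?thesis unfolding m_def by simp
  qed
  have "ennreal (norm (weighted \<omega> lam (wigner \<tau> f) u)) \<le> P * X i * L" if "i \<in> S" for i
  proof -
    obtain \<mu>' \<mu>'' where i: "i = (\<mu>', \<mu>'')" by (cases i)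
    note bd = bounds[OF that[unfolded i]]
    show ?thesis
      using wigner_weighted_le_pair[OF \<omega> K f g Fg g0 \<xi>0 \<tau> lam bd(1) p, of u \<mu>'']
      unfolding bd(5) i X_def prod.case P_def L_def N_def q_def .
  qed
  from le_mult_INF_mult_ennreal[OF this \<open>S \<noteq> {}\<close> m mX P]
  show "ennreal (norm (weighted \<omega> lam (wigner \<tau> f) u)) \<le> D6 \<omega> K b p \<tau> g lam \<mu> * L"
    unfolding D6 .
qed

theorem corollary3p7:
  fixes \<omega> :: "real \<Rightarrow> real" and K b \<tau> :: real and p :: ennreal
    and g :: "real ^ 'n \<Rightarrow> complex"
  assumes "weight_function \<omega>" and "weight_doubling \<omega> K" and "weight_log_bound \<omega> b"
    and "1 \<le> p" and "0 < \<tau>" and "\<tau> < 1"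
    and "g \<in> S_omega \<omega>" and "g \<noteq> (\<lambda>_. 0)"
  shows "(\<forall>lam\<ge>0. \<forall>f \<in> S_omega \<omega>.
            Lnorm \<infinity> (weighted \<omega> lam (spectrogram g f))
              \<le> D5 \<omega> K p \<tau> g lam * Lnorm p (weighted \<omega> (K * lam) (wigner \<tau> f))) \<and>
         (\<forall>lam\<ge>0. \<forall>\<mu> > 2 * real CARD('n) / b * (K\<^sup>2 + 2 / enn2real (conj_exponent (2 * p))).
            \<forall>f \<in> S_omega \<omega>.
            Lnorm \<infinity> (weighted \<omega> lam (wigner \<tau> f))
              \<le> D6 \<omega> K b p \<tau> g lam \<mu> *
                 Lnorm p (weighted \<omega> (8 * K ^ 4 * lam + \<mu>) (spectrogram g f)))"
proof (intro conjI allI impI ballI)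
  note g = S_omega_subset_wiener_algebra[OF assms(1,7)]
  obtain x0 where x0: "g x0 \<noteq> 0" using assms(8) by auto
  have b: "0 < b" using assms(3) by (simp add: weight_log_bound_def)
  fix lam :: real and f :: "real ^ 'n \<Rightarrow> complex" assume lam: "0 \<le> lam" and f: "f \<in> S_omega \<omega>"
  note f' = S_omega_subset_wiener_algebra[OF assms(1) f]
  show "Lnorm \<infinity> (weighted \<omega> lam (spectrogram g f))
      \<le> D5 \<omega> K p \<tau> g lam * Lnorm p (weighted \<omega> (K * lam) (wigner \<tau> f))"
    by (rule spectrogram_weighted_le[OF assms(1,2) f' g assms(5,6,4) lam])
  fix \<mu> :: real assume "2 * real CARD('n) / b * (K\<^sup>2 + 2 / enn2real (conj_exponent (2 * p))) < \<mu>"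
  then show "Lnorm \<infinity> (weighted \<omega> lam (wigner \<tau> f))
      \<le> D6 \<omega> K b p \<tau> g lam \<mu> * Lnorm p (weighted \<omega> (8 * K ^ 4 * lam + \<mu>) (spectrogram g f))"
    by (rule wigner_weighted_le_D6[OF assms(1,2) b f' g S_omegaD(3)[OF assms(7)] x0 assms(5,6) lam assms(4)])
qed

end
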